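(* For every $1<p\le 2$ there is a constant $C_p$ such that for all positive integers $N$ and all $f,g\in\ell^p(\mathbb{Z}[i])$, $$|\langle A_Nf,g\rangle|\le C_p\,N^{1-2/p}\,\|f\|_{p}\,\|g\|_{p}.$$ Equivalently, for every $1<p\le 2$ there is a constant $C_p$ such that for all positive integers $N$, whenever $f$ is supported on a cube $Q$ of side length $\sqrt N$, $$\frac{\|A_Nf\|_{p'}}{|Q|^{1/p'}}\le C_p\,\frac{\|f\|_{p}}{|Q|^{1/p}},\qquad \frac1p+\frac1{p'}=1.$$
   Context: For $n=a+ib\in\mathbb{Z}[i]$, $N(n)=a^2+b^2$ (the letter $N$ also denotes an integer parameter). The von Mangoldt function on $\mathbb{Z}[i]$ is $\Lambda(n)=\log N(\rho)$ if $n=\rho^\alpha$ with $\rho\in\mathbb{Z}[i]$ irreducible and $\alpha\geq 1$ an integer, and $\Lambda(n)=0$ otherwise. For $f:\mathbb{Z}[i]\to\mathbb{C}$, $$A_Nf(x)=\frac1N\sum_{N(n)<N}\Lambda(n)f(x-n),\qquad x\in\mathbb{Z}[i].$$ Norms $\|\cdot\|_p$ are $\ell^p(\mathbb{Z}[i])$ norms with counting measure, and $\langle f,g\rangle=\sum_{x\in\mathbb{Z}[i]}f(x)\overline{g(x)}$. A cube of side length $\sqrt N$ is the set of Gaussian integers in a translate of $[0,\sqrt N)^2$ ($\mathbb{C}$ being identified with $\mathbb{R}^2$), and $|Q|$ is its number of points. *)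

theory Defs
  imports "HOL-Analysis.Analysis"
begin

section \<open>The ring of Gaussian integers\<close>

codatatype gauss_int = Gauss_Int (ReZ: int) (ImZ: int)

lemma gauss_int_eqI [intro?]: "ReZ x = ReZ y \<Longrightarrow> ImZ x = ImZ y \<Longrightarrow> x = y"
  by (rule gauss_int.expand) simp

lemma gauss_int_eq_iff: "x = y \<longleftrightarrow> ReZ x = ReZ y \<and> ImZ x = ImZ y"
  by (auto intro: gauss_int.expand)

instantiation gauss_int :: comm_ring_1
begin

primcorec zero_gauss_int :: gauss_int where
  "ReZ 0 = 0"
| "ImZ 0 = 0"

primcorec one_gauss_int :: gauss_int where
  "ReZ 1 = 1"
| "ImZ 1 = 0"

primcorec uminus_gauss_int :: "gauss_int \<Rightarrow> gauss_int" where
  "ReZ (- x) = - ReZ x"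
| "ImZ (- x) = - ImZ x"

primcorec plus_gauss_int :: "gauss_int \<Rightarrow> gauss_int \<Rightarrow> gauss_int" where
  "ReZ (x + y) = ReZ x + ReZ y"
| "ImZ (x + y) = ImZ x + ImZ y"

primcorec minus_gauss_int :: "gauss_int \<Rightarrow> gauss_int \<Rightarrow> gauss_int" where
  "ReZ (x - y) = ReZ x - ReZ y"
| "ImZ (x - y) = ImZ x - ImZ y"

primcorec times_gauss_int :: "gauss_int \<Rightarrow> gauss_int \<Rightarrow> gauss_int" where
  "ReZ (x * y) = ReZ x * ReZ y - ImZ x * ImZ y"
| "ImZ (x * y) = ReZ x * ImZ y + ImZ x * ReZ y"

instance
  by standard (simp_all add: gauss_int_eq_iff algebra_simps)

end

definition gauss_norm :: "gauss_int \<Rightarrow> int" where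
  "gauss_norm n = (ReZ n)\<^sup>2 + (ImZ n)\<^sup>2"

lemma gauss_norm_mult: "gauss_norm (x * y) = gauss_norm x * gauss_norm y"
  by (simp add: gauss_norm_def power2_eq_square algebra_simps)

lemma gauss_norm_eq_0_iff: "gauss_norm x = 0 \<longleftrightarrow> x = 0"
  by (simp add: gauss_norm_def gauss_int_eq_iff sum_power2_eq_zero_iff)

instance gauss_int :: idom
proof
  fix a b :: gauss_int
  assume "a \<noteq> 0" "b \<noteq> 0"
  then show "a * b \<noteq> 0"
    by (metis gauss_norm_mult gauss_norm_eq_0_iff mult_eq_0_iff)
qed

lemma finite_gauss_box: "finite {n. ReZ n \<in> {a..b} \<and> ImZ n \<in> {c..d}}"
proof (rule finite_subset)
  show "{n. ReZ n \<in> {a..b} \<and> ImZ n \<in> {c..d}} \<subseteq> (\<lambda>(x, y). Gauss_Int x y) ` ({a..b} \<times> {c..d})"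
    by (force simp: image_iff gauss_int_eq_iff)
qed simp

lemma finite_gauss_norm_less: "finite {n. gauss_norm n < k}"
proof (rule finite_subset)
  have le: "\<bar>x\<bar> \<le> x\<^sup>2" for x :: int
    using self_le_power[of "\<bar>x\<bar>" 2] by (cases "x = 0") auto
  show "{n. gauss_norm n < k} \<subseteq> {n. ReZ n \<in> {-k..k} \<and> ImZ n \<in> {-k..k}}"
  proof
    fix n assume "n \<in> {n. gauss_norm n < k}"
    then have "(ReZ n)\<^sup>2 + (ImZ n)\<^sup>2 < k" by (simp add: gauss_norm_def)
    with le[of "ReZ n"] le[of "ImZ n"]
    show "n \<in> {n. ReZ n \<in> {-k..k} \<and> ImZ n \<in> {-k..k}}"
      unfolding mem_Collect_eq atLeastAtMost_iff by linarith
  qed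
qed (rule finite_gauss_box)

section \<open>The von Mangoldt function and the averages\<close>

text \<open>
  The equation \<open>n = \<rho>\<^sup>\<alpha>\<close> is literal, not up to units: for instance \<open>2 = -\<i>(1+\<i>)\<^sup>2\<close> is not a power
  of an irreducible element, so the function vanishes there.  By unique factorisation the norm
  of \<open>\<rho>\<close> does not depend on which base \<open>\<rho>\<close> is chosen.
\<close>

definition gauss_mangoldt :: "gauss_int \<Rightarrow> real" where
  "gauss_mangoldt n =
     (if \<exists>\<rho> \<alpha>. irreducible \<rho> \<and> \<alpha> \<ge> 1 \<and> n = \<rho> ^ \<alpha>
      then ln (real_of_int (gauss_norm (SOME \<rho>. irreducible \<rho> \<and> (\<exists>\<alpha>\<ge>1. n = \<rho> ^ \<alpha>))))
      else 0)"

definition gauss_avg :: "nat \<Rightarrow> (gauss_int \<Rightarrow> complex) \<Rightarrow> gauss_int \<Rightarrow> complex" where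
  "gauss_avg N f x =
     1 / of_nat N * (\<Sum>n | gauss_norm n < int N. of_real (gauss_mangoldt n) * f (x - n))"

section \<open>Sequence spaces on the Gaussian integers\<close>

definition in_lp :: "real \<Rightarrow> (gauss_int \<Rightarrow> complex) \<Rightarrow> bool" where
  "in_lp p f \<longleftrightarrow> (\<lambda>x. norm (f x) powr p) summable_on UNIV"

definition lp_norm :: "real \<Rightarrow> (gauss_int \<Rightarrow> complex) \<Rightarrow> real" where
  "lp_norm p f = (\<Sum>\<^sub>\<infinity>x. norm (f x) powr p) powr (1 / p)"

text \<open>
  The series converges absolutely for \<open>f\<close> and \<open>g\<close> in \<open>\<ell>\<^sup>2\<close>, hence in \<open>\<ell>\<^sup>p\<close> with \<open>p \<le> 2\<close>; the averages
  preserve \<open>\<ell>\<^sup>p\<close>, being finite combinations of translations.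
\<close>

definition l2_inner :: "(gauss_int \<Rightarrow> complex) \<Rightarrow> (gauss_int \<Rightarrow> complex) \<Rightarrow> complex" where
  "l2_inner f g = (\<Sum>\<^sub>\<infinity>x. f x * cnj (g x))"

text \<open>The Gaussian integers in the translate \<open>c + [0,s)\<^sup>2\<close>; the corner \<open>c\<close> is an arbitrary complex number.\<close>

definition gauss_cube :: "complex \<Rightarrow> real \<Rightarrow> gauss_int set" where
  "gauss_cube c s =
     {n. real_of_int (ReZ n) \<in> {Re c ..< Re c + s} \<and> real_of_int (ImZ n) \<in> {Im c ..< Im c + s}}"

lemma finite_gauss_cube: "finite (gauss_cube c s)"
proof (rule finite_subset)
  show "gauss_cube c s \<subseteq> {n. ReZ n \<in> {\<lfloor>Re c\<rfloor>..\<lceil>Re c + s\<rceil>} \<and> ImZ n \<in> {\<lfloor>Im c\<rfloor>..\<lceil>Im c + s\<rceil>}}"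
    unfolding gauss_cube_def by (auto; linarith)
qed (rule finite_gauss_box)

end

theory Submission
  imports Defs
begin

text \<open>
  Since the kernel of \<open>A\<^sub>N\<close> is nonnegative, the von Mangoldt function may be replaced by a Selberg
  majorant.  For a Gaussian prime \<open>\<rho>\<close> let \<open>\<psi>\<^sub>\<rho>\<close> be \<open>-1\<close> on the multiples of \<open>\<rho>\<close> and the constant
  \<open>g(\<rho>) = 1/(N(\<rho>) - 1)\<close> elsewhere, so that \<open>\<psi>\<^sub>\<rho>\<close> has mean zero, and let \<open>\<psi>\<^sub>A\<close> be the product over a finite
  set \<open>A\<close> of primes.  The sum \<open>h\<close> of the \<open>\<psi>\<^sub>A\<close> with \<open>N(A) \<le> R\<close> equals \<open>G \<ge> c log R\<close> at every power of a
  prime of norm above \<open>R\<close>, hence \<open>\<Lambda>\<close> is bounded by a constant times \<open>h\<^sup>2/G\<close> when \<open>R\<close> is a fixed power of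
  \<open>N\<close>, up to a negligible set.  As \<open>\<psi>\<^sub>\<rho>\<^sup>2 = g(\<rho>) + (g(\<rho>) - 1)\<psi>\<^sub>\<rho>\<close>, the majorant is again a combination of the
  \<open>\<psi>\<^sub>C\<close>, now with \<open>N(C) \<le> R\<^sup>2\<close>, whose coefficients are at most \<open>4\<^bsup>|C|\<^esup>\<close>.

  The part with \<open>N(C)\<close> of size \<open>2\<^sup>j\<close> has operator norm \<open>O(N 2\<^bsup>-j/4\<^esup>)\<close> on \<open>\<ell>\<^sup>2\<close>, by \<open>TT\<^sup>*\<close> and
  the orthogonality of distinct \<open>\<psi>\<^sub>C\<close>, while its \<open>r\<close>-th moments are \<open>O(N 2\<^bsup>\<epsilon>j\<^esup>)\<close>, by Rankin's trick.
  Interpolating between the two gives a geometric series in \<open>j\<close> and thus the restricted form of the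
  inequality without logarithmic loss for each exponent in \<open>(1,2]\<close>; decomposing \<open>f\<close> and \<open>g\<close> into dyadic
  level sets upgrades it to the strong form.
\<close>


section \<open>Arithmetic of the Gaussian integers\<close>

text \<open>No distribution of Gaussian primes enters: an upper bound is wanted, so the analysis
  concerns a sieve weight whose correlations are found by counting lattice points. The price is that
  the majorant is large at numbers with many small prime divisors, above all at 0, so its dyadic
  pieces admit no bound of size \<open>2^(\<epsilon>j)\<close> in the supremum norm. This is why the
  second endpoint is a moment of finite order r. It gives the exponent \<open>1 - 1/(2r)\<close> in
  the sizes of the two sets, which exceeds any given \<open>1/q < 1\<close> once r is large.

  The point 0 contributes \<open>(Q^2)^r\<close> to the moment, which is harmless only if
  \<open>Q^(2r) \<le> X\<close>. Hence the sieve level \<open>R = N^(1/(4r))\<close> is a power of N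
  depending on the exponent q, and the replacement of \<Lambda> by \<open>ln N / G\<close> times the
  majorant loses only a factor proportional to r.

  The passage to the strong inequality needs restricted bounds on both sides of p. The exponent p =
  2 is therefore treated apart, by Schur's test and a Chebyshev-type bound that is itself a
  consequence of the restricted inequality.\<close>

definition gnorm :: "gauss_int \<Rightarrow> real" where
  "gnorm n = real_of_int (gauss_norm n)"

lemma gauss_norm_nonneg: "gauss_norm n \<ge> 0"
  by (simp add: gauss_norm_def)

lemma gauss_norm_pos: "n \<noteq> 0 \<Longrightarrow> gauss_norm n > 0"
  using gauss_norm_nonneg[of n] gauss_norm_eq_0_iff[of n] by linarith

lemma gauss_norm_1 [simp]: "gauss_norm 1 = 1"
  by (simp add: gauss_norm_def)

lemma gauss_norm_minus_commute: "gauss_norm (x - y) = gauss_norm (y - x)"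
  by (simp add: gauss_norm_def power2_commute)

lemma round_div_int:
  assumes "(M::int) > 0"
  obtains a where "2 * \<bar>A - a * M\<bar> \<le> M"
proof
  \<comment> \<open>The integer nearest to \<open>A / M\<close> is the floor of
    \<open>(2 * A + M) / (2 * M)\<close>.\<close>
  define d r where "d = (2 * A + M) div (2 * M)" and "r = (2 * A + M) mod (2 * M)"
  have "d * (2 * M) + r = 2 * A + M" unfolding d_def r_def by (rule div_mult_mod_eq)
  then have "2 * (A - d * M) = r - M" by (simp add: algebra_simps)
  moreover have "0 \<le> r" "r < 2 * M" using assms by (auto simp: r_def)
  ultimately show "2 * \<bar>A - d * M\<bar> \<le> M" by linarith
qed

text \<open>The quotient x/y is x times the conjugate of y, divided by the norm of y. Rounding moves
  each of its coordinates by at most 1/2, so the remainder has norm at most half that of y.\<close>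

lemma gauss_euclidean:
  assumes "y \<noteq> 0"
  obtains q where "gauss_norm (x - q * y) < gauss_norm y"
proof -
  define M where "M = gauss_norm y"
  have M: "M > 0" using assms by (simp add: M_def gauss_norm_pos)
  define w where "w = x * Gauss_Int (ReZ y) (- ImZ y)"
  obtain a b where a: "2 * \<bar>ReZ w - a * M\<bar> \<le> M" and b: "2 * \<bar>ImZ w - b * M\<bar> \<le> M"
    using round_div_int[OF M] by metis
  define q where "q = Gauss_Int a b"
  have "gauss_norm (x - q * y) * M = gauss_norm ((x - q * y) * Gauss_Int (ReZ y) (- ImZ y))"
    by (simp add: gauss_norm_mult M_def) (simp add: gauss_norm_def)
  also have "(x - q * y) * Gauss_Int (ReZ y) (- ImZ y) = w - Gauss_Int (a * M) (b * M)"
    by (simp add: gauss_int_eq_iff w_def q_def M_def gauss_norm_def algebra_simps power2_eq_square)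
  also have "gauss_norm \<dots> = (ReZ w - a * M)\<^sup>2 + (ImZ w - b * M)\<^sup>2"
    by (simp add: gauss_norm_def)
  finally have eq: "gauss_norm (x - q * y) * M = (ReZ w - a * M)\<^sup>2 + (ImZ w - b * M)\<^sup>2" .
  have "(2 * (ReZ w - a * M))\<^sup>2 \<le> M\<^sup>2" "(2 * (ImZ w - b * M))\<^sup>2 \<le> M\<^sup>2"
    unfolding abs_le_square_iff[symmetric] using a b M by (simp_all only: abs_mult)
  then have "2 * (gauss_norm (x - q * y) * M) \<le> M * M"
    unfolding eq by (simp add: power2_eq_square algebra_simps)
  then have "2 * gauss_norm (x - q * y) \<le> M" using M by simp
  then have "gauss_norm (x - q * y) < M" using M by linarith
  then show ?thesis using that M_def by blast
qed

lemma gauss_unit_iff: "u dvd 1 \<longleftrightarrow> gauss_norm u = 1"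
proof
  assume "u dvd 1"
  then obtain v where "1 = u * v" by (auto elim: dvdE)
  then have "gauss_norm u * gauss_norm v = 1" by (metis gauss_norm_1 gauss_norm_mult)
  then show "gauss_norm u = 1"
    using gauss_norm_nonneg[of u] pos_zmult_eq_1_iff_lemma zmult_eq_1_iff by fastforce
next
  assume "gauss_norm u = 1"
  then have "1 = u * Gauss_Int (ReZ u) (- ImZ u)"
    by (simp add: gauss_int_eq_iff gauss_norm_def power2_eq_square)
  then show "u dvd 1" by (metis dvd_triv_left)
qed

lemma gauss_unit_cases:
  assumes "u dvd 1"
  obtains "u = 1" | "u = - 1" | "u = Gauss_Int 0 1" | "u = Gauss_Int 0 (- 1)"
proof -
  have eq: "(ReZ u)\<^sup>2 + (ImZ u)\<^sup>2 = 1"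
    using assms by (simp add: gauss_unit_iff gauss_norm_def)
  have "(ReZ u)\<^sup>2 \<le> 1\<^sup>2" "(ImZ u)\<^sup>2 \<le> 1\<^sup>2"
    unfolding one_power2 using eq zero_le_power2[of "ReZ u"] zero_le_power2[of "ImZ u"] by linarith+
  then have "\<bar>ReZ u\<bar> \<le> 1" "\<bar>ImZ u\<bar> \<le> 1"
    unfolding abs_le_square_iff[symmetric] by auto
  then have "ReZ u \<in> {-1, 0, 1}" "ImZ u \<in> {-1, 0, 1}" by auto
  then show ?thesis using eq that by (auto simp: gauss_int_eq_iff)
qed

text \<open>An element of least norm in the ideal generated by \<rho> and x divides both, by
  Euclidean division. It is a unit, since otherwise irreducibility would make it an associate of
  \<rho>, which does not divide x.\<close>

lemma irreducible_bezout:
  fixes \<rho> x :: gauss_int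
  assumes "irreducible \<rho>" and "\<not> \<rho> dvd x"
  obtains u v where "u * \<rho> + v * x = 1"
proof -
  define I where "I = {n. n \<noteq> 0 \<and> (\<exists>u v. n = u * \<rho> + v * x)}"
  have "\<rho> = 1 * \<rho> + 0 * x" by simp
  then have "\<rho> \<in> I" using assms(1) unfolding I_def by (metis (mono_tags, lifting) irreducible_def mem_Collect_eq)
  then obtain d where d: "d \<in> I" and min: "\<And>e. e \<in> I \<Longrightarrow> nat (gauss_norm d) \<le> nat (gauss_norm e)"
    using ex_has_least_nat[of "\<lambda>n. n \<in> I" \<rho> "\<lambda>n. nat (gauss_norm n)"] by blast
  obtain u v where d0: "d \<noteq> 0" and duv: "d = u * \<rho> + v * x" using d by (auto simp: I_def)
  have dvd: "d dvd w" if w: "w = u' * \<rho> + v' * x" for w u' v'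
  proof -
    obtain q where q: "gauss_norm (w - q * d) < gauss_norm d" using gauss_euclidean[OF d0] by blast
    have "w - q * d = (u' - q * u) * \<rho> + (v' - q * v) * x"
      by (simp add: w duv algebra_simps)
    then have "w - q * d \<in> I" if "w - q * d \<noteq> 0"
      using that unfolding I_def by blast
    then have "w - q * d = 0"
      using min[of "w - q * d"] q gauss_norm_nonneg[of "w - q * d"] by (auto simp: nat_le_eq_zle)
    then show ?thesis by (auto simp: algebra_simps)
  qed
  have "d dvd \<rho>" using dvd[of \<rho> 1 0] by simp
  then obtain e where e: "\<rho> = d * e" by blast
  have "d dvd x" using dvd[of x 0 1] by simp
  have "\<not> e dvd 1"
  proof
    assume "e dvd 1"
    then have "\<rho> dvd d" unfolding e by (simp add: mult_unit_dvd_iff)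
    then show False using \<open>d dvd x\<close> assms(2) dvd_trans by blast
  qed
  then have "d dvd 1" using assms(1) e unfolding irreducible_def by blast
  then obtain d' where "1 = d * d'" by blast
  then have "(d' * u) * \<rho> + (d' * v) * x = 1" by (simp add: duv algebra_simps)
  then show ?thesis using that by blast
qed

lemma irreducible_imp_prime_elem_gauss:
  fixes \<rho> :: gauss_int
  assumes "irreducible \<rho>"
  shows "prime_elem \<rho>"
  unfolding prime_elem_def
proof (intro conjI allI impI)
  show "\<rho> \<noteq> 0" "\<not> \<rho> dvd 1" using assms by (auto simp: irreducible_def)
  fix a b assume ab: "\<rho> dvd a * b"
  show "\<rho> dvd a \<or> \<rho> dvd b"
  proof (rule ccontr)
    assume neg: "\<not> (\<rho> dvd a \<or> \<rho> dvd b)"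
    then obtain u v where uv: "u * \<rho> + v * a = 1" using irreducible_bezout assms by blast
    have "b = b * (u * \<rho> + v * a)" by (simp add: uv)
    also have "\<dots> = \<rho> * (b * u) + (a * b) * v" by (simp add: algebra_simps)
    finally have "\<rho> dvd b" using ab by (metis dvd_add dvd_mult2 dvd_triv_left)
    then show False using neg by blast
  qed
qed

section \<open>Primes and factorization up to units\<close>

text \<open>The half-open quadrant contains exactly one of the four associates of every irreducible
  element.\<close>

definition gprimes :: "gauss_int set" where
  "gprimes = {\<rho>. irreducible \<rho> \<and> ReZ \<rho> > 0 \<and> ImZ \<rho> \<ge> 0}"

lemma gprimes_prime_elem: "\<rho> \<in> gprimes \<Longrightarrow> prime_elem \<rho>"
  by (simp add: gprimes_def irreducible_imp_prime_elem_gauss)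

lemma gprimes_nonzero: "\<rho> \<in> gprimes \<Longrightarrow> \<rho> \<noteq> 0"
  using gprimes_prime_elem by (auto simp: prime_elem_def)

lemma gprimes_norm_ge:
  assumes "\<rho> \<in> gprimes" shows "gauss_norm \<rho> \<ge> 2"
proof -
  have "\<not> \<rho> dvd 1" "\<rho> \<noteq> 0" using gprimes_prime_elem[OF assms] by (auto simp: prime_elem_def)
  then show ?thesis using gauss_norm_pos[of \<rho>] by (auto simp: gauss_unit_iff)
qed

lemma gprimes_gnorm_ge: "\<rho> \<in> gprimes \<Longrightarrow> gnorm \<rho> \<ge> 2"
  using gprimes_norm_ge[of \<rho>] by (simp add: gnorm_def)

lemma gprimes_dvd_irreducible_norm:
  fixes \<sigma> :: gauss_int
  assumes "\<rho> \<in> gprimes" "irreducible \<sigma>" "\<rho> dvd \<sigma>"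
  shows "gauss_norm \<rho> = gauss_norm \<sigma>"
proof -
  obtain u where u: "\<sigma> = \<rho> * u" using assms(3) by blast
  have "\<not> \<rho> dvd 1" using gprimes_prime_elem[OF assms(1)] by (auto simp: prime_elem_def)
  then have "u dvd 1" using assms(2) u by (auto simp: irreducible_def)
  then show ?thesis by (simp add: u gauss_norm_mult gauss_unit_iff)
qed

lemma gprimes_dvd_eq:
  assumes "\<rho> \<in> gprimes" "\<sigma> \<in> gprimes" "\<rho> dvd \<sigma>"
  shows "\<rho> = \<sigma>"
proof -
  obtain u where u: "\<sigma> = \<rho> * u" using assms(3) by blast
  have "\<not> \<rho> dvd 1" using gprimes_prime_elem[OF assms(1)] by (auto simp: prime_elem_def)
  moreover have "irreducible \<sigma>" using assms(2) by (simp add: gprimes_def)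
  ultimately have "u dvd 1" using u by (auto simp: irreducible_def)
  then show ?thesis using assms(1,2) u
    by (cases rule: gauss_unit_cases) (auto simp: gprimes_def)
qed

lemma gauss_representative:
  fixes x :: gauss_int
  assumes "x \<noteq> 0"
  obtains u where "u dvd 1" "ReZ (u * x) > 0" "ImZ (u * x) \<ge> 0"
proof -
  have un: "(1::gauss_int) dvd 1" "(- 1::gauss_int) dvd 1" "Gauss_Int 0 1 dvd 1" "Gauss_Int 0 (- 1) dvd 1"
    by (auto simp: gauss_unit_iff gauss_norm_def)
  have "ReZ x \<noteq> 0 \<or> ImZ x \<noteq> 0" using assms by (auto simp: gauss_int_eq_iff)
  then consider "ReZ x > 0" "ImZ x \<ge> 0" | "ReZ x < 0" "ImZ x \<le> 0" | "ReZ x \<ge> 0" "ImZ x < 0" | "ReZ x \<le> 0" "ImZ x > 0"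
    by linarith
  then show ?thesis
    using that[OF un(1)] that[OF un(2)] that[OF un(3)] that[OF un(4)] by cases simp_all
qed

lemma gprimes_dvd_prod_iff:
  assumes "finite U" "U \<subseteq> gprimes" "\<rho> \<in> gprimes"
  shows "\<rho> dvd \<Prod>U \<longleftrightarrow> \<rho> \<in> U"
  using assms(1,2)
proof (induction U)
  case empty
  then show ?case using gprimes_prime_elem[OF assms(3)] by (auto simp: prime_elem_def)
next
  case (insert \<sigma> U)
  then show ?case
    using prime_elem_dvd_mult_iff[OF gprimes_prime_elem[OF assms(3)]] gprimes_dvd_eq[OF assms(3)] by auto
qed

lemma gprimes_prod_dvd_iff:
  assumes "finite U" "U \<subseteq> gprimes"
  shows "\<Prod>U dvd n \<longleftrightarrow> (\<forall>\<rho>\<in>U. \<rho> dvd n)"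
  using assms
proof (induction U arbitrary: n)
  case (insert \<sigma> U)
  have prime: "prime_elem \<sigma>" using insert.prems gprimes_prime_elem by auto
  show ?case
  proof
    assume "\<Prod>(insert \<sigma> U) dvd n"
    then show "\<forall>\<rho>\<in>insert \<sigma> U. \<rho> dvd n"
      by (meson dvd_prodI dvd_trans finite_insert insert.hyps(1))
  next
    assume all: "\<forall>\<rho>\<in>insert \<sigma> U. \<rho> dvd n"
    then have "\<Prod>U dvd n" using insert by auto
    then obtain m where m: "n = \<Prod>U * m" by blast
    have "\<not> \<sigma> dvd \<Prod>U" using gprimes_dvd_prod_iff insert by auto
    moreover have "\<sigma> dvd \<Prod>U * m" using all m by auto
    ultimately have "\<sigma> dvd m" using prime_elem_dvd_mult_iff[OF prime] by blast
    then show "\<Prod>(insert \<sigma> U) dvd n"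
      using insert.hyps m by (auto simp: mult.commute intro: mult_dvd_mono)
  qed
qed simp

lemma gprimes_chinese_remainder:
  assumes "finite U" "U \<subseteq> gprimes"
  obtains y where "\<And>\<rho>. \<rho> \<in> U \<Longrightarrow> \<rho> dvd y - a \<rho>"
proof -
  have "\<exists>y. \<forall>\<rho>\<in>U. \<rho> dvd y - a \<rho>"
    using assms
  proof (induction U)
    case (insert \<sigma> U)
    then obtain y where y: "\<forall>\<rho>\<in>U. \<rho> dvd y - a \<rho>" by auto
    have "irreducible \<sigma>" "\<not> \<sigma> dvd \<Prod>U"
      using insert gprimes_dvd_prod_iff[of U \<sigma>] by (auto simp: gprimes_def)
    then obtain u v where uv: "u * \<sigma> + v * \<Prod>U = 1" using irreducible_bezout by blast
    \<comment> \<open>\<open>v * \<Prod>U\<close> is 1 modulo \<sigma> and 0 modulo every member of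
      U, so the correction changes only the residue modulo \<sigma>.\<close>
    define z where "z = y + (a \<sigma> - y) * (v * \<Prod>U)"
    have "z - a \<sigma> = (y - a \<sigma>) * (1 - v * \<Prod>U)"
      by (simp add: z_def algebra_simps)
    also have "\<dots> = (y - a \<sigma>) * (u * \<sigma>)"
      using uv by (metis add_diff_cancel_right')
    finally have "\<sigma> dvd z - a \<sigma>" by simp
    moreover have "\<rho> dvd z - a \<rho>" if "\<rho> \<in> U" for \<rho>
    proof -
      have "\<rho> dvd \<Prod>U" using dvd_prodI[OF insert.hyps(1) that, of "\<lambda>x. x"] by simp
      then have "\<rho> dvd (a \<sigma> - y) * v * \<Prod>U" by (rule dvd_mult)
      then have "\<rho> dvd (y - a \<rho>) + (a \<sigma> - y) * v * \<Prod>U" using y that by (intro dvd_add) auto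
      moreover have "z - a \<rho> = (y - a \<rho>) + (a \<sigma> - y) * v * \<Prod>U" by (simp add: z_def algebra_simps)
      ultimately show ?thesis by metis
    qed
    ultimately show ?case by blast
  qed simp
  then show ?thesis using that by blast
qed

text \<open>A non-unit divisor of least norm is irreducible, because in a factorization into two
  non-units each factor would have smaller norm. A unit then moves it into the chosen
  quadrant.\<close>

lemma exists_gprime_dvd:
  assumes "n \<noteq> 0" "\<not> n dvd 1"
  obtains \<rho> where "\<rho> \<in> gprimes" "\<rho> dvd n"
proof -
  define I where "I = {d. d dvd n \<and> \<not> d dvd 1}"
  have "n \<in> I" using assms by (simp add: I_def)
  then obtain d where d: "d \<in> I" and min: "\<And>e. e \<in> I \<Longrightarrow> nat (gauss_norm d) \<le> nat (gauss_norm e)"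
    using ex_has_least_nat[of "\<lambda>n. n \<in> I" n "\<lambda>n. nat (gauss_norm n)"] by blast
  have d': "d dvd n" "\<not> d dvd 1" "d \<noteq> 0" using d assms by (auto simp: I_def)
  have "irreducible d"
    unfolding irreducible_def
  proof (intro conjI allI impI)
    show "d \<noteq> 0" "\<not> d dvd 1" using d' by auto
    fix a b assume ab: "d = a * b"
    show "a dvd 1 \<or> b dvd 1"
    proof (rule ccontr)
      assume neg: "\<not> (a dvd 1 \<or> b dvd 1)"
      then have "a \<in> I" using d'(1) ab unfolding I_def by (auto intro: dvd_trans)
      then have "gauss_norm d \<le> gauss_norm a" using min[of a] gauss_norm_nonneg[of a] by (simp add: nat_le_eq_zle)
      moreover have "gauss_norm a > 0" "gauss_norm b > 0" using ab d'(3) gauss_norm_pos by auto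
      ultimately show False using neg unfolding ab gauss_norm_mult gauss_unit_iff
        by (smt (verit) mult_le_cancel_left2)
    qed
  qed
  obtain u where u: "u dvd 1" "ReZ (u * d) > 0" "ImZ (u * d) \<ge> 0" using gauss_representative d'(3) by blast
  have "u * d dvd d" using u(1) by (simp add: mult_unit_dvd_iff')
  have "irreducible (u * d)"
    unfolding irreducible_def
  proof (intro conjI allI impI)
    show "u * d \<noteq> 0" using u(2) by auto
    show "\<not> u * d dvd 1" using u(1) d'(2) by (simp add: gauss_unit_iff gauss_norm_mult)
    fix a b assume ab: "u * d = a * b"
    obtain u' where "1 = u * u'" using u(1) by blast
    then have "d = (u' * u) * d" by (simp add: mult.commute)
    then have "d = (u' * a) * b" using ab by (simp add: mult.assoc)
    then have "u' * a dvd 1 \<or> b dvd 1" using \<open>irreducible d\<close> by (auto simp: irreducible_def)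
    then show "a dvd 1 \<or> b dvd 1" using dvd_mult_right by blast
  qed
  then have "u * d \<in> gprimes" using u by (simp add: gprimes_def)
  then show ?thesis using that \<open>u * d dvd d\<close> d'(1) dvd_trans by blast
qed

text \<open>The norm drops when a prime is split off. Keeping all exponents at least 1 makes A the
  exact set of primes dividing n, so that its product has norm at most that of n.\<close>

lemma gprimes_factorization:
  assumes "n \<noteq> 0"
  shows "\<exists>u A e. u dvd 1 \<and> finite A \<and> A \<subseteq> gprimes \<and> (\<forall>\<rho>\<in>A. e \<rho> \<ge> (1::nat)) \<and> n = u * (\<Prod>\<rho>\<in>A. \<rho> ^ e \<rho>)"
  using assms
proof (induction "nat (gauss_norm n)" arbitrary: n rule: less_induct)
  case less
  show ?case
  proof (cases "n dvd 1")
    case True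
    then show ?thesis by (intro exI[of _ n] exI[of _ "{}"]) auto
  next
    case False
    then obtain \<rho> where \<rho>: "\<rho> \<in> gprimes" "\<rho> dvd n" using exists_gprime_dvd less.prems by blast
    then obtain m where m: "n = \<rho> * m" by blast
    have m0: "m \<noteq> 0" using m less.prems by auto
    have "gauss_norm m < gauss_norm n"
      using gprimes_norm_ge[OF \<rho>(1)] gauss_norm_pos[OF m0] unfolding m gauss_norm_mult
      by (smt (verit) mult_le_cancel_right2)
    then obtain u A e where IH: "u dvd 1" "finite A" "A \<subseteq> gprimes" "\<forall>\<rho>\<in>A. e \<rho> \<ge> (1::nat)" "m = u * (\<Prod>\<rho>\<in>A. \<rho> ^ e \<rho>)"
      using less.hyps[of m] m0 gauss_norm_nonneg[of m] by (auto simp: nat_less_eq_zless)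
    define e' where "e' = (\<lambda>\<sigma>. if \<sigma> = \<rho> then (if \<rho> \<in> A then Suc (e \<rho>) else 1) else e \<sigma>)"
    have eq: "(\<Prod>\<sigma>\<in>A - {\<rho>}. \<sigma> ^ e' \<sigma>) = (\<Prod>\<sigma>\<in>A - {\<rho>}. \<sigma> ^ e \<sigma>)"
      by (intro prod.cong) (auto simp: e'_def)
    have "(\<Prod>\<sigma>\<in>insert \<rho> A. \<sigma> ^ e' \<sigma>) = \<rho> ^ e' \<rho> * (\<Prod>\<sigma>\<in>A - {\<rho>}. \<sigma> ^ e' \<sigma>)"
      by (rule prod.insert_remove[OF IH(2)])
    also have "\<dots> = \<rho> * (\<Prod>\<sigma>\<in>A. \<sigma> ^ e \<sigma>)"
      unfolding eq by (cases "\<rho> \<in> A") (auto simp: e'_def prod.remove[OF IH(2)])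
    finally have "n = u * (\<Prod>\<sigma>\<in>insert \<rho> A. \<sigma> ^ e' \<sigma>)"
      by (simp add: m IH(5) algebra_simps)
    moreover have "\<forall>\<sigma>\<in>insert \<rho> A. e' \<sigma> \<ge> 1" using IH(4) by (auto simp: e'_def)
    ultimately show ?thesis using IH \<rho>
      by (intro exI[of _ u] exI[of _ "insert \<rho> A"] exI[of _ e']) auto
  qed
qed

section \<open>Lattice points and Euler products\<close>

lemma gnorm_mult: "gnorm (x * y) = gnorm x * gnorm y"
  by (simp add: gnorm_def gauss_norm_mult)

lemma gnorm_nonneg [simp]: "gnorm x \<ge> 0"
  by (simp add: gnorm_def gauss_norm_nonneg)

lemma gnorm_0 [simp]: "gnorm 0 = 0"
  by (simp add: gnorm_def gauss_norm_def)

lemma gnorm_1 [simp]: "gnorm 1 = 1"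
  by (simp add: gnorm_def)

lemma gnorm_minus_commute: "gnorm (x - y) = gnorm (y - x)"
  by (simp add: gnorm_def gauss_norm_minus_commute[of x])

lemma gnorm_ge_1: "n \<noteq> 0 \<Longrightarrow> gnorm n \<ge> 1"
  using gauss_norm_pos[of n] by (simp add: gnorm_def)

lemma gnorm_pos: "n \<noteq> 0 \<Longrightarrow> gnorm n > 0"
  using gnorm_ge_1[of n] by linarith

lemma gnorm_add_le: "gnorm (x + y) \<le> 2 * gnorm x + 2 * gnorm y"
proof -
  have "gauss_norm (x + y) + ((ReZ x - ReZ y)\<^sup>2 + (ImZ x - ImZ y)\<^sup>2) = 2 * gauss_norm x + 2 * gauss_norm y"
    by (simp add: gauss_norm_def power2_eq_square algebra_simps)
  then have "gauss_norm (x + y) \<le> 2 * gauss_norm x + 2 * gauss_norm y"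
    by (smt (verit) zero_le_power2)
  then have "real_of_int (gauss_norm (x + y)) \<le> real_of_int (2 * gauss_norm x + 2 * gauss_norm y)"
    by (rule of_int_le_iff[THEN iffD2])
  then show ?thesis by (simp add: gnorm_def)
qed

lemma gnorm_prod: "gnorm (prod f A) = (\<Prod>x\<in>A. gnorm (f x))"
  by (induction A rule: infinite_finite_induct) (auto simp: gnorm_mult)

lemma gnorm_power: "gnorm (x ^ k) = gnorm x ^ k"
  by (induction k) (auto simp: gnorm_mult)

lemma finite_gnorm_less: "finite {n. gnorm n < X}"
proof (rule finite_subset)
  show "{n. gnorm n < X} \<subseteq> {n. gauss_norm n < \<lceil>X\<rceil>}"
    by (auto simp: gnorm_def less_ceiling_iff)
qed (rule finite_gauss_norm_less)

text \<open>X bounds the norm, which is the square of the distance: the disc has radius sqrt X and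
  about \<open>pi * X\<close> points.\<close>

definition gdisc :: "gauss_int \<Rightarrow> real \<Rightarrow> gauss_int set" where
  "gdisc z X = {n. gnorm (n - z) < X}"

lemma gdisc_eq_image: "gdisc z X = (\<lambda>n. n + z) ` {n. gnorm n < X}"
  unfolding gdisc_def by (auto simp: image_iff) (metis diff_add_cancel)

lemma finite_gdisc [simp]: "finite (gdisc z X)"
  by (simp add: gdisc_eq_image finite_gnorm_less)

lemma card_gdisc: "card (gdisc z X) = card (gdisc 0 X)"
proof -
  have "card (gdisc z X) = card {n. gnorm n < X}"
    unfolding gdisc_eq_image by (intro card_image inj_onI) auto
  then show ?thesis by (simp add: gdisc_def)
qed

section \<open>Lattice points in discs and residue classes\<close>

definition cplx :: "gauss_int \<Rightarrow> complex" where
  "cplx n = Complex (real_of_int (ReZ n)) (real_of_int (ImZ n))"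

lemma cplx_simps [simp]:
  "cplx (a + b) = cplx a + cplx b" "cplx (a - b) = cplx a - cplx b" "cplx (a * b) = cplx a * cplx b"
  "Re (cplx a) = real_of_int (ReZ a)" "Im (cplx a) = real_of_int (ImZ a)"
  by (simp_all add: cplx_def complex_eq_iff)

lemma gnorm_eq_cplx: "gnorm n = (cmod (cplx n))\<^sup>2"
  by (simp add: gnorm_def gauss_norm_def cmod_power2)

lemma gnorm_less_iff: "X \<ge> 0 \<Longrightarrow> gnorm n < X \<longleftrightarrow> cmod (cplx n) < sqrt X"
  using real_sqrt_less_iff[of "gnorm n" X] by (simp add: gnorm_eq_cplx)

definition gcell :: "gauss_int \<Rightarrow> complex set" where
  "gcell k = cbox (cplx k - Complex (1/2) (1/2)) (cplx k + Complex (1/2) (1/2))"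

lemma gcell_iff: "z \<in> gcell k \<longleftrightarrow> \<bar>Re z - ReZ k\<bar> \<le> 1/2 \<and> \<bar>Im z - ImZ k\<bar> \<le> 1/2"
  unfolding gcell_def in_cbox_complex_iff atLeastAtMost_iff by simp argo

lemma gcell_dist:
  assumes "z \<in> gcell k" shows "cmod (z - cplx k) < 1"
proof -
  have "\<bar>Re z - ReZ k\<bar>\<^sup>2 \<le> (1/2)\<^sup>2" "\<bar>Im z - ImZ k\<bar>\<^sup>2 \<le> (1/2)\<^sup>2"
    using assms unfolding gcell_iff by (intro power_mono; simp)+
  then have "(cmod (z - cplx k))\<^sup>2 \<le> 1/2"
    unfolding cmod_power2 by (simp add: power2_eq_square)
  also have "\<dots> < 1\<^sup>2" by simp
  finally show ?thesis by (rule power_less_imp_less_base) simp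
qed

lemma measure_gcell: "measure lborel (gcell k) = 1"
  "measure lborel (box (cplx k - Complex (1/2) (1/2)) (cplx k + Complex (1/2) (1/2))) = 1"
  unfolding gcell_def
  by (subst measure_lborel_cbox_eq measure_lborel_box_eq; simp add: Basis_complex_def inner_complex_def)+

text \<open>Gauss's comparison of areas: the open unit cells around the counted points are disjoint
  and lie in the disc of radius r + 1, while the closed ones cover the disc of radius r - 1. The
  centre is an arbitrary complex number because residue classes will be rescaled to the full
  lattice.\<close>

lemma lattice_points_disc:
  assumes r: "r \<ge> 0" 
  shows "finite {k. cmod (cplx k - w) < r}"
    and "\<bar>real (card {k. cmod (cplx k - w) < r}) - pi * r\<^sup>2\<bar> \<le> 7 * (r + 1)"
proof -
  define S where "S = {k. cmod (cplx k - w) < r}"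
  have fin: "finite S"
  proof (rule finite_subset)
    show "S \<subseteq> {n. ReZ n \<in> {\<lfloor>Re w - r\<rfloor>..\<lceil>Re w + r\<rceil>} \<and> ImZ n \<in> {\<lfloor>Im w - r\<rfloor>..\<lceil>Im w + r\<rceil>}}"
    proof
      fix k assume "k \<in> S"
      then have "\<bar>Re (cplx k - w)\<bar> < r" "\<bar>Im (cplx k - w)\<bar> < r"
        unfolding S_def using abs_Re_le_cmod abs_Im_le_cmod le_less_trans by blast+
      then show "k \<in> {n. ReZ n \<in> {\<lfloor>Re w - r\<rfloor>..\<lceil>Re w + r\<rceil>} \<and> ImZ n \<in> {\<lfloor>Im w - r\<rfloor>..\<lceil>Im w + r\<rceil>}}"
        by simp linarith
    qed
  qed (rule finite_gauss_box)
  then show "finite {k. cmod (cplx k - w) < r}" by (simp add: S_def)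
  have area: "measure lborel (ball w s) = pi * s\<^sup>2" if "s \<ge> 0" for s
    using content_ball[of s w] that by (simp add: unit_ball_vol_2)
  have meas_fin: "emeasure lborel A \<noteq> \<infinity>" if "bounded A" for A :: "complex set"
    using emeasure_bounded_finite[OF that] by auto
  have upper: "real (card S) \<le> pi * (r + 1)\<^sup>2"
  proof -
    define B where "B = (\<lambda>k. box (cplx k - Complex (1/2) (1/2)) (cplx k + Complex (1/2) (1/2)))"
    have sub: "B k \<subseteq> gcell k" for k by (simp add: B_def gcell_def box_subset_cbox)
    have "real (card S) = (\<Sum>k\<in>S. measure lborel (B k))"
      by (simp add: measure_gcell B_def)
    also have "\<dots> = measure lborel (\<Union>k\<in>S. B k)"
    proof (rule measure_finite_Union[symmetric])
      show "disjoint_family_on B S"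
        unfolding disjoint_family_on_def
      proof (intro ballI impI)
        fix k l :: gauss_int assume "k \<noteq> l"
        show "B k \<inter> B l = {}"
        proof (rule ccontr)
          assume "B k \<inter> B l \<noteq> {}"
          then obtain z where "z \<in> B k" "z \<in> B l" by auto
          then have "\<bar>real_of_int (ReZ k) - real_of_int (ReZ l)\<bar> < 1" "\<bar>real_of_int (ImZ k) - real_of_int (ImZ l)\<bar> < 1"
            unfolding B_def in_box_complex_iff by auto
          then have "\<bar>ReZ k - ReZ l\<bar> < 1" "\<bar>ImZ k - ImZ l\<bar> < 1"
            by (metis of_int_1_less_iff of_int_abs of_int_diff of_int_less_1_iff)+
          then have "k = l" by (simp add: gauss_int_eq_iff)
          then show False using \<open>k \<noteq> l\<close> by simp
        qed
      qed
      show "emeasure lborel (B k) \<noteq> \<infinity>" if "k \<in> S" for k by (intro meas_fin) (simp add: B_def bounded_box)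
    qed (use fin in \<open>auto simp: B_def\<close>)
    also have "\<dots> \<le> measure lborel (ball w (r + 1))"
    proof (rule measure_mono_fmeasurable)
      show "(\<Union>k\<in>S. B k) \<subseteq> ball w (r + 1)"
      proof clarify
        fix k z assume k: "k \<in> S" and "z \<in> B k"
        then have "cmod (z - cplx k) < 1" using gcell_dist sub by blast
        moreover have "cmod (cplx k - w) < r" using k by (simp add: S_def)
        ultimately have "cmod (z - w) < r + 1"
          using norm_triangle_ineq[of "z - cplx k" "cplx k - w"] by simp
        then show "z \<in> ball w (r + 1)" by (simp add: dist_norm norm_minus_commute)
      qed
      show "(\<Union>k\<in>S. B k) \<in> sets lborel" using fin by (auto simp: B_def)
      show "ball w (r + 1) \<in> fmeasurable lborel"
        using emeasure_bounded_finite[OF bounded_ball] by (auto simp: fmeasurable_def)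
    qed
    also have "\<dots> = pi * (r + 1)\<^sup>2" using r by (simp add: area)
    finally show ?thesis .
  qed
  have lower: "pi * (r - 1)\<^sup>2 \<le> real (card S)" if "r \<ge> 1"
  proof -
    have "pi * (r - 1)\<^sup>2 = measure lborel (ball w (r - 1))" using that by (simp add: area)
    also have "\<dots> \<le> measure lborel (\<Union>k\<in>S. gcell k)"
    proof (rule measure_mono_fmeasurable)
      show "ball w (r - 1) \<subseteq> (\<Union>k\<in>S. gcell k)"
      proof
        fix z assume "z \<in> ball w (r - 1)"
        then have z: "cmod (z - w) < r - 1" by (simp add: dist_norm norm_minus_commute)
        define k where "k = Gauss_Int (round (Re z)) (round (Im z))"
        have k: "z \<in> gcell k"
          using of_int_round_abs_le[of "Re z"] of_int_round_abs_le[of "Im z"]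
          by (simp add: gcell_iff k_def abs_minus_commute)
        have "cmod (cplx k - w) \<le> cmod (cplx k - z) + cmod (z - w)"
          using norm_triangle_ineq[of "cplx k - z" "z - w"] by simp
        also have "\<dots> < r" using gcell_dist[OF k] z by (simp add: norm_minus_commute)
        finally show "z \<in> (\<Union>k\<in>S. gcell k)" using k by (auto simp: S_def)
      qed
      show "(\<Union>k\<in>S. gcell k) \<in> fmeasurable lborel"
        unfolding gcell_def by (intro fmeasurable.finite_UN fin) (auto simp: fmeasurable_cbox)
    qed auto
    also have "\<dots> \<le> (\<Sum>k\<in>S. measure lborel (gcell k))"
      by (intro measure_UNION_le fin) (simp add: gcell_def)
    also have "\<dots> = real (card S)" by (simp add: measure_gcell)
    finally show ?thesis .
  qed
  \<comment> \<open>The area differences are at most \<open>pi * (2 * r + 1)\<close>, and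
    \<open>pi \<le> 63/20\<close> keeps this below \<open>7 * (r + 1)\<close>.\<close>
  have pi: "pi \<le> (63 / 20)" using pi_approx by simp
  have "pi * (r + 1)\<^sup>2 = pi * r\<^sup>2 + pi * (2 * r + 1)" by (simp add: power2_eq_square algebra_simps)
  then have "real (card S) \<le> pi * r\<^sup>2 + pi * (2 * r + 1)" using upper by simp
  moreover have "pi * (2 * r + 1) \<le> (63 / 20) * (2 * r + 1)" using r pi by (intro mult_right_mono) auto
  ultimately have 1: "real (card S) - pi * r\<^sup>2 \<le> 7 * (r + 1)" using r by argo
  have "pi * r\<^sup>2 - real (card S) \<le> 7 * (r + 1)"
  proof (cases "r \<ge> 1")
    case True
    have "pi * (r - 1)\<^sup>2 = pi * r\<^sup>2 - pi * (2 * r - 1)" by (simp add: power2_eq_square algebra_simps)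
    then have "pi * r\<^sup>2 - pi * (2 * r - 1) \<le> real (card S)" using lower[OF True] by simp
    moreover have "pi * (2 * r - 1) \<le> (63 / 20) * (2 * r - 1)" using True pi by (intro mult_right_mono) auto
    ultimately show ?thesis using r by argo
  next
    case False
    have "pi * r\<^sup>2 \<le> (63 / 20) * 1\<^sup>2" using False r pi by (intro mult_mono power_mono) auto
    then show ?thesis using r by simp
  qed
  then show "\<bar>real (card {k. cmod (cplx k - w) < r}) - pi * r\<^sup>2\<bar> \<le> 7 * (r + 1)"
    using 1 by (simp add: S_def abs_le_iff)
qed

text \<open>Division by D turns the class of y0 into the full lattice and the disc into one of
  radius \<open>sqrt (X / gnorm D)\<close> around w, which in general is not a lattice
  point.\<close>

lemma card_gdisc_dvd:
  assumes "D \<noteq> 0" "X \<ge> 0"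
  shows "\<bar>real (card {y \<in> gdisc z X. D dvd y - y0}) - pi * X / gnorm D\<bar> \<le> 7 * (sqrt (X / gnorm D) + 1)"
proof -
  define w where "w = (cplx z - cplx y0) / cplx D"
  define r where "r = sqrt (X / gnorm D)"
  have D: "cplx D \<noteq> 0" using gnorm_pos[OF assms(1)] by (auto simp: gnorm_eq_cplx)
  have rD: "r * cmod (cplx D) = sqrt X"
    using D by (simp add: r_def real_sqrt_divide gnorm_eq_cplx)
  have iff: "y0 + D * k \<in> gdisc z X \<longleftrightarrow> cmod (cplx k - w) < r" for k
  proof -
    have "cplx (y0 + D * k - z) = cplx D * (cplx k - w)"
      using D by (simp add: w_def field_simps)
    then have "cmod (cplx (y0 + D * k - z)) = cmod (cplx D) * cmod (cplx k - w)"
      by (simp only: norm_mult)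
    then have "y0 + D * k \<in> gdisc z X \<longleftrightarrow> cmod (cplx D) * cmod (cplx k - w) < r * cmod (cplx D)"
      using assms(2) by (simp add: gdisc_def gnorm_less_iff rD del: cplx_simps)
    also have "\<dots> \<longleftrightarrow> cmod (cplx k - w) < r"
      using D by (simp add: mult.commute)
    finally show ?thesis .
  qed
  have "{y \<in> gdisc z X. D dvd y - y0} = (\<lambda>k. y0 + D * k) ` {k. cmod (cplx k - w) < r}"
  proof (intro equalityI subsetI)
    fix y assume y: "y \<in> {y \<in> gdisc z X. D dvd y - y0}"
    then obtain k where "y - y0 = D * k" by auto
    then have "y = y0 + D * k" by (simp add: algebra_simps)
    then show "y \<in> (\<lambda>k. y0 + D * k) ` {k. cmod (cplx k - w) < r}" using y iff by blast
  qed (use iff in auto)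
  then have "card {y \<in> gdisc z X. D dvd y - y0} = card {k. cmod (cplx k - w) < r}"
    using assms(1) by (simp add: card_image inj_on_def)
  moreover have "r\<^sup>2 = X / gnorm D" "r \<ge> 0" using assms(2) by (simp_all add: r_def)
  ultimately show ?thesis using lattice_points_disc(2)[of r w] by (simp add: r_def)
qed

text \<open>The error term is made uniform in D, for use where counts to many moduli are combined
  with signs.\<close>

lemma card_gdisc_dvd_asymp:
  assumes "D \<noteq> 0" "X \<ge> 1"
  shows "\<bar>real (card {y \<in> gdisc z X. D dvd y - y0}) - pi * X / gnorm D\<bar> \<le> 14 * sqrt X"
proof -
  have "X / gnorm D \<le> X / 1" using assms gnorm_ge_1[of D] gnorm_pos[of D] by (intro divide_left_mono) auto
  then have "sqrt (X / gnorm D) \<le> sqrt X" by (subst real_sqrt_le_iff) simp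
  moreover have "1 \<le> sqrt X" using assms by simp
  moreover have "\<bar>real (card {y \<in> gdisc z X. D dvd y - y0}) - pi * X / gnorm D\<bar> \<le> 7 * (sqrt (X / gnorm D) + 1)"
    using assms by (intro card_gdisc_dvd) auto
  ultimately show ?thesis by argo
qed

text \<open>For large D the main term falls below 1 while a single point may remain, hence the
  \<open>+ 1\<close>. The square root in the error is absorbed by
  \<open>2 * sqrt t \<le> t + 1\<close>.\<close>

lemma card_gdisc_dvd_le:
  assumes "D \<noteq> 0" "X \<ge> 0"
  shows "real (card {y \<in> gdisc z X. D dvd y - y0}) \<le> 12 * (X / gnorm D + 1)"
proof -
  define t where "t = X / gnorm D"
  have t: "t \<ge> 0" using assms by (simp add: t_def)
  have "0 \<le> (sqrt t - 1)\<^sup>2" by simp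
  then have "2 * sqrt t \<le> t + 1" using t by (simp add: power2_eq_square algebra_simps)
  moreover have "pi * t \<le> 4 * t" using t pi_less_4 by (intro mult_right_mono) auto
  moreover have "real (card {y \<in> gdisc z X. D dvd y - y0}) - pi * t \<le> 7 * (sqrt t + 1)"
    using card_gdisc_dvd[OF assms, of z y0] by (simp only: t_def abs_le_iff times_divide_eq_right)
  ultimately have "real (card {y \<in> gdisc z X. D dvd y - y0}) \<le> 12 * (t + 1)" using t by argo
  then show ?thesis by (simp add: t_def)
qed

lemma card_gdisc_le:
  assumes "X \<ge> 1"
  shows "real (card (gdisc z X)) \<le> 24 * X"
  using card_gdisc_dvd_le[of 1 X z 0] assms by simp

lemma card_gdisc_asymp:
  assumes "X \<ge> 1"
  shows "\<bar>real (card (gdisc z X)) - pi * X\<bar> \<le> 14 * sqrt X"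
  using card_gdisc_dvd_asymp[of 1 X z 0] assms by simp

lemma sum_nat_abs_le:
  fixes f :: "nat \<Rightarrow> real"
  assumes "finite A" "summable f" "\<And>k. f k \<ge> 0"
  shows "(\<Sum>a\<in>A. f (nat \<bar>a\<bar>)) \<le> 2 * suminf f"
proof -
  define B where "B = (\<lambda>a. nat \<bar>a\<bar>) ` A"
  have B: "finite B" using assms(1) by (simp add: B_def)
  have "A \<subseteq> int ` B \<union> (\<lambda>k. - int k) ` B"
  proof
    fix a assume a: "a \<in> A"
    then have "nat \<bar>a\<bar> \<in> B" by (simp add: B_def)
    moreover have "a = int (nat \<bar>a\<bar>) \<or> a = - int (nat \<bar>a\<bar>)" by auto
    ultimately show "a \<in> int ` B \<union> (\<lambda>k. - int k) ` B" by blast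
  qed
  then have "(\<Sum>a\<in>A. f (nat \<bar>a\<bar>)) \<le> (\<Sum>a\<in>int ` B \<union> (\<lambda>k. - int k) ` B. f (nat \<bar>a\<bar>))"
    using B assms(3) by (intro sum_mono2) auto
  also have "\<dots> \<le> (\<Sum>a\<in>int ` B. f (nat \<bar>a\<bar>)) + (\<Sum>a\<in>(\<lambda>k. - int k) ` B. f (nat \<bar>a\<bar>))"
    using B assms(3) by (subst sum_Un) (auto intro!: sum_nonneg)
  also have "\<dots> = 2 * (\<Sum>k\<in>B. f k)"
    by (simp add: sum.reindex inj_on_def)
  also have "\<dots> \<le> 2 * suminf f"
    using assms B by (intro mult_left_mono sum_le_suminf) auto
  finally show ?thesis .
qed

section \<open>Convergent Euler products and Rankin's trick\<close>

text \<open>With a and b the absolute values of the coordinates,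
  \<open>(1 + a) * (1 + b) \<le> 4 * gnorm n\<close> for nonzero n, so the lattice sum is dominated
  by a product of two convergent sums over the integers.\<close>

lemma gauss_zeta_bound:
  assumes s: "s > 1"
  obtains Z where "\<And>U. finite U \<Longrightarrow> 0 \<notin> U \<Longrightarrow> (\<Sum>n\<in>U. gnorm n powr (- s)) \<le> Z"
proof -
  define h where "h = (\<lambda>a::int. (1 + \<bar>real_of_int a\<bar>) powr (- s))"
  define f where "f = (\<lambda>k. (1 + real k) powr (- s))"
  have summ: "summable f"
    using s summable_real_powr_iff[of "- s"] unfolding f_def
    by (subst (asm) summable_Suc_iff[symmetric]) (simp add: add.commute)
  have f0: "f k \<ge> 0" for k by (simp add: f_def)
  define Z0 where "Z0 = suminf f"
  have Z0_nonneg: "Z0 \<ge> 0" unfolding Z0_def by (intro suminf_nonneg summ f0)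
  have one: "(\<Sum>a\<in>{- int m..int m}. h a) \<le> 2 * Z0" for m
    using sum_nat_abs_le[of "{- int m..int m}" f] summ f0 by (simp add: h_def f_def Z0_def)
  have "(\<Sum>n\<in>U. gnorm n powr (- s)) \<le> 4 powr s * ((2 * Z0) * (2 * Z0))" if U: "finite U" "0 \<notin> U" for U
  proof -
    have "finite ((\<lambda>n. nat \<bar>ReZ n\<bar>) ` U \<union> (\<lambda>n. nat \<bar>ImZ n\<bar>) ` U)" using U by auto
    then obtain m where m: "\<forall>k\<in>(\<lambda>n. nat \<bar>ReZ n\<bar>) ` U \<union> (\<lambda>n. nat \<bar>ImZ n\<bar>) ` U. k \<le> m"
      using finite_nat_set_iff_bounded_le by blast
    have "\<bar>ReZ n\<bar> \<le> int m \<and> \<bar>ImZ n\<bar> \<le> int m" if "n \<in> U" for n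
      using m that by (metis UnI1 UnI2 imageI nat_le_iff)
    then have sub: "(\<lambda>n. (ReZ n, ImZ n)) ` U \<subseteq> {- int m..int m} \<times> {- int m..int m}"
      by (fastforce simp: abs_le_iff)
    have trm: "gnorm n powr (- s) \<le> 4 powr s * (h (ReZ n) * h (ImZ n))" if "n \<in> U" for n
    proof -
      define a b where "a = \<bar>real_of_int (ReZ n)\<bar>" and "b = \<bar>real_of_int (ImZ n)\<bar>"
      have "n \<noteq> 0" using that U by auto
      then have g1: "gnorm n \<ge> 1" by (rule gnorm_ge_1)
      have gn: "gnorm n = a\<^sup>2 + b\<^sup>2" by (simp add: gnorm_def gauss_norm_def a_def b_def)
      have le: "\<bar>real_of_int x\<bar> \<le> \<bar>real_of_int x\<bar>\<^sup>2" for x :: int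
      proof (cases "x = 0")
        case False
        then have "1 \<le> real_of_int \<bar>x\<bar>" by (subst of_int_1_le_iff) linarith
        then show ?thesis using self_le_power[of "\<bar>real_of_int x\<bar>" 2] by simp
      qed simp
      have "2 * (a * b) \<le> a\<^sup>2 + b\<^sup>2" using sum_squares_bound[of a b] by simp
      moreover have "a \<le> a\<^sup>2" "b \<le> b\<^sup>2" using le by (simp_all add: a_def b_def)
      ultimately have "(1 + a) * (1 + b) \<le> 4 * gnorm n"
        using g1 gn by (simp add: algebra_simps)
      then have "(4 * gnorm n) powr (- s) \<le> ((1 + a) * (1 + b)) powr (- s)"
        using s by (intro powr_mono2') (auto simp: a_def b_def intro: mult_pos_pos add_pos_nonneg)
      then have "4 powr s * (4 powr (- s) * gnorm n powr (- s)) \<le> 4 powr s * (h (ReZ n) * h (ImZ n))"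
        by (simp add: powr_mult h_def a_def b_def)
      moreover have "4 powr s * (4 powr (- s) * gnorm n powr (- s)) = gnorm n powr (- s)"
        by (simp add: powr_minus field_simps)
      ultimately show ?thesis by simp
    qed
    have "(\<Sum>n\<in>U. gnorm n powr (- s)) \<le> (\<Sum>n\<in>U. 4 powr s * (h (ReZ n) * h (ImZ n)))"
      by (intro sum_mono trm)
    also have "\<dots> = 4 powr s * (\<Sum>(a, b)\<in>(\<lambda>n. (ReZ n, ImZ n)) ` U. h a * h b)"
      by (subst sum.reindex) (auto simp: inj_on_def gauss_int_eq_iff sum_distrib_left)
    also have "\<dots> \<le> 4 powr s * (\<Sum>(a, b)\<in>{- int m..int m} \<times> {- int m..int m}. h a * h b)"
      by (intro mult_left_mono sum_mono2 sub) (auto simp: h_def)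
    also have "\<dots> = 4 powr s * ((\<Sum>a\<in>{- int m..int m}. h a) * (\<Sum>a\<in>{- int m..int m}. h a))"
      by (simp add: sum_product sum.cartesian_product)
    also have "\<dots> \<le> 4 powr s * ((2 * Z0) * (2 * Z0))"
      by (intro mult_left_mono mult_mono one) (auto simp: h_def intro!: sum_nonneg Z0_nonneg)
    finally show ?thesis .
  qed
  then show ?thesis using that by blast
qed

text \<open>By \<open>1 + x \<le> exp x\<close> the product is controlled by the sum of
  \<open>gnorm \<rho> powr (- s)\<close>, part of the sum over all nonzero Gaussian integers. The
  constant depends on s and c only and serves every finite set of primes and every choice of local
  weights b.\<close>

lemma euler_product_bound:
  assumes "s > 1" "c \<ge> 0"
  shows "\<exists>K\<ge>1. \<forall>b U. finite U \<longrightarrow> U \<subseteq> gprimes \<longrightarrow> (\<forall>\<rho>\<in>U. 0 \<le> b \<rho> \<and> b \<rho> \<le> c * gnorm \<rho> powr (- s)) \<longrightarrow> (\<Prod>\<rho>\<in>U. 1 + b \<rho>) \<le> K"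
proof -
  obtain Z where Z: "\<And>U. finite U \<Longrightarrow> 0 \<notin> U \<Longrightarrow> (\<Sum>n\<in>U. gnorm n powr (- s)) \<le> Z"
    using gauss_zeta_bound[OF assms(1)] by blast
  have Z0: "Z \<ge> 0" using Z[of "{}"] by simp
  show ?thesis
  proof (intro exI[of _ "exp (c * Z)"] conjI allI impI)
    show "exp (c * Z) \<ge> 1" using Z0 assms by simp
    fix b U assume U: "finite U" "U \<subseteq> gprimes" and b: "\<forall>\<rho>\<in>U. 0 \<le> b \<rho> \<and> b \<rho> \<le> c * gnorm \<rho> powr (- s)"
    have "(\<Prod>\<rho>\<in>U. 1 + b \<rho>) \<le> (\<Prod>\<rho>\<in>U. exp (c * gnorm \<rho> powr (- s)))"
    proof (rule prod_mono)
      fix \<rho> assume "\<rho> \<in> U"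
      then have "0 \<le> b \<rho>" "b \<rho> \<le> c * gnorm \<rho> powr (- s)" using b by auto
      then show "0 \<le> 1 + b \<rho> \<and> 1 + b \<rho> \<le> exp (c * gnorm \<rho> powr (- s))"
        using exp_ge_add_one_self[of "c * gnorm \<rho> powr (- s)"] by linarith
    qed
    also have "\<dots> = exp (c * (\<Sum>\<rho>\<in>U. gnorm \<rho> powr (- s)))"
      by (simp add: exp_sum[OF U(1)] sum_distrib_left)
    also have "\<dots> \<le> exp (c * Z)"
      using Z[OF U(1)] U(2) gprimes_nonzero assms(2) by (auto intro!: mult_left_mono)
    finally show "(\<Prod>\<rho>\<in>U. 1 + b \<rho>) \<le> exp (c * Z)" .
  qed
qed

lemma sum_prod_le_prod_add_1:
  fixes b :: "'a \<Rightarrow> real"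
  assumes "finite U" "\<C> \<subseteq> Pow U" "\<And>x. x \<in> U \<Longrightarrow> b x \<ge> 0"
  shows "(\<Sum>A\<in>\<C>. prod b A) \<le> (\<Prod>x\<in>U. 1 + b x)"
proof -
  have "(\<Sum>A\<in>\<C>. prod b A) \<le> (\<Sum>A\<in>Pow U. prod b A)"
    using assms by (intro sum_mono2) (auto intro!: prod_nonneg)
  also have "\<dots> = (\<Prod>x\<in>U. b x + 1)"
    by (subst prod_add) (auto simp: assms(1))
  finally show ?thesis by (simp add: add.commute)
qed

text \<open>The summand is multiplicative in A, so the sum is part of an expanded Euler product over
  the primes that occur. Any fixed base c is allowed, and so factors exponential in
  \<open>card A\<close> can be absorbed later.\<close>

lemma rankin_bound:
  assumes "s > 1" "c \<ge> 0"
  shows "\<exists>K\<ge>1. \<forall>\<C>. finite \<C> \<longrightarrow> (\<forall>A\<in>\<C>. finite A \<and> A \<subseteq> gprimes) \<longrightarrow> (\<Sum>A\<in>\<C>. c ^ card A * prod gnorm A powr (- s)) \<le> K"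
proof -
  obtain K where K: "K \<ge> 1" and all: "\<forall>b U. finite U \<longrightarrow> U \<subseteq> gprimes \<longrightarrow> (\<forall>\<rho>\<in>U. 0 \<le> b \<rho> \<and> b \<rho> \<le> c * gnorm \<rho> powr (- s)) \<longrightarrow> (\<Prod>\<rho>\<in>U. 1 + b \<rho>) \<le> K"
    using euler_product_bound[OF assms] by blast
  show ?thesis
  proof (intro exI[of _ K] conjI allI impI K)
    fix \<C> assume \<C>: "finite \<C>" "\<forall>A\<in>\<C>. finite A \<and> A \<subseteq> gprimes"
    have "(\<Sum>A\<in>\<C>. c ^ card A * prod gnorm A powr (- s)) = (\<Sum>A\<in>\<C>. \<Prod>\<rho>\<in>A. c * gnorm \<rho> powr (- s))"
      by (intro sum.cong refl) (simp add: prod.distrib prod_powr_distrib)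
    also have "\<dots> \<le> (\<Prod>\<rho>\<in>\<Union>\<C>. 1 + c * gnorm \<rho> powr (- s))"
      using \<C> assms(2) by (intro sum_prod_le_prod_add_1) auto
    also have "\<dots> \<le> K" using \<C> assms(2) by (intro all[rule_format]) auto
    finally show "(\<Sum>A\<in>\<C>. c ^ card A * prod gnorm A powr (- s)) \<le> K" .
  qed
qed

section \<open>The Selberg sieve\<close>

definition sieve_weight :: "gauss_int \<Rightarrow> real" where
  "sieve_weight \<rho> = 1 / (gnorm \<rho> - 1)"

definition psi :: "gauss_int \<Rightarrow> gauss_int \<Rightarrow> real" where
  "psi \<rho> n = (if \<rho> dvd n then - 1 else sieve_weight \<rho>)"

definition Psi :: "gauss_int set \<Rightarrow> gauss_int \<Rightarrow> real" where
  "Psi A n = (\<Prod>\<rho>\<in>A. psi \<rho> n)"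

text \<open>Such sets encode the squarefree Gaussian integers of norm at most R up to units, with
  \<open>prod gnorm A\<close> as the norm.\<close>

definition sieve_sets :: "real \<Rightarrow> gauss_int set set" where
  "sieve_sets R = {A. finite A \<and> A \<subseteq> gprimes \<and> prod gnorm A \<le> R}"

text \<open>Selberg's sum of 1/\<phi>(d) over squarefree d of norm at most R, where \<phi> is
  Euler's function of the Gaussian integers.\<close>

definition sieve_mass :: "real \<Rightarrow> real" where
  "sieve_mass R = (\<Sum>A\<in>sieve_sets R. prod sieve_weight A)"

text \<open>A single division by \<open>sieve_mass R\<close> leaves the value
  \<open>sieve_mass R\<close> at points free of small primes, and gives coefficients over the
  \<open>Psi C\<close> that are bounded in terms of \<open>card C\<close> alone.\<close>

definition sieve_majorant :: "real \<Rightarrow> gauss_int \<Rightarrow> real" where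
  "sieve_majorant R n = (\<Sum>A\<in>sieve_sets R. Psi A n)\<^sup>2 / sieve_mass R"

text \<open>The last identity expresses that \<open>psi \<rho>\<close> has mean zero: with weight g
  and norm N the mean is \<open>- 1/N + g * (1 - 1/N)\<close>, which equals
  \<open>g - (1 + g)/N\<close>. All orthogonality rests on it.\<close>

lemma sieve_weight_bounds:
  assumes "\<rho> \<in> gprimes"
  shows "0 < sieve_weight \<rho>" "sieve_weight \<rho> \<le> 1" "sieve_weight \<rho> \<le> 2 / gnorm \<rho>"
    "(1 + sieve_weight \<rho>) / gnorm \<rho> = sieve_weight \<rho>"
  using gprimes_gnorm_ge[OF assms] by (auto simp: sieve_weight_def field_simps)

lemma abs_psi_le: "\<rho> \<in> gprimes \<Longrightarrow> \<bar>psi \<rho> n\<bar> \<le> 1"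
  using sieve_weight_bounds[of \<rho>] by (auto simp: psi_def)

lemma abs_psi_less: "\<rho> \<in> gprimes \<Longrightarrow> \<not> \<rho> dvd n \<Longrightarrow> \<bar>psi \<rho> n\<bar> \<le> 2 / gnorm \<rho>"
  using sieve_weight_bounds[of \<rho>] by (auto simp: psi_def)

lemma abs_Psi_le: "A \<subseteq> gprimes \<Longrightarrow> \<bar>Psi A n\<bar> \<le> 1"
  unfolding Psi_def abs_prod using abs_psi_le by (intro prod_le_1) auto

lemma psi_square: "psi \<rho> n * psi \<rho> n = (sieve_weight \<rho> - 1) * psi \<rho> n + sieve_weight \<rho>"
  by (simp add: psi_def algebra_simps)

lemma prod_gnorm_ge_1: "A \<subseteq> gprimes \<Longrightarrow> prod gnorm A \<ge> 1"
  using gprimes_gnorm_ge by (intro prod_ge_1) force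

lemma prod_gnorm_mono:
  assumes "finite B" "A \<subseteq> B" "B \<subseteq> gprimes"
  shows "prod gnorm A \<le> prod gnorm B"
  using assms gprimes_gnorm_ge by (intro prod_mono2) force+

lemma prod_gnorm_Un_le:
  assumes "finite A" "finite B" "A \<subseteq> gprimes" "B \<subseteq> gprimes"
  shows "prod gnorm (A \<union> B) \<le> prod gnorm A * prod gnorm B"
proof -
  have "prod gnorm (A \<union> B) = prod gnorm A * prod gnorm (B - A)"
    using assms by (subst prod.union_disjoint[symmetric]) auto
  also have "\<dots> \<le> prod gnorm A * prod gnorm B"
    using assms by (intro mult_left_mono prod_gnorm_mono prod_nonneg) auto
  finally show ?thesis .
qed

lemma sieve_sets_memD:
  assumes "A \<in> sieve_sets R"
  shows "finite A" "A \<subseteq> gprimes" "prod gnorm A \<le> R" "\<And>\<rho>. \<rho> \<in> A \<Longrightarrow> gnorm \<rho> \<le> R"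
proof -
  show A: "finite A" "A \<subseteq> gprimes" "prod gnorm A \<le> R" using assms by (auto simp: sieve_sets_def)
  show "gnorm \<rho> \<le> R" if "\<rho> \<in> A" for \<rho>
    using prod_gnorm_mono[of A "{\<rho>}"] A that by auto
qed

lemma finite_sieve_sets [simp]: "finite (sieve_sets R)"
proof (rule finite_subset)
  show "sieve_sets R \<subseteq> Pow {n. gnorm n < R + 1}"
    using sieve_sets_memD(4) by force
qed (simp add: finite_gnorm_less)

lemma sieve_sets_subset: "A \<in> sieve_sets R \<Longrightarrow> B \<subseteq> A \<Longrightarrow> B \<in> sieve_sets R"
  unfolding sieve_sets_def using prod_gnorm_mono[of A B] by (auto intro: finite_subset)

lemma empty_in_sieve_sets: "R \<ge> 1 \<Longrightarrow> {} \<in> sieve_sets R"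
  by (simp add: sieve_sets_def)

lemma prod_sieve_weight_nonneg: "A \<subseteq> gprimes \<Longrightarrow> prod sieve_weight A \<ge> 0"
  using sieve_weight_bounds(1) by (intro prod_nonneg) force

lemma sieve_mass_ge_1:
  assumes "R \<ge> 1" shows "sieve_mass R \<ge> 1"
proof -
  have "(\<Sum>A\<in>{{}}. prod sieve_weight A) \<le> sieve_mass R"
    unfolding sieve_mass_def using empty_in_sieve_sets[OF assms]
    by (intro sum_mono2) (auto intro: prod_sieve_weight_nonneg[OF sieve_sets_memD(2)])
  then show ?thesis by simp
qed

text \<open>Primes in exactly one of the two sets occur once. At a common prime the square of
  \<open>psi\<close> is linear in \<open>psi\<close>, and T collects the common primes at which the
  linear term is chosen.\<close>

lemma Psi_mult:
  assumes "finite A" "finite B"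
  shows "Psi A n * Psi B n = (\<Sum>T\<in>Pow (A \<inter> B). (\<Prod>\<rho>\<in>T. sieve_weight \<rho> - 1) * prod sieve_weight (A \<inter> B - T)
            * Psi ((A - B) \<union> (B - A) \<union> T) n)"
proof -
  have "Psi A n = Psi (A - B) n * Psi (A \<inter> B) n" "Psi B n = Psi (B - A) n * Psi (A \<inter> B) n"
    unfolding Psi_def using assms by (subst prod.union_disjoint[symmetric]; force intro: prod.cong)+
  then have "Psi A n * Psi B n = (Psi (A - B) n * Psi (B - A) n) * (\<Prod>\<rho>\<in>A \<inter> B. psi \<rho> n * psi \<rho> n)"
    by (simp add: Psi_def prod.distrib algebra_simps)
  also have "\<dots> = (\<Sum>T\<in>Pow (A \<inter> B). (Psi (A - B) n * Psi (B - A) n) *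
      ((\<Prod>\<rho>\<in>T. (sieve_weight \<rho> - 1) * psi \<rho> n) * prod sieve_weight (A \<inter> B - T)))"
    unfolding psi_square using assms by (subst prod_add) (auto simp: sum_distrib_left)
  also have "\<dots> = (\<Sum>T\<in>Pow (A \<inter> B). (\<Prod>\<rho>\<in>T. sieve_weight \<rho> - 1) * prod sieve_weight (A \<inter> B - T)
            * Psi ((A - B) \<union> (B - A) \<union> T) n)"
  proof (rule sum.cong[OF refl])
    fix T assume T: "T \<in> Pow (A \<inter> B)"
    then have "finite T" using assms finite_subset by auto
    then have "Psi ((A - B) \<union> (B - A) \<union> T) n = Psi (A - B) n * Psi (B - A) n * Psi T n"
      unfolding Psi_def using assms T by (subst prod.union_disjoint; (subst prod.union_disjoint)?; auto)+
    then show "(Psi (A - B) n * Psi (B - A) n) * ((\<Prod>\<rho>\<in>T. (sieve_weight \<rho> - 1) * psi \<rho> n) * prod sieve_weight (A \<inter> B - T))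
        = (\<Prod>\<rho>\<in>T. sieve_weight \<rho> - 1) * prod sieve_weight (A \<inter> B - T) * Psi ((A - B) \<union> (B - A) \<union> T) n"
      by (simp add: prod.distrib Psi_def mult_ac)
  qed
  finally show ?thesis .
qed

text \<open>Expanding the square and linearising every product yields terms indexed by triples
  \<open>(A, B, T)\<close>, which are grouped by the set C that they produce. The coefficients are
  estimated by absolute values, without cancellation.\<close>

lemma sieve_square_expansion:
  assumes R: "R \<ge> 1"
  obtains v where "\<And>C. C \<in> sieve_sets (R * R) \<Longrightarrow> \<bar>v C\<bar> \<le> 4 ^ card C"
    and "\<And>n. sieve_majorant R n = (\<Sum>C\<in>sieve_sets (R * R). v C * Psi C n)"
proof -
  define I where "I = (SIGMA A:sieve_sets R. SIGMA B:sieve_sets R. Pow (A \<inter> B))"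
  define co where "co = (\<lambda>(A::gauss_int set, B, T). (\<Prod>\<rho>\<in>T. sieve_weight \<rho> - 1) * prod sieve_weight (A \<inter> B - T))"
  define \<phi> where "\<phi> = (\<lambda>(A::gauss_int set, B, T). (A - B) \<union> (B - A) \<union> T)"
  define v where "v = (\<lambda>C. (\<Sum>i\<in>{i \<in> I. \<phi> i = C}. co i) / sieve_mass R)"
  have G: "sieve_mass R \<ge> 1" by (rule sieve_mass_ge_1[OF R])
  have finI: "finite I" unfolding I_def
    by (intro finite_SigmaI) (auto dest: sieve_sets_memD(1))
  have img: "\<phi> ` I \<subseteq> sieve_sets (R * R)"
  proof clarsimp
    fix A B T assume "(A, B, T) \<in> I"
    then have A: "A \<in> sieve_sets R" and B: "B \<in> sieve_sets R" and T: "T \<subseteq> A \<inter> B" by (auto simp: I_def)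
    note A' = sieve_sets_memD[OF A] and B' = sieve_sets_memD[OF B]
    have "prod gnorm (A \<union> B) \<le> prod gnorm A * prod gnorm B" using A' B' by (intro prod_gnorm_Un_le)
    also have "\<dots> \<le> R * R" using A' B' R by (intro mult_mono prod_nonneg) auto
    finally have "A \<union> B \<in> sieve_sets (R * R)" using A' B' by (simp add: sieve_sets_def)
    then show "\<phi> (A, B, T) \<in> sieve_sets (R * R)"
      by (rule sieve_sets_subset) (use T in \<open>auto simp: \<phi>_def\<close>)
  qed
  have "sieve_majorant R n = (\<Sum>C\<in>sieve_sets (R * R). v C * Psi C n)" for n
  proof -
    have "(\<Sum>A\<in>sieve_sets R. Psi A n)\<^sup>2 = (\<Sum>A\<in>sieve_sets R. \<Sum>B\<in>sieve_sets R. Psi A n * Psi B n)"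
      by (simp add: power2_eq_square sum_product)
    also have "\<dots> = (\<Sum>A\<in>sieve_sets R. \<Sum>B\<in>sieve_sets R. \<Sum>T\<in>Pow (A \<inter> B). co (A, B, T) * Psi (\<phi> (A, B, T)) n)"
      by (intro sum.cong refl) (simp add: Psi_mult sieve_sets_memD(1) co_def \<phi>_def)
    also have "\<dots> = (\<Sum>i\<in>I. co i * Psi (\<phi> i) n)"
      unfolding I_def by (simp add: sum.Sigma split_def sieve_sets_memD(1))
    also have "\<dots> = (\<Sum>C\<in>sieve_sets (R * R). \<Sum>i\<in>{i \<in> I. \<phi> i = C}. co i * Psi (\<phi> i) n)"
      by (rule sum.group[symmetric]) (use finI img in auto)
    also have "\<dots> = (\<Sum>C\<in>sieve_sets (R * R). (\<Sum>i\<in>{i \<in> I. \<phi> i = C}. co i) * Psi C n)"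
      by (intro sum.cong refl) (simp add: sum_distrib_right)
    finally show ?thesis by (simp add: sieve_majorant_def v_def sum_divide_distrib[where A = "sieve_sets (R * R)"])
  qed
  moreover have "\<bar>v C\<bar> \<le> 4 ^ card C" if C: "C \<in> sieve_sets (R * R)" for C
  proof -
    note C' = sieve_sets_memD[OF C]
    define J where "J = {i \<in> I. \<phi> i = C}"
    \<comment> \<open>A triple in \<open>J\<close> is determined by two subsets of \<open>C\<close> and the set \<open>A \<inter> B - T\<close>, and the weights of
      the latter sum to at most \<open>sieve_mass R\<close>, which the normalisation of \<open>v\<close> cancels.\<close>
    define \<theta> where "\<theta> = (\<lambda>(A::gauss_int set, B, T). (A \<inter> C, B \<inter> C, A \<inter> B - T))"
    define K where "K = Pow C \<times> Pow C \<times> sieve_sets R"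
    have co: "\<bar>co i\<bar> \<le> prod sieve_weight (snd (snd (\<theta> i)))" if "i \<in> J" for i
    proof -
      obtain A B T where i: "i = (A, B, T)" by (cases i)
      have A: "A \<in> sieve_sets R" and T: "T \<subseteq> A \<inter> B" using that by (auto simp: I_def J_def i)
      then have sub: "T \<subseteq> gprimes" "A \<inter> B - T \<subseteq> gprimes" using sieve_sets_memD(2)[OF A] by auto
      have "\<bar>\<Prod>\<rho>\<in>T. sieve_weight \<rho> - 1\<bar> \<le> 1"
        unfolding abs_prod using sieve_weight_bounds sub by (intro prod_le_1) (force simp: abs_le_iff)
      moreover have w: "prod sieve_weight (A \<inter> B - T) \<ge> 0" using prod_sieve_weight_nonneg sub by blast
      ultimately have "\<bar>\<Prod>\<rho>\<in>T. sieve_weight \<rho> - 1\<bar> * prod sieve_weight (A \<inter> B - T) \<le> 1 * prod sieve_weight (A \<inter> B - T)"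
        by (intro mult_right_mono)
      then show ?thesis using w by (simp add: co_def i \<theta>_def abs_mult)
    qed
    have inj: "inj_on \<theta> J"
    proof (rule inj_onI)
      \<comment> \<open>\<open>A - B\<close> and T lie in C, so A is the union of
        \<open>A \<inter> C\<close> and \<open>A \<inter> B - T\<close>, and likewise for B. As C
        meets \<open>A \<inter> B\<close> exactly in T, the set T is recovered as well.\<close>
      have rec: "fst i = fst (\<theta> i) \<union> snd (snd (\<theta> i)) \<and> fst (snd i) = fst (snd (\<theta> i)) \<union> snd (snd (\<theta> i))
          \<and> snd (snd i) = fst i \<inter> fst (snd i) \<inter> C" if "i \<in> J" for i
        using that by (cases i) (auto simp: J_def I_def \<phi>_def \<theta>_def)
      fix i j assume "i \<in> J" "j \<in> J" "\<theta> i = \<theta> j"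
      then show "i = j" using rec[of i] rec[of j] by (metis prod_eq_iff)
    qed
    have sub: "\<theta> ` J \<subseteq> K"
    proof
      fix k assume "k \<in> \<theta> ` J"
      then obtain A B T where k: "k = \<theta> (A, B, T)" "A \<in> sieve_sets R" by (auto simp: J_def I_def)
      then have "A \<inter> B - T \<in> sieve_sets R" by (elim sieve_sets_subset) auto
      then show "k \<in> K" by (simp add: k \<theta>_def K_def)
    qed
    have "\<bar>\<Sum>i\<in>J. co i\<bar> \<le> (\<Sum>i\<in>J. prod sieve_weight (snd (snd (\<theta> i))))"
      by (rule order_trans[OF sum_abs sum_mono]) (rule co)
    also have "\<dots> = (\<Sum>k\<in>\<theta> ` J. prod sieve_weight (snd (snd k)))"
      by (simp add: sum.reindex[OF inj])
    also have "\<dots> \<le> (\<Sum>k\<in>K. prod sieve_weight (snd (snd k)))"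
      using C'(1) by (intro sum_mono2 sub)
        (auto simp: K_def intro: prod_sieve_weight_nonneg[OF sieve_sets_memD(2)])
    also have "\<dots> = (\<Sum>X\<in>Pow C. \<Sum>Y\<in>Pow C. sieve_mass R)"
      unfolding K_def sieve_mass_def by (simp add: sum.cartesian_product')
    also have "\<dots> = 4 ^ card C * sieve_mass R"
      using C'(1) by (simp add: card_Pow flip: power_mult_distrib)
    finally have "\<bar>\<Sum>i\<in>J. co i\<bar> \<le> 4 ^ card C * sieve_mass R" .
    then show ?thesis using G by (simp add: v_def J_def abs_divide field_simps)
  qed
  ultimately show ?thesis using that by blast
qed

lemma sum_Psi_rough:
  assumes "\<And>\<rho>. \<rho> \<in> gprimes \<Longrightarrow> gnorm \<rho> \<le> R \<Longrightarrow> \<not> \<rho> dvd n"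
  shows "(\<Sum>A\<in>sieve_sets R. Psi A n) = sieve_mass R"
  unfolding sieve_mass_def Psi_def
proof (intro sum.cong refl prod.cong)
  fix A \<rho> assume A: "A \<in> sieve_sets R" "\<rho> \<in> A"
  then have "\<rho> \<in> gprimes" "gnorm \<rho> \<le> R" using sieve_sets_memD(2,4)[OF A(1)] by auto
  then show "psi \<rho> n = sieve_weight \<rho>" using assms by (simp add: psi_def)
qed

section \<open>Lower bound for the sieve mass\<close>

text \<open>\<open>sieve_weight \<rho>\<close> is the geometric series of the powers of
  \<open>1 / gnorm \<rho>\<close>, starting at the first power. Up to units the mass is thus the sum
  of 1/N over the numbers whose squarefree kernel has norm at most R; these include all numbers of
  norm at most R. The 4 counts the units.\<close>

lemma sum_inverse_gnorm_le:
  assumes R: "R \<ge> 1"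
  shows "(\<Sum>n\<in>{n. n \<noteq> 0 \<and> gnorm n \<le> R}. 1 / gnorm n) \<le> 4 * sieve_mass R"
proof -
  define W where "W = {1, - 1, Gauss_Int 0 1, Gauss_Int 0 (- 1)}"
  have finW: "finite W" by (simp add: W_def)
  have cardW: "card W \<le> 4" unfolding W_def by (intro card_insert_le_m1) auto
  \<comment> \<open>Since \<open>gnorm \<rho> \<ge> 2\<close>, exponents in the factorization of a
    number of norm at most R do not exceed R; the cut-off keeps the index set finite.\<close>
  define K where "K = nat \<lceil>R\<rceil>"
  define J where "J = W \<times> (SIGMA A:sieve_sets R. PiE A (\<lambda>_. {1..K}))"
  \<comment> \<open>Only the existence of a prime factorization is used: \<open>F\<close> need not be injective.\<close>
  define F where "F = (\<lambda>(u::gauss_int, A, e). u * (\<Prod>\<rho>\<in>A. \<rho> ^ e \<rho>))"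
  have finS: "finite (SIGMA A:sieve_sets R. PiE A (\<lambda>_. {1..K}))"
    by (intro finite_SigmaI finite_PiE) (auto dest: sieve_sets_memD(1))
  then have finJ: "finite J" unfolding J_def using finW by blast
  have gF: "gnorm (F (u, A, e)) = (\<Prod>\<rho>\<in>A. gnorm \<rho> ^ e \<rho>)" if "u \<in> W" for u A e
  proof -
    have "gnorm u = 1" using that by (auto simp: W_def gnorm_def gauss_norm_def)
    then show ?thesis by (simp add: F_def gnorm_mult gnorm_prod gnorm_power)
  qed
  have sub: "{n. n \<noteq> 0 \<and> gnorm n \<le> R} \<subseteq> F ` J"
  proof clarify
    fix n assume n: "n \<noteq> 0" "gnorm n \<le> R"
    obtain u A e where f: "u dvd 1" "finite A" "A \<subseteq> gprimes" "\<forall>\<rho>\<in>A. e \<rho> \<ge> (1::nat)" "n = u * (\<Prod>\<rho>\<in>A. \<rho> ^ e \<rho>)"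
      using gprimes_factorization[OF n(1)] by blast
    have u: "u \<in> W" using f(1) by (cases rule: gauss_unit_cases) (auto simp: W_def)
    have gn: "gnorm n = (\<Prod>\<rho>\<in>A. gnorm \<rho> ^ e \<rho>)" using gF[OF u, of A e] f(5) by (simp add: F_def)
    have ge1: "gnorm \<rho> ^ k \<ge> 1" if "\<rho> \<in> A" for \<rho> k
      using gprimes_gnorm_ge[of \<rho>] f(3) that by (intro one_le_power) auto
    have "prod gnorm A \<le> gnorm n"
      unfolding gn
    proof (rule prod_mono)
      fix \<rho> assume "\<rho> \<in> A"
      then have "gnorm \<rho> ^ 1 \<le> gnorm \<rho> ^ e \<rho>"
        using gprimes_gnorm_ge[of \<rho>] f(3,4) by (intro power_increasing) auto
      then show "0 \<le> gnorm \<rho> \<and> gnorm \<rho> \<le> gnorm \<rho> ^ e \<rho>" by simp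
    qed
    then have A: "A \<in> sieve_sets R" using f n by (simp add: sieve_sets_def)
    have eK: "e \<rho> \<le> K" if "\<rho> \<in> A" for \<rho>
    proof -
      have "real (e \<rho>) \<le> 2 ^ e \<rho>" using of_nat_less_two_power[of "e \<rho>", where 'a = real] by simp
      also have "\<dots> \<le> gnorm \<rho> ^ e \<rho>" using gprimes_gnorm_ge[of \<rho>] f(3) that by (intro power_mono) auto
      also have "\<dots> = (\<Prod>\<sigma>\<in>{\<rho>}. gnorm \<sigma> ^ e \<sigma>)" by simp
      also have "\<dots> \<le> gnorm n" unfolding gn using f(2) that ge1 
        by (intro prod_mono2) (auto intro: order_trans[OF zero_le_one])
      finally show ?thesis using n(2) unfolding K_def by linarith
    qed
    have "n = F (u, A, restrict e A)" using f(5) by (simp add: F_def)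
    moreover have "(u, A, restrict e A) \<in> J" using u A eK f(4) by (auto simp: J_def)
    ultimately show "n \<in> F ` J" by blast
  qed
  have geo: "(\<Sum>k\<in>{1..K}. (1 / gnorm \<rho>) ^ k) \<le> sieve_weight \<rho>" if "\<rho> \<in> gprimes" for \<rho>
  proof -
    define x where "x = 1 / gnorm \<rho>"
    have g: "gnorm \<rho> \<ge> 2" using gprimes_gnorm_ge that by blast
    then have x: "0 < x" "x < 1" by (auto simp: x_def)
    have "(\<Sum>k\<in>{1..K}. x ^ k) = x * (\<Sum>k<K. x ^ k)"
      by (simp add: sum_distrib_left sum.atLeast1_atMost_eq)
    also have "\<dots> = x * ((1 - x ^ K) / (1 - x))" using x by (subst sum_gp_strict) auto
    also have "\<dots> \<le> x * (1 / (1 - x))" using x by (intro mult_left_mono divide_right_mono) auto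
    also have "\<dots> = sieve_weight \<rho>" using g by (simp add: x_def sieve_weight_def field_simps)
    finally show ?thesis by (simp add: x_def)
  qed
  have "(\<Sum>n\<in>{n. n \<noteq> 0 \<and> gnorm n \<le> R}. 1 / gnorm n) \<le> (\<Sum>n\<in>F ` J. 1 / gnorm n)"
    using finJ by (intro sum_mono2 sub) auto
  also have "\<dots> \<le> (\<Sum>j\<in>J. 1 / gnorm (F j))"
    using sum_image_le[OF finJ, of "\<lambda>n. 1 / gnorm n" F] by (simp add: o_def)
  also have "\<dots> = (\<Sum>(u, A, e)\<in>J. \<Prod>\<rho>\<in>A. (1 / gnorm \<rho>) ^ e \<rho>)"
    by (intro sum.cong refl) (auto simp: J_def gF prod_dividef power_one_over)
  also have "\<dots> = real (card W) * (\<Sum>(A, e)\<in>(SIGMA A:sieve_sets R. PiE A (\<lambda>_. {1..K})). \<Prod>\<rho>\<in>A. (1 / gnorm \<rho>) ^ e \<rho>)"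
    unfolding J_def by (simp add: sum.cartesian_product[symmetric])
  also have "(\<Sum>(A, e)\<in>(SIGMA A:sieve_sets R. PiE A (\<lambda>_. {1..K})). \<Prod>\<rho>\<in>A. (1 / gnorm \<rho>) ^ e \<rho>)
      = (\<Sum>A\<in>sieve_sets R. \<Sum>e\<in>PiE A (\<lambda>_. {1..K}). \<Prod>\<rho>\<in>A. (1 / gnorm \<rho>) ^ e \<rho>)"
    by (rule sum.Sigma[symmetric]) (auto intro!: finite_PiE dest: sieve_sets_memD(1))
  also have "\<dots> = (\<Sum>A\<in>sieve_sets R. \<Prod>\<rho>\<in>A. \<Sum>k\<in>{1..K}. (1 / gnorm \<rho>) ^ k)"
    by (intro sum.cong refl prod_sum_PiE[symmetric]) (auto dest: sieve_sets_memD(1))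
  also have "\<dots> \<le> sieve_mass R"
    unfolding sieve_mass_def by (intro sum_mono prod_mono conjI geo sum_nonneg) (auto dest: sieve_sets_memD(2))
  also have "real (card W) * sieve_mass R \<le> 4 * sieve_mass R"
    using cardW sieve_mass_ge_1[OF R] by (intro mult_right_mono) auto
  finally show ?thesis by (simp add: mult_left_mono)
qed

text \<open>Only the points k + ib with 0 \<le> b < k \<le> m are used. For each k there are k of
  them, of norm at most \<open>2 * k^2\<close>, which together contribute at least 1/(2k), and the
  harmonic sum remains.\<close>

lemma sum_inverse_gnorm_ge:
  assumes "2 * real m ^ 2 \<le> R"
  shows "ln (real m + 1) / 2 \<le> (\<Sum>n\<in>{n. n \<noteq> 0 \<and> gnorm n \<le> R}. 1 / gnorm n)"
proof -
  define T where "T = (SIGMA k:{1..m}. {..<k})"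
  define F where "F = (\<lambda>(k, b). Gauss_Int (int k) (int b))"
  have gF: "gnorm (F (k, b)) = real k ^ 2 + real b ^ 2" for k b
    by (simp add: F_def gnorm_def gauss_norm_def)
  have b2: "real b ^ 2 \<le> real k ^ 2" if "b < k" for b k :: nat
    using that by (intro power_mono) auto
  have inj: "inj_on F T" by (auto simp: inj_on_def F_def gauss_int_eq_iff)
  have "ln (real m + 1) / 2 \<le> harm m / (2::real)" using ln_le_harm[of m] by simp
  also have "\<dots> = (\<Sum>k\<in>{1..m}. \<Sum>b\<in>{..<k}. 1 / (2 * real k ^ 2))"
    unfolding harm_def sum_divide_distrib by (intro sum.cong refl) (auto simp: field_simps power2_eq_square)
  also have "\<dots> = (\<Sum>(k, b)\<in>T. 1 / (2 * real k ^ 2))"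
    unfolding T_def by (rule sum.Sigma) auto
  also have "\<dots> \<le> (\<Sum>j\<in>T. 1 / gnorm (F j))"
  proof (rule sum_mono, clarify)
    fix k b assume "(k, b) \<in> T"
    then have "b < k" by (auto simp: T_def)
    then show "1 / (2 * real k ^ 2) \<le> 1 / gnorm (F (k, b))"
      unfolding gF using b2[of b k] by (intro divide_left_mono) (auto intro!: mult_pos_pos add_pos_nonneg)
  qed
  also have "\<dots> = (\<Sum>n\<in>F ` T. 1 / gnorm n)" by (simp add: sum.reindex[OF inj])
  also have "\<dots> \<le> (\<Sum>n\<in>{n. n \<noteq> 0 \<and> gnorm n \<le> R}. 1 / gnorm n)"
  proof (rule sum_mono2)
    show "finite {n. n \<noteq> 0 \<and> gnorm n \<le> R}"
      by (rule finite_subset[OF _ finite_gnorm_less[of "R + 1"]]) auto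
    show "F ` T \<subseteq> {n. n \<noteq> 0 \<and> gnorm n \<le> R}"
    proof clarsimp
      fix k b assume "(k, b) \<in> T"
      then have kb: "b < k" "k \<le> m" "k \<ge> 1" by (auto simp: T_def)
      have "real k ^ 2 \<le> real m ^ 2" using kb by (intro power_mono) auto
      then have "gnorm (F (k, b)) \<le> R" unfolding gF using b2[OF kb(1)] assms by linarith
      moreover have "F (k, b) \<noteq> 0" using kb by (simp add: F_def gauss_int_eq_iff)
      ultimately show "F (k, b) \<noteq> 0 \<and> gnorm (F (k, b)) \<le> R" by blast
    qed
  qed auto
  finally show ?thesis .
qed

text \<open>The two preceding bounds, with m the integer part of sqrt(R/2), give the factor 16; one
  more unit covers \<open>ln 2\<close>, as the mass is at least 1.\<close>

lemma ln_le_sieve_mass: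
  assumes R: "R \<ge> 1"
  shows "ln R \<le> 17 * sieve_mass R"
proof -
  define m where "m = nat \<lfloor>sqrt (R / 2)\<rfloor>"
  have m: "real m \<le> sqrt (R / 2)" "sqrt (R / 2) \<le> real m + 1"
    using R by (auto simp: m_def)
  have "real m ^ 2 \<le> (sqrt (R / 2)) ^ 2" using m by (intro power_mono) auto
  then have "2 * real m ^ 2 \<le> R" using R by simp
  then have "ln (real m + 1) / 2 \<le> 4 * sieve_mass R"
    using sum_inverse_gnorm_ge[of m R] sum_inverse_gnorm_le[OF R] by linarith
  moreover have "ln (sqrt (R / 2)) \<le> ln (real m + 1)"
    using m R by (subst ln_le_cancel_iff) auto
  moreover have "ln (sqrt (R / 2)) = (ln R - ln 2) / 2"
    using R by (simp add: ln_sqrt ln_div)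
  moreover have "ln (2::real) \<le> 1" using ln_le_minus_one[of "2::real"] by simp
  ultimately show ?thesis using sieve_mass_ge_1[OF R] by argo
qed

section \<open>Correlations of the sieve functions\<close>

text \<open>The coefficients of \<open>Psi A\<close> over divisibility indicators: with weight g,
  \<open>psi \<rho> n\<close> is \<open>g - (1 + g) * of_bool (\<rho> dvd n)\<close>, and S is the
  set of primes at which the indicator is chosen.\<close>

definition psi_coeff :: "gauss_int set \<Rightarrow> gauss_int set \<Rightarrow> real" where
  "psi_coeff A S = (\<Prod>\<rho>\<in>S. - (1 + sieve_weight \<rho>)) * prod sieve_weight (A - S)"

lemma prod_of_bool_dvd:
  assumes "finite S" "S \<subseteq> gprimes"
  shows "(\<Prod>\<rho>\<in>S. of_bool (\<rho> dvd n) :: real) = of_bool (\<Prod>S dvd n)"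
proof -
  have "(\<Prod>\<rho>\<in>S. of_bool (\<rho> dvd n) :: real) = of_bool (\<forall>\<rho>\<in>S. \<rho> dvd n)"
    using assms(1) by (induction S) auto
  then show ?thesis by (simp add: gprimes_prod_dvd_iff[OF assms])
qed

lemma Psi_expansion:
  assumes "finite A" "A \<subseteq> gprimes"
  shows "Psi A n = (\<Sum>S\<in>Pow A. psi_coeff A S * of_bool (\<Prod>S dvd n))"
proof -
  have "Psi A n = (\<Prod>\<rho>\<in>A. - (1 + sieve_weight \<rho>) * of_bool (\<rho> dvd n) + sieve_weight \<rho>)"
    unfolding Psi_def psi_def by (intro prod.cong) auto
  also have "\<dots> = (\<Sum>S\<in>Pow A. (\<Prod>\<rho>\<in>S. - (1 + sieve_weight \<rho>) * of_bool (\<rho> dvd n)) * prod sieve_weight (A - S))"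
    by (rule prod_add[OF assms(1)])
  also have "\<dots> = (\<Sum>S\<in>Pow A. psi_coeff A S * of_bool (\<Prod>S dvd n))"
  proof (rule sum.cong[OF refl])
    fix S assume S: "S \<in> Pow A"
    then have "finite S" "S \<subseteq> gprimes" using assms finite_subset by auto
    then show "(\<Prod>\<rho>\<in>S. - (1 + sieve_weight \<rho>) * of_bool (\<rho> dvd n)) * prod sieve_weight (A - S) =
        psi_coeff A S * of_bool (\<Prod>S dvd n)"
      unfolding prod.distrib psi_coeff_def by (subst prod_of_bool_dvd) simp_all
  qed
  finally show ?thesis .
qed

text \<open>The sum factors into \<open>1 + 2 * sieve_weight \<rho>\<close> over the primes of A,
  and weights are at most 1.\<close>

lemma sum_abs_psi_coeff:
  assumes "finite A" "A \<subseteq> gprimes"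
  shows "(\<Sum>S\<in>Pow A. \<bar>psi_coeff A S\<bar>) \<le> 3 ^ card A"
proof -
  have "(\<Sum>S\<in>Pow A. \<bar>psi_coeff A S\<bar>) = (\<Sum>S\<in>Pow A. (\<Prod>\<rho>\<in>S. 1 + sieve_weight \<rho>) * prod sieve_weight (A - S))"
  proof (rule sum.cong[OF refl])
    fix S assume "S \<in> Pow A"
    then have w: "\<rho> \<in> S \<Longrightarrow> sieve_weight \<rho> > 0" "\<rho> \<in> A - S \<Longrightarrow> sieve_weight \<rho> > 0" for \<rho>
      using assms sieve_weight_bounds(1) by auto
    have "\<bar>\<Prod>\<rho>\<in>S. - (1 + sieve_weight \<rho>)\<bar> = (\<Prod>\<rho>\<in>S. 1 + sieve_weight \<rho>)"
      unfolding abs_prod using w(1) by (intro prod.cong refl) force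
    moreover have "\<bar>prod sieve_weight (A - S)\<bar> = prod sieve_weight (A - S)"
      unfolding abs_prod using w(2) by (intro prod.cong refl) force
    ultimately show "\<bar>psi_coeff A S\<bar> = (\<Prod>\<rho>\<in>S. 1 + sieve_weight \<rho>) * prod sieve_weight (A - S)"
      by (simp add: psi_coeff_def abs_mult)
  qed
  also have "\<dots> = (\<Prod>\<rho>\<in>A. (1 + sieve_weight \<rho>) + sieve_weight \<rho>)"
    by (rule prod_add[OF assms(1), symmetric])
  also have "\<dots> \<le> (\<Prod>\<rho>\<in>A. 3)"
    using assms(2) sieve_weight_bounds(1,2) by (intro prod_mono) (force intro: add_mono[of _ 2 _ 1, simplified])
  finally show ?thesis by simp
qed

text \<open>This is the density of the y with \<open>\<Prod>S dvd y - x\<close> and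
  \<open>\<Prod>T dvd y - x'\<close>, where m is \<open>x - x'\<close>: the congruences are
  compatible exactly if every common prime divides m.\<close>

definition joint_density :: "gauss_int set \<Rightarrow> gauss_int set \<Rightarrow> gauss_int \<Rightarrow> real" where
  "joint_density S T m = of_bool (\<forall>\<rho>\<in>S \<inter> T. \<rho> dvd m) / prod gnorm (S \<union> T)"

text \<open>Compatible congruences merge, by the Chinese remainder theorem, into one class modulo
  the product over \<open>S \<union> T\<close>; incompatible ones have no common solution.\<close>

lemma card_joint_dvd:
  assumes S: "finite S" "S \<subseteq> gprimes" and T: "finite T" "T \<subseteq> gprimes" and X: "X \<ge> 1"
  shows "\<bar>real (card {y \<in> gdisc z X. \<Prod>S dvd y - x \<and> \<Prod>T dvd y - x'}) - pi * X * joint_density S T (x - x')\<bar> \<le> 14 * sqrt X"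
proof (cases "\<forall>\<rho>\<in>S \<inter> T. \<rho> dvd x - x'")
  case True
  define U where "U = S \<union> T"
  have U: "finite U" "U \<subseteq> gprimes" using S T by (auto simp: U_def)
  obtain y0 where y0: "\<And>\<rho>. \<rho> \<in> U \<Longrightarrow> \<rho> dvd y0 - (if \<rho> \<in> S then x else x')"
    using gprimes_chinese_remainder[OF U, of "\<lambda>\<rho>. if \<rho> \<in> S then x else x'"] by metis
  have x0: "\<rho> dvd y0 - x" if "\<rho> \<in> S" for \<rho> using y0[of \<rho>] that by (simp add: U_def)
  have x0': "\<rho> dvd y0 - x'" if "\<rho> \<in> T" for \<rho>
  proof (cases "\<rho> \<in> S")
    case r: True
    then have "\<rho> dvd (y0 - x) + (x - x')" using x0 True that by (intro dvd_add) auto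
    then show ?thesis by simp
  next
    case False
    then show ?thesis using y0[of \<rho>] that by (simp add: U_def)
  qed
  have shift: "\<rho> dvd y - a \<longleftrightarrow> \<rho> dvd y - y0" if "\<rho> dvd y0 - a" for \<rho> y a
  proof -
    have "y - a = (y - y0) + (y0 - a)" by simp
    then show ?thesis using that dvd_add_left_iff by metis
  qed
  have "\<Prod>S dvd y - x \<and> \<Prod>T dvd y - x' \<longleftrightarrow> \<Prod>U dvd y - y0" for y
    unfolding gprimes_prod_dvd_iff[OF S] gprimes_prod_dvd_iff[OF T] gprimes_prod_dvd_iff[OF U]
    using shift[OF x0] shift[OF x0'] by (auto simp: U_def)
  then have eq: "{y \<in> gdisc z X. \<Prod>S dvd y - x \<and> \<Prod>T dvd y - x'} = {y \<in> gdisc z X. \<Prod>U dvd y - y0}"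
    by simp
  have "\<Prod>U \<noteq> 0" using U gprimes_nonzero by auto
  then show ?thesis
    using card_gdisc_dvd_asymp[of "\<Prod>U" X z y0] X True
    by (simp add: eq joint_density_def gnorm_prod U_def)
next
  case False
  then obtain \<rho> where \<rho>: "\<rho> \<in> S" "\<rho> \<in> T" "\<not> \<rho> dvd x - x'" by auto
  have "False" if "\<Prod>S dvd y - x" "\<Prod>T dvd y - x'" for y
  proof -
    have "\<rho> dvd y - x" "\<rho> dvd y - x'"
      using that \<rho> gprimes_prod_dvd_iff[OF S] gprimes_prod_dvd_iff[OF T] by auto
    then have "\<rho> dvd (y - x') - (y - x)" by (rule dvd_diff[rotated])
    then show False using \<rho>(3) by simp
  qed
  then have eq: "{y \<in> gdisc z X. \<Prod>S dvd y - x \<and> \<Prod>T dvd y - x'} = {}" by blast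
  have "joint_density S T (x - x') = 0" using False by (simp add: joint_density_def)
  then show ?thesis using X by (simp only: eq) simp
qed

text \<open>The sum over T factors over the primes of B. A prime outside S, of norm N and weight g,
  contributes \<open>- (1 + g)/N + g = 0\<close>, and a prime in S contributes
  \<open>psi \<rho> m\<close>.\<close>

lemma sum_psi_coeff_joint_density:
  assumes B: "finite B" "B \<subseteq> gprimes" and S: "finite S" "S \<subseteq> gprimes"
  shows "(\<Sum>T\<in>Pow B. psi_coeff B T * joint_density S T m) = (if B \<subseteq> S then Psi B m / prod gnorm S else 0)"
proof -
  \<comment> \<open>Prime by prime, t is the density of the condition of T once that of S is
    imposed.\<close>
  define t where "t = (\<lambda>\<rho>. if \<rho> \<in> S then of_bool (\<rho> dvd m) else 1 / gnorm \<rho>)"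
  have dens: "joint_density S T m = prod t T / prod gnorm S" if "T \<in> Pow B" for T
  proof -
    have T: "finite T" using that B finite_subset by auto
    have "prod t T = prod t (T \<inter> S) * prod t (T - S)"
      using T by (subst prod.union_disjoint[symmetric]) (auto intro: prod.cong)
    also have "prod t (T \<inter> S) = of_bool (\<forall>\<rho>\<in>S \<inter> T. \<rho> dvd m)"
    proof -
      have "prod t (T \<inter> S) = (\<Prod>\<rho>\<in>T \<inter> S. of_bool (\<rho> dvd m))" by (rule prod.cong) (auto simp: t_def)
      also have "\<dots> = of_bool (\<Prod>(T \<inter> S) dvd m)" using T S by (intro prod_of_bool_dvd) auto
      finally show ?thesis using gprimes_prod_dvd_iff[of "T \<inter> S" m] T S by auto
    qed
    also have "prod t (T - S) = 1 / prod gnorm (T - S)"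
      unfolding t_def by (simp add: prod_dividef)
    finally have "prod t T / prod gnorm S = of_bool (\<forall>\<rho>\<in>S \<inter> T. \<rho> dvd m) / (prod gnorm S * prod gnorm (T - S))"
      by (simp add: field_simps)
    also have "prod gnorm S * prod gnorm (T - S) = prod gnorm (S \<union> T)"
      using T S by (subst prod.union_disjoint[symmetric]) auto
    finally show ?thesis by (simp add: joint_density_def)
  qed
  have "(\<Sum>T\<in>Pow B. psi_coeff B T * joint_density S T m)
      = (\<Sum>T\<in>Pow B. (\<Prod>\<rho>\<in>T. - (1 + sieve_weight \<rho>) * t \<rho>) * prod sieve_weight (B - T)) / prod gnorm S"
    unfolding sum_divide_distrib by (intro sum.cong refl) (simp add: dens psi_coeff_def prod.distrib)
  also have "(\<Sum>T\<in>Pow B. (\<Prod>\<rho>\<in>T. - (1 + sieve_weight \<rho>) * t \<rho>) * prod sieve_weight (B - T))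
      = (\<Prod>\<rho>\<in>B. - (1 + sieve_weight \<rho>) * t \<rho> + sieve_weight \<rho>)"
    by (rule prod_add[OF B(1), symmetric])
  also have "\<dots> = (if B \<subseteq> S then Psi B m else 0)"
  proof (cases "B \<subseteq> S")
    case True
    then show ?thesis unfolding Psi_def psi_def t_def by (simp, intro prod.cong) auto
  next
    case False
    then obtain \<rho> where \<rho>: "\<rho> \<in> B" "\<rho> \<notin> S" by auto
    then have "(1 + sieve_weight \<rho>) * t \<rho> = sieve_weight \<rho>"
      using sieve_weight_bounds(4)[of \<rho>] B by (auto simp: t_def)
    then have "- (1 + sieve_weight \<rho>) * t \<rho> + sieve_weight \<rho> = 0"
      by (simp only: mult_minus_left)
    then show ?thesis using False B(1) \<rho>(1) by (simp only: prod_zero_iff) auto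
  qed
  finally show ?thesis by simp
qed

text \<open>By the preceding lemma only the S that contain B survive. The sign
  \<open>(- 1)^card S\<close> left on them cancels in pairs along any prime of \<open>A - B\<close>,
  so that nothing remains unless A = B.\<close>

lemma sum_psi_coeff_joint_density2:
  assumes A: "finite A" "A \<subseteq> gprimes" and B: "finite B" "B \<subseteq> gprimes"
  shows "(\<Sum>S\<in>Pow A. \<Sum>T\<in>Pow B. psi_coeff A S * psi_coeff B T * joint_density S T m)
       = (if A = B then (- 1) ^ card A * prod sieve_weight A * Psi A m else 0)"
proof -
  have "(\<Sum>S\<in>Pow A. \<Sum>T\<in>Pow B. psi_coeff A S * psi_coeff B T * joint_density S T m)
      = (\<Sum>S\<in>Pow A. psi_coeff A S * (if B \<subseteq> S then Psi B m / prod gnorm S else 0))"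
  proof (rule sum.cong[OF refl])
    fix S assume "S \<in> Pow A"
    then have "finite S" "S \<subseteq> gprimes" using A finite_subset by auto
    from sum_psi_coeff_joint_density[OF B this, of m]
    show "(\<Sum>T\<in>Pow B. psi_coeff A S * psi_coeff B T * joint_density S T m)
      = psi_coeff A S * (if B \<subseteq> S then Psi B m / prod gnorm S else 0)"
      by (simp add: sum_distrib_left[symmetric] mult.assoc)
  qed
  also have "\<dots> = (if A = B then (- 1) ^ card A * prod sieve_weight A * Psi A m else 0)"
  proof (cases "B \<subseteq> A")
    case False
    then have "(\<Sum>S\<in>Pow A. psi_coeff A S * (if B \<subseteq> S then Psi B m / prod gnorm S else 0)) = 0"
      by (intro sum.neutral) auto
    then show ?thesis using False by auto
  next
    case True
    \<comment> \<open>f encodes the constraint \<open>B \<subseteq> S\<close>: its product over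
      \<open>A - S\<close> is 1 if the constraint holds and 0 otherwise, so that the sum over S
      becomes a product again.\<close>
    define f where "f = (\<lambda>\<rho>. if \<rho> \<in> B then 0 else 1 :: real)"
    have "psi_coeff A S * (if B \<subseteq> S then Psi B m / prod gnorm S else 0)
        = prod sieve_weight A * Psi B m * ((\<Prod>\<rho>\<in>S. - 1) * prod f (A - S))" if S: "S \<in> Pow A" for S
    proof -
      have finS: "finite S" using S A finite_subset by auto
      have "prod f (A - S) = (if B \<subseteq> S then 1 else 0)"
      proof (cases "B \<subseteq> S")
        case True
        then show ?thesis by (auto simp: f_def intro!: prod.neutral)
      next
        case False
        then obtain \<rho> where "\<rho> \<in> B" "\<rho> \<notin> S" by auto
        then have "\<exists>a\<in>A - S. f a = 0" using True by (auto simp: f_def)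
        from prod_zero[OF finite_Diff[OF A(1)] this] show ?thesis using False by simp
      qed
      moreover have "psi_coeff A S / prod gnorm S = prod sieve_weight A * (\<Prod>\<rho>\<in>S. - 1)"
      proof -
        have "psi_coeff A S / prod gnorm S = (\<Prod>\<rho>\<in>S. - (1 + sieve_weight \<rho>) / gnorm \<rho>) * prod sieve_weight (A - S)"
          by (simp add: psi_coeff_def prod_dividef)
        also have "(\<Prod>\<rho>\<in>S. - (1 + sieve_weight \<rho>) / gnorm \<rho>) = (\<Prod>\<rho>\<in>S. sieve_weight \<rho> * - 1)"
        proof (rule prod.cong[OF refl])
          fix \<rho> assume "\<rho> \<in> S"
          then have "(1 + sieve_weight \<rho>) / gnorm \<rho> = sieve_weight \<rho>"
            using sieve_weight_bounds(4)[of \<rho>] A S by auto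
          then show "- (1 + sieve_weight \<rho>) / gnorm \<rho> = sieve_weight \<rho> * - 1"
            by (simp only: minus_divide_left[symmetric] mult_minus_right mult_1_right)
        qed
        also have "\<dots> = prod sieve_weight S * (\<Prod>\<rho>\<in>S. - 1)" by (rule prod.distrib)
        finally have "psi_coeff A S / prod gnorm S = (prod sieve_weight (A - S) * prod sieve_weight S) * (\<Prod>\<rho>\<in>S. - 1)"
          by (simp only: mult_ac)
        then show ?thesis using S A by (simp add: prod.subset_diff[of S A sieve_weight])
      qed
      moreover have "psi_coeff A S * (if B \<subseteq> S then Psi B m / prod gnorm S else 0)
          = (psi_coeff A S / prod gnorm S) * Psi B m * (if B \<subseteq> S then 1 else 0)" by simp
      ultimately show ?thesis by (simp only: mult_ac)
    qed
    then have "(\<Sum>S\<in>Pow A. psi_coeff A S * (if B \<subseteq> S then Psi B m / prod gnorm S else 0))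
        = prod sieve_weight A * Psi B m * (\<Sum>S\<in>Pow A. (\<Prod>\<rho>\<in>S. - 1) * prod f (A - S))"
      by (simp add: sum_distrib_left)
    also have "(\<Sum>S\<in>Pow A. (\<Prod>\<rho>\<in>S. - 1) * prod f (A - S)) = (\<Prod>\<rho>\<in>A. - 1 + f \<rho>)"
      by (rule prod_add[OF A(1), symmetric])
    also have "\<dots> = (if A = B then (- 1) ^ card A else 0)"
    proof (cases "A = B")
      case True
      then show ?thesis by (simp add: f_def)
    next
      case False
      then have "\<exists>\<rho>\<in>A. - 1 + f \<rho> = 0" using \<open>B \<subseteq> A\<close> by (auto simp: f_def)
      from prod_zero[OF A(1) this] show ?thesis using False by simp
    qed
    finally show ?thesis by simp
  qed
  finally show ?thesis .
qed

text \<open>Up to the lattice point error distinct sets are uncorrelated, and the autocorrelation of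
  \<open>Psi A\<close> is a multiple of \<open>Psi A\<close> itself at the difference of the shifts.
  The powers of 3 bound the absolute sums of the coefficients.\<close>

lemma Psi_correlation:
  assumes A: "finite A" "A \<subseteq> gprimes" and B: "finite B" "B \<subseteq> gprimes" and X: "X \<ge> 1"
  shows "\<bar>(\<Sum>y\<in>gdisc z X. Psi A (y - x) * Psi B (y - x'))
      - (if A = B then pi * X * ((- 1) ^ card A * prod sieve_weight A * Psi A (x - x')) else 0)\<bar>
      \<le> 14 * sqrt X * (3 ^ card A * 3 ^ card B)"
proof -
  define c where "c = (\<lambda>S T. real (card {y \<in> gdisc z X. \<Prod>S dvd y - x \<and> \<Prod>T dvd y - x'}))"
  have "(\<Sum>y\<in>gdisc z X. Psi A (y - x) * Psi B (y - x'))
      = (\<Sum>y\<in>gdisc z X. \<Sum>S\<in>Pow A. \<Sum>T\<in>Pow B. psi_coeff A S * psi_coeff B T * of_bool (\<Prod>S dvd y - x \<and> \<Prod>T dvd y - x'))"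
    by (simp only: Psi_expansion[OF A] Psi_expansion[OF B] sum_product of_bool_conj mult_ac)
  also have "\<dots> = (\<Sum>S\<in>Pow A. \<Sum>y\<in>gdisc z X. \<Sum>T\<in>Pow B. psi_coeff A S * psi_coeff B T * of_bool (\<Prod>S dvd y - x \<and> \<Prod>T dvd y - x'))"
    by (rule sum.swap)
  also have "\<dots> = (\<Sum>S\<in>Pow A. \<Sum>T\<in>Pow B. \<Sum>y\<in>gdisc z X. psi_coeff A S * psi_coeff B T * of_bool (\<Prod>S dvd y - x \<and> \<Prod>T dvd y - x'))"
    by (intro sum.cong refl sum.swap)
  also have "\<dots> = (\<Sum>S\<in>Pow A. \<Sum>T\<in>Pow B. psi_coeff A S * psi_coeff B T * c S T)"
    unfolding c_def by (simp add: sum_distrib_left[symmetric] sum_of_bool_eq Int_def)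
  finally have eq: "(\<Sum>y\<in>gdisc z X. Psi A (y - x) * Psi B (y - x'))
      = (\<Sum>S\<in>Pow A. \<Sum>T\<in>Pow B. psi_coeff A S * psi_coeff B T * c S T)" .
  have main: "(if A = B then pi * X * ((- 1) ^ card A * prod sieve_weight A * Psi A (x - x')) else 0)
      = (\<Sum>S\<in>Pow A. \<Sum>T\<in>Pow B. psi_coeff A S * psi_coeff B T * (pi * X * joint_density S T (x - x')))"
  proof -
    have "(\<Sum>S\<in>Pow A. \<Sum>T\<in>Pow B. psi_coeff A S * psi_coeff B T * (pi * X * joint_density S T (x - x')))
      = pi * X * (\<Sum>S\<in>Pow A. \<Sum>T\<in>Pow B. psi_coeff A S * psi_coeff B T * joint_density S T (x - x'))"
      by (simp add: sum_distrib_left mult_ac)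
    then show ?thesis by (simp add: sum_psi_coeff_joint_density2[OF A B])
  qed
  have "\<bar>\<Sum>S\<in>Pow A. \<Sum>T\<in>Pow B. psi_coeff A S * psi_coeff B T * (c S T - pi * X * joint_density S T (x - x'))\<bar>
      \<le> (\<Sum>S\<in>Pow A. \<Sum>T\<in>Pow B. \<bar>psi_coeff A S\<bar> * \<bar>psi_coeff B T\<bar> * (14 * sqrt X))"
  proof (rule order_trans[OF sum_abs sum_mono], rule order_trans[OF sum_abs sum_mono])
    fix S T assume "S \<in> Pow A" "T \<in> Pow B"
    then have "finite S" "S \<subseteq> gprimes" "finite T" "T \<subseteq> gprimes" using A B finite_subset by auto
    from card_joint_dvd[OF this X, of z x x']
    show "\<bar>psi_coeff A S * psi_coeff B T * (c S T - pi * X * joint_density S T (x - x'))\<bar>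
        \<le> \<bar>psi_coeff A S\<bar> * \<bar>psi_coeff B T\<bar> * (14 * sqrt X)"
      unfolding abs_mult c_def by (intro mult_left_mono) auto
  qed
  also have "\<dots> = 14 * sqrt X * ((\<Sum>S\<in>Pow A. \<bar>psi_coeff A S\<bar>) * (\<Sum>T\<in>Pow B. \<bar>psi_coeff B T\<bar>))"
    by (subst sum_product) (simp only: sum_distrib_left mult_ac)
  also have "\<dots> \<le> 14 * sqrt X * (3 ^ card A * 3 ^ card B)"
    using X by (intro mult_left_mono mult_mono sum_abs_psi_coeff A B sum_nonneg) auto
  finally show ?thesis
    unfolding eq main by (simp add: sum_subtractf right_diff_distrib)
qed

text \<open>The absolute value of \<open>psi \<rho>\<close> is at most the indicator of the
  multiples of \<rho> plus the weight, a majorant of mean at most 3/N(\<rho>). By the assumption on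
  X every count involved has \<open>X / gnorm (\<Prod>S) \<ge> 1\<close>, so the additive constant
  is absorbed by doubling.\<close>

lemma sum_abs_Psi_gdisc:
  assumes C: "finite C" "C \<subseteq> gprimes" and X: "prod gnorm C \<le> X"
  shows "(\<Sum>y\<in>gdisc z X. \<bar>Psi C (x - y)\<bar>) \<le> 24 * X * (3 ^ card C / prod gnorm C)"
proof -
  have X1: "X \<ge> 1" using prod_gnorm_ge_1[OF C(2)] X by linarith
  have w: "0 < sieve_weight \<rho>" "sieve_weight \<rho> \<le> 2 / gnorm \<rho>" "gnorm \<rho> > 0" if "\<rho> \<in> C" for \<rho>
    using sieve_weight_bounds[of \<rho>] gprimes_gnorm_ge[of \<rho>] C(2) that by auto
  have bound: "\<bar>Psi C n\<bar> \<le> (\<Sum>S\<in>Pow C. of_bool (\<Prod>S dvd n) * prod sieve_weight (C - S))" for n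
  proof -
    have "\<bar>Psi C n\<bar> \<le> (\<Prod>\<rho>\<in>C. of_bool (\<rho> dvd n) + sieve_weight \<rho>)"
      unfolding Psi_def abs_prod using w(1) by (intro prod_mono) (force simp: psi_def)
    also have "\<dots> = (\<Sum>S\<in>Pow C. (\<Prod>\<rho>\<in>S. of_bool (\<rho> dvd n)) * prod sieve_weight (C - S))"
      by (rule prod_add[OF C(1)])
    also have "\<dots> = (\<Sum>S\<in>Pow C. of_bool (\<Prod>S dvd n) * prod sieve_weight (C - S))"
    proof (rule sum.cong[OF refl])
      fix S assume "S \<in> Pow C"
      then have "finite S" "S \<subseteq> gprimes" using C finite_subset by auto
      then show "(\<Prod>\<rho>\<in>S. of_bool (\<rho> dvd n)) * prod sieve_weight (C - S) = of_bool (\<Prod>S dvd n) * prod sieve_weight (C - S)"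
        by (simp only: prod_of_bool_dvd)
    qed
    finally show ?thesis .
  qed
  have cnt: "(\<Sum>y\<in>gdisc z X. of_bool (\<Prod>S dvd x - y)) \<le> 24 * X / prod gnorm S" if S: "S \<in> Pow C" for S
  proof -
    have S': "finite S" "S \<subseteq> gprimes" using S C finite_subset by auto
    have "\<Prod>S \<noteq> 0" using S' gprimes_nonzero by auto
    have "prod gnorm S \<le> X" using prod_gnorm_mono[of C S] C S X by auto
    then have "1 \<le> X / prod gnorm S" using prod_gnorm_ge_1[OF S'(2)] by simp
    have "(\<Sum>y\<in>gdisc z X. of_bool (\<Prod>S dvd x - y)) = real (card {y \<in> gdisc z X. \<Prod>S dvd y - x})"
      by (simp add: sum_of_bool_eq Int_def) (metis dvd_minus_iff minus_diff_eq)
    also have "\<dots> \<le> 12 * (X / gnorm (\<Prod>S) + 1)"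
      using \<open>\<Prod>S \<noteq> 0\<close> X1 by (intro card_gdisc_dvd_le) auto
    also have "\<dots> \<le> 24 * X / prod gnorm S" using \<open>1 \<le> X / prod gnorm S\<close> by (simp add: gnorm_prod)
    finally show ?thesis .
  qed
  have "(\<Sum>y\<in>gdisc z X. \<bar>Psi C (x - y)\<bar>) \<le> (\<Sum>y\<in>gdisc z X. \<Sum>S\<in>Pow C. of_bool (\<Prod>S dvd x - y) * prod sieve_weight (C - S))"
    by (intro sum_mono bound)
  also have "\<dots> = (\<Sum>S\<in>Pow C. (\<Sum>y\<in>gdisc z X. of_bool (\<Prod>S dvd x - y)) * prod sieve_weight (C - S))"
    by (subst sum.swap) (simp add: sum_distrib_right)
  also have "\<dots> \<le> (\<Sum>S\<in>Pow C. 24 * X / prod gnorm S * prod sieve_weight (C - S))"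
    using C by (intro sum_mono mult_right_mono cnt prod_sieve_weight_nonneg) auto
  also have "\<dots> = 24 * X * (\<Sum>S\<in>Pow C. (\<Prod>\<rho>\<in>S. 1 / gnorm \<rho>) * prod sieve_weight (C - S))"
    by (simp add: sum_distrib_left prod_dividef)
  also have "(\<Sum>S\<in>Pow C. (\<Prod>\<rho>\<in>S. 1 / gnorm \<rho>) * prod sieve_weight (C - S)) = (\<Prod>\<rho>\<in>C. 1 / gnorm \<rho> + sieve_weight \<rho>)"
    by (rule prod_add[OF C(1), symmetric])
  also have "\<dots> \<le> (\<Prod>\<rho>\<in>C. 3 / gnorm \<rho>)"
  proof (intro prod_mono conjI)
    fix \<rho> assume \<rho>: "\<rho> \<in> C"
    show "0 \<le> 1 / gnorm \<rho> + sieve_weight \<rho>" using w[OF \<rho>] by simp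
    have "1 / gnorm \<rho> + 2 / gnorm \<rho> = 3 / gnorm \<rho>" by (simp flip: add_divide_distrib)
    then show "1 / gnorm \<rho> + sieve_weight \<rho> \<le> 3 / gnorm \<rho>" using w(2)[OF \<rho>] by linarith
  qed
  also have "\<dots> = 3 ^ card C / prod gnorm C" by (simp add: prod_dividef)
  finally show ?thesis using X1 by (simp add: mult_left_mono)
qed

section \<open>Bounds for the dyadic pieces of the sieve majorant\<close>

text \<open>A diagonal term carries the square of a coefficient, at most \<open>16 ^ card C\<close>,
  and a product of weights, at most \<open>2 ^ card C / prod gnorm C\<close>, whence 32. In the
  error term 12 combines the 4 of the coefficients with the 3 of
  \<open>Psi_correlation\<close>.\<close>

lemma abs_correlation_sum_le:
  assumes \<C>: "finite \<C>" "\<And>C. C \<in> \<C> \<Longrightarrow> finite C \<and> C \<subseteq> gprimes \<and> \<bar>v C\<bar> \<le> 4 ^ card C" and X: "X \<ge> 1"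
  shows "\<bar>\<Sum>y\<in>gdisc z X. (\<Sum>C\<in>\<C>. v C * Psi C (y - x)) * (\<Sum>C\<in>\<C>. v C * Psi C (y - x'))\<bar>
    \<le> (\<Sum>C\<in>\<C>. 4 * X * (32 ^ card C / prod gnorm C) * \<bar>Psi C (x - x')\<bar>) + 14 * sqrt X * (\<Sum>C\<in>\<C>. 12 ^ card C)\<^sup>2"
proof -
  define c where "c = (\<lambda>C C'. \<Sum>y\<in>gdisc z X. Psi C (y - x) * Psi C' (y - x'))"
  define m where "m = (\<lambda>C. pi * X * ((- 1) ^ card C * prod sieve_weight C * Psi C (x - x')))"
  have "(\<Sum>y\<in>gdisc z X. (\<Sum>C\<in>\<C>. v C * Psi C (y - x)) * (\<Sum>C\<in>\<C>. v C * Psi C (y - x')))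
      = (\<Sum>y\<in>gdisc z X. \<Sum>C\<in>\<C>. \<Sum>C'\<in>\<C>. v C * v C' * (Psi C (y - x) * Psi C' (y - x')))"
    by (simp only: sum_product mult_ac)
  also have "\<dots> = (\<Sum>C\<in>\<C>. \<Sum>y\<in>gdisc z X. \<Sum>C'\<in>\<C>. v C * v C' * (Psi C (y - x) * Psi C' (y - x')))"
    by (rule sum.swap)
  also have "\<dots> = (\<Sum>C\<in>\<C>. \<Sum>C'\<in>\<C>. \<Sum>y\<in>gdisc z X. v C * v C' * (Psi C (y - x) * Psi C' (y - x')))"
    by (intro sum.cong refl sum.swap)
  also have "\<dots> = (\<Sum>C\<in>\<C>. \<Sum>C'\<in>\<C>. v C * v C' * c C C')"
    by (simp only: c_def sum_distrib_left)
  also have "\<dots> = (\<Sum>C\<in>\<C>. \<Sum>C'\<in>\<C>. v C * v C' * (if C = C' then m C else 0) + v C * v C' * (c C C' - (if C = C' then m C else 0)))"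
    by (intro sum.cong refl) (simp add: algebra_simps)
  also have "\<dots> = (\<Sum>C\<in>\<C>. v C * v C * m C) + (\<Sum>C\<in>\<C>. \<Sum>C'\<in>\<C>. v C * v C' * (c C C' - (if C = C' then m C else 0)))"
    unfolding sum.distrib using \<C>(1) by (simp add: if_distrib cong: if_cong)
  finally have eq: "(\<Sum>y\<in>gdisc z X. (\<Sum>C\<in>\<C>. v C * Psi C (y - x)) * (\<Sum>C\<in>\<C>. v C * Psi C (y - x'))) = \<dots>" .
  have "\<bar>\<Sum>C\<in>\<C>. v C * v C * m C\<bar> \<le> (\<Sum>C\<in>\<C>. 4 * X * (32 ^ card C / prod gnorm C) * \<bar>Psi C (x - x')\<bar>)"
  proof (rule order_trans[OF sum_abs sum_mono])
    fix C assume "C \<in> \<C>"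
    then have C: "finite C" "C \<subseteq> gprimes" "\<bar>v C\<bar> \<le> 4 ^ card C" using \<C>(2) by auto
    have w: "0 \<le> prod sieve_weight C" by (rule prod_sieve_weight_nonneg[OF C(2)])
    have "prod sieve_weight C \<le> (\<Prod>\<rho>\<in>C. 2 / gnorm \<rho>)"
      using C(2) sieve_weight_bounds(1,3) by (intro prod_mono) (force intro: less_imp_le)
    also have "\<dots> = 2 ^ card C / prod gnorm C" by (simp add: prod_dividef)
    finally have w2: "prod sieve_weight C \<le> 2 ^ card C / prod gnorm C" .
    have m: "\<bar>m C\<bar> \<le> 4 * X * (2 ^ card C / prod gnorm C) * \<bar>Psi C (x - x')\<bar>"
    proof -
      have "\<bar>m C\<bar> = pi * X * prod sieve_weight C * \<bar>Psi C (x - x')\<bar>"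
        using w X by (simp add: m_def abs_mult power_abs)
      also have "\<dots> \<le> 4 * X * (2 ^ card C / prod gnorm C) * \<bar>Psi C (x - x')\<bar>"
        using w w2 X pi_less_4 by (intro mult_right_mono mult_mono) auto
      finally show ?thesis .
    qed
    have "\<bar>v C * v C * m C\<bar> \<le> (4 ^ card C * 4 ^ card C) * (4 * X * (2 ^ card C / prod gnorm C) * \<bar>Psi C (x - x')\<bar>)"
      unfolding abs_mult by (intro mult_mono m C(3)) auto
    also have "\<dots> = 4 * X * ((4 ^ card C * 4 ^ card C * 2 ^ card C) / prod gnorm C) * \<bar>Psi C (x - x')\<bar>"
      by simp
    also have "(4 ^ card C * 4 ^ card C * 2 ^ card C :: real) = 32 ^ card C"
      by (simp flip: power_mult_distrib)
    finally show "\<bar>v C * v C * m C\<bar> \<le> 4 * X * (32 ^ card C / prod gnorm C) * \<bar>Psi C (x - x')\<bar>" .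
  qed
  moreover have "\<bar>\<Sum>C\<in>\<C>. \<Sum>C'\<in>\<C>. v C * v C' * (c C C' - (if C = C' then m C else 0))\<bar> \<le> 14 * sqrt X * (\<Sum>C\<in>\<C>. 12 ^ card C)\<^sup>2"
  proof -
    have "\<bar>\<Sum>C\<in>\<C>. \<Sum>C'\<in>\<C>. v C * v C' * (c C C' - (if C = C' then m C else 0))\<bar>
      \<le> (\<Sum>C\<in>\<C>. \<Sum>C'\<in>\<C>. 14 * sqrt X * (12 ^ card C * 12 ^ card C'))"
    proof (rule order_trans[OF sum_abs sum_mono], rule order_trans[OF sum_abs sum_mono])
      fix C C' assume "C \<in> \<C>" "C' \<in> \<C>"
      then have C: "finite C" "C \<subseteq> gprimes" "\<bar>v C\<bar> \<le> 4 ^ card C" and C': "finite C'" "C' \<subseteq> gprimes" "\<bar>v C'\<bar> \<le> 4 ^ card C'"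
        using \<C>(2) by auto
      have "\<bar>v C * v C' * (c C C' - (if C = C' then m C else 0))\<bar>
          \<le> (4 ^ card C * 4 ^ card C') * (14 * sqrt X * (3 ^ card C * 3 ^ card C'))"
        unfolding abs_mult c_def m_def using X
        by (intro mult_mono C(3) C'(3) Psi_correlation C C') auto
      also have "\<dots> = 14 * sqrt X * ((4 ^ card C * 3 ^ card C) * (4 ^ card C' * 3 ^ card C'))"
        by (simp only: mult_ac)
      also have "\<dots> = 14 * sqrt X * (12 ^ card C * 12 ^ card C')"
        by (simp flip: power_mult_distrib)
      finally show "\<bar>v C * v C' * (c C C' - (if C = C' then m C else 0))\<bar> \<le> 14 * sqrt X * (12 ^ card C * 12 ^ card C')" .
    qed
    also have "\<dots> = 14 * sqrt X * (\<Sum>C\<in>\<C>. 12 ^ card C)\<^sup>2"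
      unfolding power2_eq_square by (subst sum_product) (simp only: sum_distrib_left)
    finally show ?thesis .
  qed
  ultimately show ?thesis unfolding eq by linarith
qed

text \<open>Cauchy-Schwarz in y leaves a quadratic form in x and x' whose entries are correlations,
  and it is bounded by absolute row sums. Their diagonal part gains \<open>1 / sqrt Q0\<close>,
  because the correlation carries a factor \<open>1 / prod gnorm C\<close> and the mean of the
  absolute value of \<open>Psi C\<close> carries another.\<close>

lemma block_L2_bound:
  shows "\<exists>K>0. \<forall>\<C> v Q0 Q X z F G. finite \<C> \<longrightarrow>
    (\<forall>C\<in>\<C>. finite C \<and> C \<subseteq> gprimes \<and> Q0 \<le> prod gnorm C \<and> prod gnorm C \<le> Q \<and> \<bar>v C\<bar> \<le> 4 ^ card C) \<longrightarrow>
    1 \<le> Q0 \<longrightarrow> Q0 \<le> Q \<longrightarrow> Q ^ 9 \<le> X \<longrightarrow> F \<subseteq> gdisc z X \<longrightarrow> G \<subseteq> gdisc z X \<longrightarrow>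
    (\<Sum>x\<in>F. \<Sum>y\<in>G. \<Sum>C\<in>\<C>. v C * Psi C (y - x))\<^sup>2 \<le> K * X\<^sup>2 / sqrt Q0 * real (card F) * real (card G)"
proof -
  obtain K1 where K1_ge: "K1 \<ge> 1" and K1_all: "\<forall>\<C>. finite \<C> \<longrightarrow> (\<forall>A\<in>\<C>. finite A \<and> A \<subseteq> gprimes) \<longrightarrow> (\<Sum>A\<in>\<C>. 96 ^ card A * prod gnorm A powr (- (3/2))) \<le> K1"
    by (atomize_elim, rule rankin_bound) simp_all
  note K1 = K1_ge K1_all[rule_format]
  obtain K2 where K2_ge: "K2 \<ge> 1" and K2_all: "\<forall>\<C>. finite \<C> \<longrightarrow> (\<forall>A\<in>\<C>. finite A \<and> A \<subseteq> gprimes) \<longrightarrow> (\<Sum>A\<in>\<C>. 12 ^ card A * prod gnorm A powr (- 2)) \<le> K2"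
    by (atomize_elim, rule rankin_bound) simp_all
  note K2 = K2_ge K2_all[rule_format]
  define K where "K = 96 * K1 + 336 * K2\<^sup>2"
  have "(\<Sum>x\<in>F. \<Sum>y\<in>G. \<Sum>C\<in>\<C>. v C * Psi C (y - x))\<^sup>2 \<le> K * X\<^sup>2 / sqrt Q0 * real (card F) * real (card G)"
    if \<C>: "finite \<C>" "\<And>C. C \<in> \<C> \<Longrightarrow> finite C \<and> C \<subseteq> gprimes \<and> Q0 \<le> prod gnorm C \<and> prod gnorm C \<le> Q \<and> \<bar>v C\<bar> \<le> 4 ^ card C"
      and Q: "1 \<le> Q0" "Q0 \<le> Q" "Q ^ 9 \<le> X" and F: "F \<subseteq> gdisc z X" and G: "G \<subseteq> gdisc z X" for \<C> v Q0 Q X z F G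
  proof -
    have X: "X \<ge> 1" using one_le_power[of Q 9] Q by linarith
    have QX: "Q \<le> X" using self_le_power[of Q 9] Q by simp
    have finF: "finite F" "finite G" using F G finite_subset finite_gdisc by blast+
    define \<kappa> where "\<kappa> = (\<lambda>n. \<Sum>C\<in>\<C>. v C * Psi C n)"
    define D where "D = gdisc z X"
    \<comment> \<open>The first summand comes from equal sets C, the second from the lattice point
      error at each of at most \<open>24 * X\<close> points x'.\<close>
    define M where "M = 96 * X\<^sup>2 * (K1 / sqrt Q0) + 24 * X * (14 * sqrt X * (Q\<^sup>2 * K2)\<^sup>2)"
    have row: "(\<Sum>x'\<in>D. \<bar>\<Sum>y\<in>D. \<kappa> (y - x) * \<kappa> (y - x')\<bar>) \<le> M" for x
    proof -
      have "(\<Sum>x'\<in>D. \<bar>\<Sum>y\<in>D. \<kappa> (y - x) * \<kappa> (y - x')\<bar>)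
          \<le> (\<Sum>x'\<in>D. (\<Sum>C\<in>\<C>. 4 * X * (32 ^ card C / prod gnorm C) * \<bar>Psi C (x - x')\<bar>) + 14 * sqrt X * (\<Sum>C\<in>\<C>. 12 ^ card C)\<^sup>2)"
        unfolding \<kappa>_def D_def using \<C> X by (intro sum_mono abs_correlation_sum_le) auto
      also have "\<dots> = (\<Sum>C\<in>\<C>. 4 * X * (32 ^ card C / prod gnorm C) * (\<Sum>x'\<in>D. \<bar>Psi C (x - x')\<bar>))
          + real (card D) * (14 * sqrt X * (\<Sum>C\<in>\<C>. 12 ^ card C)\<^sup>2)"
        unfolding sum.distrib by (subst sum.swap) (simp add: sum_distrib_left)
      also have "(\<Sum>C\<in>\<C>. 4 * X * (32 ^ card C / prod gnorm C) * (\<Sum>x'\<in>D. \<bar>Psi C (x - x')\<bar>)) \<le> 96 * X\<^sup>2 * (K1 / sqrt Q0)"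
      proof -
        have "(\<Sum>C\<in>\<C>. 4 * X * (32 ^ card C / prod gnorm C) * (\<Sum>x'\<in>D. \<bar>Psi C (x - x')\<bar>))
            \<le> (\<Sum>C\<in>\<C>. 96 * X\<^sup>2 * (1 / sqrt Q0) * (96 ^ card C * prod gnorm C powr (- (3/2))))"
        proof (rule sum_mono)
          fix C assume "C \<in> \<C>"
          then have C: "finite C" "C \<subseteq> gprimes" "Q0 \<le> prod gnorm C" "prod gnorm C \<le> Q" using \<C>(2) by auto
          define P where "P = prod gnorm C"
          have P: "P \<ge> 1" "Q0 \<le> P" using C prod_gnorm_ge_1 by (auto simp: P_def)
          have "4 * X * (32 ^ card C / P) * (\<Sum>x'\<in>D. \<bar>Psi C (x - x')\<bar>)
              \<le> 4 * X * (32 ^ card C / P) * (24 * X * (3 ^ card C / P))"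
            unfolding P_def D_def using C QX X
            by (intro mult_left_mono sum_abs_Psi_gdisc) (auto intro!: divide_nonneg_nonneg prod_nonneg)
          also have "\<dots> = 96 * X\<^sup>2 * ((32 ^ card C * 3 ^ card C) * (1 / P\<^sup>2))"
            by (simp add: power2_eq_square)
          also have "(32 ^ card C * 3 ^ card C :: real) = 96 ^ card C" by (simp flip: power_mult_distrib)
          \<comment> \<open>Of this decay a square root of P is kept as the gain of the block; the
            remaining exponent 3/2 exceeds 1 and so suffices for Rankin's bound.\<close>
          also have "1 / P\<^sup>2 = (1 / sqrt P) * P powr (- (3/2))"
          proof -
            have "1 / P\<^sup>2 = P powr (- 2)" using P by (simp add: powr_minus powr_numeral field_simps)
            also have "\<dots> = P powr (- (1/2)) * P powr (- (3/2))" by (simp flip: powr_add)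
            also have "P powr (- (1/2)) = 1 / sqrt P" using P by (simp add: powr_minus powr_half_sqrt field_simps)
            finally show ?thesis .
          qed
          also have "96 * X\<^sup>2 * (96 ^ card C * ((1 / sqrt P) * P powr (- (3/2))))
              \<le> 96 * X\<^sup>2 * (96 ^ card C * ((1 / sqrt Q0) * P powr (- (3/2))))"
            using P Q by (intro mult_left_mono mult_right_mono divide_left_mono) auto
          finally show "4 * X * (32 ^ card C / prod gnorm C) * (\<Sum>x'\<in>D. \<bar>Psi C (x - x')\<bar>)
              \<le> 96 * X\<^sup>2 * (1 / sqrt Q0) * (96 ^ card C * prod gnorm C powr (- (3/2)))"
            by (simp add: P_def mult_ac)
        qed
        also have "\<dots> = 96 * X\<^sup>2 * (1 / sqrt Q0) * (\<Sum>C\<in>\<C>. 96 ^ card C * prod gnorm C powr (- (3/2)))"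
          by (simp only: sum_distrib_left)
        also have "\<dots> \<le> 96 * X\<^sup>2 * (1 / sqrt Q0) * K1"
          using \<C> Q by (intro mult_left_mono K1(2)) auto
        finally show ?thesis by simp
      qed
      also have "real (card D) * (14 * sqrt X * (\<Sum>C\<in>\<C>. 12 ^ card C)\<^sup>2) \<le> 24 * X * (14 * sqrt X * (Q\<^sup>2 * K2)\<^sup>2)"
      proof -
        \<comment> \<open>Rankin's trick: \<open>prod gnorm C \<le> Q\<close> buys the convergence
          factor \<open>prod gnorm C powr (- 2)\<close> at the price of \<open>Q^2\<close>.\<close>
        have "(\<Sum>C\<in>\<C>. 12 ^ card C) \<le> (\<Sum>C\<in>\<C>. Q\<^sup>2 * (12 ^ card C * prod gnorm C powr (- 2)))"
        proof (rule sum_mono)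
          fix C assume "C \<in> \<C>"
          then have C: "C \<subseteq> gprimes" "prod gnorm C \<le> Q" using \<C>(2) by auto
          have P: "prod gnorm C \<ge> 1" using C prod_gnorm_ge_1 by auto
          have "(prod gnorm C)\<^sup>2 \<le> Q\<^sup>2" using P C by (intro power_mono) auto
          moreover have "prod gnorm C powr (- 2) = 1 / (prod gnorm C)\<^sup>2"
            using P by (simp add: powr_minus powr_numeral field_simps)
          ultimately have "1 \<le> Q\<^sup>2 * prod gnorm C powr (- 2)" using P by simp
          then have "12 ^ card C * 1 \<le> 12 ^ card C * (Q\<^sup>2 * prod gnorm C powr (- 2))"
            by (intro mult_left_mono) auto
          then show "12 ^ card C \<le> Q\<^sup>2 * (12 ^ card C * prod gnorm C powr (- 2))" by (simp add: mult_ac)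
        qed
        also have "\<dots> = Q\<^sup>2 * (\<Sum>C\<in>\<C>. 12 ^ card C * prod gnorm C powr (- 2))" by (simp only: sum_distrib_left)
        also have "\<dots> \<le> Q\<^sup>2 * K2" using \<C> by (intro mult_left_mono K2(2)) auto
        finally have le: "(\<Sum>C\<in>\<C>. 12 ^ card C) \<le> Q\<^sup>2 * K2" .
        show ?thesis unfolding D_def
          using X le by (intro mult_mono card_gdisc_le power_mono mult_nonneg_nonneg sum_nonneg) auto
      qed
      finally show ?thesis by (simp add: M_def)
    qed
    have M: "M \<le> K * X\<^sup>2 / sqrt Q0"
    proof -
      \<comment> \<open>The error carries \<open>Q ^ 4\<close> against the desired
        \<open>1 / sqrt Q0\<close>; this is the origin of the ninth power of Q in the
        hypothesis.\<close>
      have "(Q ^ 4 * sqrt Q0)\<^sup>2 = Q ^ 8 * Q0" using Q by (simp add: power_mult_distrib flip: power_mult)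
      also have "\<dots> \<le> Q ^ 8 * Q" using Q by (intro mult_left_mono) auto
      also have "\<dots> = Q ^ 9" by (simp add: eval_nat_numeral)
      finally have "(Q ^ 4 * sqrt Q0)\<^sup>2 \<le> X" using Q by simp
      then have "Q ^ 4 * sqrt Q0 \<le> sqrt X" by (rule real_le_rsqrt)
      then have "Q ^ 4 \<le> sqrt X / sqrt Q0" using Q by (simp add: pos_le_divide_eq)
      then have "336 * K2\<^sup>2 * X * sqrt X * Q ^ 4 \<le> 336 * K2\<^sup>2 * X * sqrt X * (sqrt X / sqrt Q0)"
        using X by (intro mult_left_mono) auto
      also have "\<dots> = 336 * K2\<^sup>2 * X * (sqrt X * sqrt X) / sqrt Q0" by simp
      also have "\<dots> = 336 * K2\<^sup>2 * X\<^sup>2 / sqrt Q0" using X by (simp add: power2_eq_square)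
      finally have "336 * K2\<^sup>2 * X * sqrt X * Q ^ 4 \<le> 336 * K2\<^sup>2 * X\<^sup>2 / sqrt Q0" .
      moreover have "24 * X * (14 * sqrt X * (Q\<^sup>2 * K2)\<^sup>2) = 336 * K2\<^sup>2 * X * sqrt X * Q ^ 4"
        by (simp add: power_mult_distrib flip: power_mult)
      moreover have "K * X\<^sup>2 / sqrt Q0 = 96 * X\<^sup>2 * (K1 / sqrt Q0) + 336 * K2\<^sup>2 * X\<^sup>2 / sqrt Q0"
        by (simp add: K_def add_divide_distrib algebra_simps)
      ultimately show ?thesis unfolding M_def by linarith
    qed
    have "(\<Sum>x\<in>F. \<Sum>y\<in>G. \<kappa> (y - x))\<^sup>2 = (\<Sum>y\<in>G. \<Sum>x\<in>F. \<kappa> (y - x))\<^sup>2"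
      by (subst sum.swap) simp
    also have "\<dots> \<le> (\<Sum>y\<in>G. (\<Sum>x\<in>F. \<kappa> (y - x))\<^sup>2) * real (card G)"
      by (rule sum_squared_le_sum_of_squares)
    \<comment> \<open>Enlarging G to the whole disc turns the sums over y into the complete
      correlations estimated in \<open>row\<close>.\<close>
    also have "\<dots> \<le> (\<Sum>y\<in>D. (\<Sum>x\<in>F. \<kappa> (y - x))\<^sup>2) * real (card G)"
      using G by (intro mult_right_mono sum_mono2) (auto simp: D_def)
    also have "(\<Sum>y\<in>D. (\<Sum>x\<in>F. \<kappa> (y - x))\<^sup>2) = (\<Sum>y\<in>D. \<Sum>x\<in>F. \<Sum>x'\<in>F. \<kappa> (y - x) * \<kappa> (y - x'))"
      by (simp only: power2_eq_square sum_product)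
    also have "\<dots> = (\<Sum>x\<in>F. \<Sum>y\<in>D. \<Sum>x'\<in>F. \<kappa> (y - x) * \<kappa> (y - x'))" by (rule sum.swap)
    also have "\<dots> = (\<Sum>x\<in>F. \<Sum>x'\<in>F. \<Sum>y\<in>D. \<kappa> (y - x) * \<kappa> (y - x'))" by (intro sum.cong refl sum.swap)
    also have "\<dots> \<le> (\<Sum>x\<in>F. \<Sum>x'\<in>F. \<bar>\<Sum>y\<in>D. \<kappa> (y - x) * \<kappa> (y - x')\<bar>)"
      by (intro sum_mono) simp
    also have "\<dots> \<le> (\<Sum>x\<in>F. \<Sum>x'\<in>D. \<bar>\<Sum>y\<in>D. \<kappa> (y - x) * \<kappa> (y - x')\<bar>)"
      using F by (intro sum_mono sum_mono2) (auto simp: D_def)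
    also have "\<dots> \<le> (\<Sum>x\<in>F. M)" by (intro sum_mono row)
    also have "\<dots> = M * real (card F)" by simp
    also have "\<dots> \<le> K * X\<^sup>2 / sqrt Q0 * real (card F)" by (intro mult_right_mono M) simp
    finally show ?thesis by (simp add: \<kappa>_def mult_right_mono)
  qed
  note main = this
  have Kpos: "K > 0" using K1(1) by (simp add: K_def add_pos_nonneg)
  show ?thesis
  proof (intro exI[of _ K] conjI allI impI Kpos)
    fix \<C> z F G and v :: "gauss_int set \<Rightarrow> real" and Q0 Q X :: real
    assume a: "finite \<C>" "\<forall>C\<in>\<C>. finite C \<and> C \<subseteq> gprimes \<and> Q0 \<le> prod gnorm C \<and> prod gnorm C \<le> Q \<and> \<bar>v C\<bar> \<le> 4 ^ card C"
      "1 \<le> Q0" "Q0 \<le> Q" "Q ^ 9 \<le> X" "F \<subseteq> gdisc z X" "G \<subseteq> gdisc z X"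
    show "(\<Sum>x\<in>F. \<Sum>y\<in>G. \<Sum>C\<in>\<C>. v C * Psi C (y - x))\<^sup>2 \<le> K * X\<^sup>2 / sqrt Q0 * real (card F) * real (card G)"
      by (rule main[OF a(1) a(2)[rule_format] a(3-)])
  qed
qed

section \<open>Higher moments of the sieve pieces\<close>

text \<open>The convex power lies below its chord over [0, 1], of slope
  \<open>5 ^ r - 1\<close>.\<close>

lemma power_one_plus_le:
  fixes t :: real
  assumes "0 \<le> t" "t \<le> 1"
  shows "(1 + 4 * t) ^ r \<le> 1 + 5 ^ r * t"
proof -
  have "(1 + 4 * t) ^ r \<le> 1 + (5 ^ r - 1) * t"
  proof (induction r)
    case (Suc r)
    have "(1 + 4 * t) ^ Suc r \<le> (1 + 4 * t) * (1 + (5 ^ r - 1) * t)"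
      using Suc assms by (simp add: mult_left_mono)
    also have "\<dots> = 1 + (3 + 5 ^ r) * t + 4 * (5 ^ r - 1) * (t * t)" by (simp add: algebra_simps)
    also have "\<dots> \<le> 1 + (3 + 5 ^ r) * t + 4 * (5 ^ r - 1) * (t * 1)"
      using assms by (intro add_left_mono mult_left_mono) auto
    also have "\<dots> = 1 + (5 ^ Suc r - 1) * t" by (simp add: algebra_simps)
    finally show ?case .
  qed simp
  also have "\<dots> \<le> 1 + 5 ^ r * t" using assms by (intro add_left_mono mult_right_mono) auto
  finally show ?thesis .
qed

text \<open>Rankin's trick replaces the cut-off at Q by the factor \<open>Q powr \<epsilon>\<close>
  and a product over primes. Primes not dividing n contribute a bounded factor, and those dividing n
  give a sum over squarefree divisors that is bounded on average over nonzero n. The term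
  \<open>(Q^2) ^ r\<close> pays for n = 0.\<close>

lemma sieve_moment_bound:
  fixes r :: nat
  assumes \<epsilon>: "\<epsilon> > 0" and r: "r \<ge> 1"
  shows "\<exists>K>0. \<forall>Q X. Q \<ge> 1 \<longrightarrow> X \<ge> 1 \<longrightarrow>
    (\<Sum>n\<in>gdisc 0 X. (\<Sum>C\<in>sieve_sets Q. 4 ^ card C * \<bar>Psi C n\<bar>) ^ r) \<le> K * ((Q powr \<epsilon>) ^ r * X + (Q\<^sup>2) ^ r)"
proof -
  have eps1: "1 + \<epsilon> > 1" using \<epsilon> by simp
  obtain K1 where K1_ge: "K1 \<ge> 1" and K1_all: "\<forall>b U. finite U \<longrightarrow> U \<subseteq> gprimes \<longrightarrow> (\<forall>\<rho>\<in>U. 0 \<le> b \<rho> \<and> b \<rho> \<le> 8 * gnorm \<rho> powr (- (1 + \<epsilon>))) \<longrightarrow> (\<Prod>\<rho>\<in>U. 1 + b \<rho>) \<le> K1"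
    by (atomize_elim, rule euler_product_bound) (use eps1 in simp_all)
  note K1 = K1_ge K1_all[rule_format]
  obtain K2 where K2_ge: "K2 \<ge> 1" and K2_all: "\<forall>b U. finite U \<longrightarrow> U \<subseteq> gprimes \<longrightarrow> (\<forall>\<rho>\<in>U. 0 \<le> b \<rho> \<and> b \<rho> \<le> 5 ^ r * gnorm \<rho> powr (- (1 + \<epsilon>))) \<longrightarrow> (\<Prod>\<rho>\<in>U. 1 + b \<rho>) \<le> K2"
    by (atomize_elim, rule euler_product_bound) (use eps1 in simp_all)
  note K2 = K2_ge K2_all[rule_format]
  obtain K3 where K3_ge: "K3 \<ge> 1" and K3_all: "\<forall>\<C>. finite \<C> \<longrightarrow> (\<forall>A\<in>\<C>. finite A \<and> A \<subseteq> gprimes) \<longrightarrow> (\<Sum>A\<in>\<C>. 4 ^ card A * prod gnorm A powr (- 2)) \<le> K3"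
    by (atomize_elim, rule rankin_bound) simp_all
  note K3 = K3_ge K3_all[rule_format]
  define K where "K = 24 * K1 ^ r * K2 + K3 ^ r"
  have "(\<Sum>n\<in>gdisc 0 X. (\<Sum>C\<in>sieve_sets Q. 4 ^ card C * \<bar>Psi C n\<bar>) ^ r) \<le> K * ((Q powr \<epsilon>) ^ r * X + (Q\<^sup>2) ^ r)"
    if Q: "Q \<ge> 1" and X: "X \<ge> 1" for Q X
  proof -
    define s where "s = (\<lambda>n. \<Sum>C\<in>sieve_sets Q. 4 ^ card C * \<bar>Psi C n\<bar>)"
    define U where "U = {\<rho> \<in> gprimes. gnorm \<rho> \<le> Q}"
    have U: "finite U" "U \<subseteq> gprimes"
      by (auto simp: U_def intro: finite_subset[OF _ finite_gnorm_less[of "Q + 1"]])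
    \<comment> \<open>Rankin weights: their product over a set C in \<open>sieve_sets Q\<close> is
      at least \<open>Q powr (- \<epsilon>)\<close>.\<close>
    define t where "t = (\<lambda>\<rho>. gnorm \<rho> powr (- \<epsilon>))"
    have t: "0 \<le> t \<rho>" "t \<rho> \<le> 1" "t \<rho> / gnorm \<rho> = gnorm \<rho> powr (- (1 + \<epsilon>))" if "\<rho> \<in> gprimes" for \<rho>
    proof -
      have g: "gnorm \<rho> \<ge> 2" by (rule gprimes_gnorm_ge[OF that])
      show "0 \<le> t \<rho>" by (simp add: t_def)
      show "t \<rho> \<le> 1" using g \<epsilon> powr_mono[of "- \<epsilon>" 0 "gnorm \<rho>"] by (simp add: t_def)
      have "gnorm \<rho> powr (- (1 + \<epsilon>)) = gnorm \<rho> powr (- 1) * t \<rho>" unfolding t_def powr_add[symmetric] by simp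
      moreover have "gnorm \<rho> powr (- 1) = 1 / gnorm \<rho>" using g by (simp add: powr_minus_divide)
      ultimately show "t \<rho> / gnorm \<rho> = gnorm \<rho> powr (- (1 + \<epsilon>))" by (metis mult.left_neutral times_divide_eq_left)
    qed
    \<comment> \<open>Every prime divides 0, so \<open>Psi C 0\<close> has absolute value 1 for all
      C and only the trivial estimate is available there.\<close>
    have zero: "s 0 \<le> K3 * Q\<^sup>2"
    proof -
      have "s 0 \<le> (\<Sum>C\<in>sieve_sets Q. Q\<^sup>2 * (4 ^ card C * prod gnorm C powr (- 2)))"
        unfolding s_def
      proof (rule sum_mono)
        fix C assume C: "C \<in> sieve_sets Q"
        note C' = sieve_sets_memD[OF C]
        have P: "prod gnorm C \<ge> 1" using C' prod_gnorm_ge_1 by auto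
        have "(prod gnorm C)\<^sup>2 \<le> Q\<^sup>2" using P C' by (intro power_mono) auto
        moreover have "prod gnorm C powr (- 2) = 1 / (prod gnorm C)\<^sup>2"
          using P by (simp add: powr_minus powr_numeral field_simps)
        ultimately have "1 \<le> Q\<^sup>2 * prod gnorm C powr (- 2)" using P by simp
        then have "\<bar>Psi C 0\<bar> \<le> Q\<^sup>2 * prod gnorm C powr (- 2)" using abs_Psi_le[OF C'(2), of 0] by linarith
        then have "4 ^ card C * \<bar>Psi C 0\<bar> \<le> 4 ^ card C * (Q\<^sup>2 * prod gnorm C powr (- 2))"
          by (intro mult_left_mono) auto
        then show "4 ^ card C * \<bar>Psi C 0\<bar> \<le> Q\<^sup>2 * (4 ^ card C * prod gnorm C powr (- 2))" by (simp add: mult_ac)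
      qed
      also have "\<dots> = Q\<^sup>2 * (\<Sum>C\<in>sieve_sets Q. 4 ^ card C * prod gnorm C powr (- 2))" by (simp only: sum_distrib_left)
      also have "\<dots> \<le> Q\<^sup>2 * K3" by (intro mult_left_mono K3(2)) (auto dest: sieve_sets_memD)
      finally show ?thesis by (simp add: mult_ac)
    qed
    \<comment> \<open>The divisor sum that will dominate the r-th power:
      \<open>power_one_plus_le\<close> makes the r-th power of each local factor linear in t
      again.\<close>
    define w where "w = (\<lambda>n. \<Sum>B\<in>Pow U. of_bool (\<Prod>B dvd n) * (\<Prod>\<rho>\<in>B. 5 ^ r * t \<rho>))"
    have s_le: "s n ^ r \<le> (Q powr \<epsilon>) ^ r * K1 ^ r * w n" for n
    proof -
      have "s n \<le> (\<Sum>C\<in>sieve_sets Q. Q powr \<epsilon> * (\<Prod>\<rho>\<in>C. 4 * \<bar>psi \<rho> n\<bar> * t \<rho>))"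
        unfolding s_def
      proof (rule sum_mono)
        fix C assume C: "C \<in> sieve_sets Q"
        note C' = sieve_sets_memD[OF C]
        have P: "prod gnorm C \<ge> 1" using C' prod_gnorm_ge_1 by auto
        have "prod t C = prod gnorm C powr (- \<epsilon>)" unfolding t_def by (simp add: prod_powr_distrib)
        moreover have "prod gnorm C powr \<epsilon> \<le> Q powr \<epsilon>" using P C' \<epsilon> by (intro powr_mono2) auto
        moreover have "0 \<le> prod t C" by (intro prod_nonneg) (simp add: t_def)
        ultimately have "prod gnorm C powr \<epsilon> * prod gnorm C powr (- \<epsilon>) \<le> Q powr \<epsilon> * prod t C"
          by (metis mult_right_mono)
        then have "1 \<le> Q powr \<epsilon> * prod t C" using P by (simp flip: powr_add)
        then have "(4 ^ card C * \<bar>Psi C n\<bar>) * 1 \<le> (4 ^ card C * \<bar>Psi C n\<bar>) * (Q powr \<epsilon> * prod t C)"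
          by (intro mult_left_mono) auto
        also have "\<dots> = Q powr \<epsilon> * (\<Prod>\<rho>\<in>C. 4 * \<bar>psi \<rho> n\<bar> * t \<rho>)"
          by (simp add: Psi_def abs_prod prod.distrib)
        finally show "4 ^ card C * \<bar>Psi C n\<bar> \<le> Q powr \<epsilon> * (\<Prod>\<rho>\<in>C. 4 * \<bar>psi \<rho> n\<bar> * t \<rho>)" by simp
      qed
      also have "\<dots> = Q powr \<epsilon> * (\<Sum>C\<in>sieve_sets Q. \<Prod>\<rho>\<in>C. 4 * \<bar>psi \<rho> n\<bar> * t \<rho>)" by (simp only: sum_distrib_left)
      also have "\<dots> \<le> Q powr \<epsilon> * (\<Prod>\<rho>\<in>U. 1 + 4 * \<bar>psi \<rho> n\<bar> * t \<rho>)"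
      proof (intro mult_left_mono sum_prod_le_prod_add_1 U)
        show "sieve_sets Q \<subseteq> Pow U" using sieve_sets_memD(2,4) by (fastforce simp: U_def)
      qed (use U t in \<open>auto intro!: mult_nonneg_nonneg\<close>)
      \<comment> \<open>Off the multiples of \<rho> the bound \<open>2 / gnorm \<rho>\<close> for
        \<open>psi\<close> makes the local factor part of a convergent Euler product; on the
        multiples the factor is kept as an indicator.\<close>
      also have "(\<Prod>\<rho>\<in>U. 1 + 4 * \<bar>psi \<rho> n\<bar> * t \<rho>)
          \<le> (\<Prod>\<rho>\<in>U. (1 + 8 * (t \<rho> / gnorm \<rho>)) * (1 + of_bool (\<rho> dvd n) * (4 * t \<rho>)))"
      proof (intro prod_mono conjI)
        fix \<rho> assume "\<rho> \<in> U"
        then have \<rho>: "\<rho> \<in> gprimes" using U by auto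
        note tt = t(1,2)[OF \<rho>]
        have g: "gnorm \<rho> \<ge> 2" by (rule gprimes_gnorm_ge[OF \<rho>])
        show "0 \<le> 1 + 4 * \<bar>psi \<rho> n\<bar> * t \<rho>" using tt by (intro add_nonneg_nonneg) auto
        show "1 + 4 * \<bar>psi \<rho> n\<bar> * t \<rho> \<le> (1 + 8 * (t \<rho> / gnorm \<rho>)) * (1 + of_bool (\<rho> dvd n) * (4 * t \<rho>))"
        proof (cases "\<rho> dvd n")
          case True
          have "1 * (1 + 4 * t \<rho>) \<le> (1 + 8 * (t \<rho> / gnorm \<rho>)) * (1 + 4 * t \<rho>)"
            using tt g by (intro mult_right_mono) auto
          then show ?thesis using True by (simp add: psi_def)
        next
          case False
          have "4 * \<bar>psi \<rho> n\<bar> * t \<rho> \<le> 4 * (2 / gnorm \<rho>) * t \<rho>"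
            using tt abs_psi_less[OF \<rho> False] by (intro mult_right_mono mult_left_mono) auto
          then show ?thesis using False by simp
        qed
      qed
      also have "\<dots> = (\<Prod>\<rho>\<in>U. 1 + 8 * (t \<rho> / gnorm \<rho>)) * (\<Prod>\<rho>\<in>U. 1 + of_bool (\<rho> dvd n) * (4 * t \<rho>))"
        by (rule prod.distrib)
      also have "\<dots> \<le> K1 * (\<Prod>\<rho>\<in>U. 1 + of_bool (\<rho> dvd n) * (4 * t \<rho>))"
      proof (intro mult_right_mono K1(2) U prod_nonneg)
        fix \<rho> assume "\<rho> \<in> U"
        then have \<rho>: "\<rho> \<in> gprimes" using U by auto
        show "0 \<le> 8 * (t \<rho> / gnorm \<rho>) \<and> 8 * (t \<rho> / gnorm \<rho>) \<le> 8 * gnorm \<rho> powr (- (1 + \<epsilon>))"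
          unfolding t(3)[OF \<rho>] by simp
        show "0 \<le> 1 + of_bool (\<rho> dvd n) * (4 * t \<rho>)" using t(1)[OF \<rho>] by simp
      qed
      finally have "s n \<le> Q powr \<epsilon> * (K1 * (\<Prod>\<rho>\<in>U. 1 + of_bool (\<rho> dvd n) * (4 * t \<rho>)))"
        by (simp add: mult_left_mono)
      then have "s n ^ r \<le> (Q powr \<epsilon> * (K1 * (\<Prod>\<rho>\<in>U. 1 + of_bool (\<rho> dvd n) * (4 * t \<rho>)))) ^ r"
        by (intro power_mono) (auto simp: s_def intro!: sum_nonneg)
      also have "\<dots> = (Q powr \<epsilon>) ^ r * K1 ^ r * (\<Prod>\<rho>\<in>U. (1 + of_bool (\<rho> dvd n) * (4 * t \<rho>)) ^ r)"
        by (simp add: power_mult_distrib prod_power_distrib)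
      also have "\<dots> \<le> (Q powr \<epsilon>) ^ r * K1 ^ r * (\<Prod>\<rho>\<in>U. of_bool (\<rho> dvd n) * (5 ^ r * t \<rho>) + 1)"
      proof (intro mult_left_mono prod_mono conjI)
        fix \<rho> assume "\<rho> \<in> U"
        then have \<rho>: "\<rho> \<in> gprimes" using U by auto
        show "0 \<le> (1 + of_bool (\<rho> dvd n) * (4 * t \<rho>)) ^ r" using t(1)[OF \<rho>] by simp
        show "(1 + of_bool (\<rho> dvd n) * (4 * t \<rho>)) ^ r \<le> of_bool (\<rho> dvd n) * (5 ^ r * t \<rho>) + 1"
          using power_one_plus_le[OF t(1,2)[OF \<rho>], of r] by simp
      qed (use K1 in auto)
      also have "(\<Prod>\<rho>\<in>U. of_bool (\<rho> dvd n) * (5 ^ r * t \<rho>) + 1) = w n"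
        unfolding prod_add[OF U(1)] w_def
      proof (rule sum.cong[OF refl])
        fix B assume "B \<in> Pow U"
        then have "finite B" "B \<subseteq> gprimes" using U finite_subset by auto
        then show "(\<Prod>\<rho>\<in>B. of_bool (\<rho> dvd n) * (5 ^ r * t \<rho>)) * (\<Prod>\<rho>\<in>U - B. 1) = of_bool (\<Prod>B dvd n) * (\<Prod>\<rho>\<in>B. 5 ^ r * t \<rho>)"
          by (simp only: prod.distrib[of "\<lambda>\<rho>. of_bool (\<rho> dvd n)"] prod_of_bool_dvd) simp
      qed
      finally show ?thesis .
    qed
    \<comment> \<open>A nonzero multiple of \<open>\<Prod>B\<close> in the disc forces
      \<open>prod gnorm B \<le> X\<close>, and then the additive constant of the count is absorbed;
      without such a multiple the sum vanishes.\<close>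
    have cnt: "(\<Sum>n\<in>gdisc 0 X - {0}. of_bool (\<Prod>B dvd n)) \<le> 24 * X / prod gnorm B" if B: "B \<in> Pow U" for B
    proof -
      have B': "finite B" "B \<subseteq> gprimes" using B U finite_subset by auto
      have P: "prod gnorm B \<ge> 1" by (rule prod_gnorm_ge_1[OF B'(2)])
      have nz: "\<Prod>B \<noteq> 0" using B' gprimes_nonzero by auto
      show ?thesis
      proof (cases "\<exists>n\<in>gdisc 0 X - {0}. \<Prod>B dvd n")
        case True
        then obtain n where n: "gnorm n < X" "n \<noteq> 0" "\<Prod>B dvd n" by (auto simp: gdisc_def)
        then obtain k where k: "n = \<Prod>B * k" by blast
        then have "gnorm k \<ge> 1" using n(2) by (intro gnorm_ge_1) auto
        then have "prod gnorm B * 1 \<le> prod gnorm B * gnorm k" using P by (intro mult_left_mono) auto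
        also have "\<dots> = gnorm n" by (simp add: k gnorm_mult gnorm_prod)
        finally have "prod gnorm B \<le> X" using n(1) by simp
        then have "1 \<le> X / prod gnorm B" using P by simp
        have "(\<Sum>n\<in>gdisc 0 X - {0}. of_bool (\<Prod>B dvd n)) \<le> (\<Sum>n\<in>gdisc 0 X. of_bool (\<Prod>B dvd n) :: real)"
          by (intro sum_mono2) auto
        also have "\<dots> = real (card {n \<in> gdisc 0 X. \<Prod>B dvd n - 0})"
          by (simp add: sum_of_bool_eq Int_def)
        also have "\<dots> \<le> 12 * (X / gnorm (\<Prod>B) + 1)" using nz X by (intro card_gdisc_dvd_le) auto
        also have "\<dots> \<le> 24 * X / prod gnorm B" using \<open>1 \<le> X / prod gnorm B\<close> by (simp add: gnorm_prod)
        finally show ?thesis .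
      next
        case False
        then have "(\<Sum>n\<in>gdisc 0 X - {0}. of_bool (\<Prod>B dvd n)) = (0::real)" by (intro sum.neutral) auto
        then show ?thesis using X P by simp
      qed
    qed
    have "(\<Sum>n\<in>gdisc 0 X - {0}. w n) = (\<Sum>B\<in>Pow U. (\<Sum>n\<in>gdisc 0 X - {0}. of_bool (\<Prod>B dvd n)) * (\<Prod>\<rho>\<in>B. 5 ^ r * t \<rho>))"
      unfolding w_def by (subst sum.swap) (simp only: sum_distrib_right)
    also have "\<dots> \<le> (\<Sum>B\<in>Pow U. 24 * X / prod gnorm B * (\<Prod>\<rho>\<in>B. 5 ^ r * t \<rho>))"
      by (intro sum_mono mult_right_mono cnt prod_nonneg) (use t U in auto)
    also have "\<dots> = 24 * X * (\<Sum>B\<in>Pow U. \<Prod>\<rho>\<in>B. 5 ^ r * (t \<rho> / gnorm \<rho>))"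
      by (simp add: sum_distrib_left prod.distrib prod_dividef)
    also have "\<dots> \<le> 24 * X * (\<Prod>\<rho>\<in>U. 1 + 5 ^ r * (t \<rho> / gnorm \<rho>))"
      using X U t(1) by (intro mult_left_mono sum_prod_le_prod_add_1) auto
    also have "\<dots> \<le> 24 * X * K2"
    proof (intro mult_left_mono K2(2) U)
      fix \<rho> assume "\<rho> \<in> U"
      then have \<rho>: "\<rho> \<in> gprimes" using U by auto
      show "0 \<le> 5 ^ r * (t \<rho> / gnorm \<rho>) \<and> 5 ^ r * (t \<rho> / gnorm \<rho>) \<le> 5 ^ r * gnorm \<rho> powr (- (1 + \<epsilon>))"
        unfolding t(3)[OF \<rho>] by simp
    qed (use X in auto)
    finally have w_sum: "(\<Sum>n\<in>gdisc 0 X - {0}. w n) \<le> 24 * X * K2" .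
    have "(\<Sum>n\<in>gdisc 0 X. s n ^ r) = s 0 ^ r + (\<Sum>n\<in>gdisc 0 X - {0}. s n ^ r)"
      using X by (intro sum.remove) (simp_all, simp add: gdisc_def)
    also have "s 0 ^ r \<le> (K3 * Q\<^sup>2) ^ r"
      by (intro power_mono zero) (auto simp: s_def intro!: sum_nonneg)
    also have "(\<Sum>n\<in>gdisc 0 X - {0}. s n ^ r) \<le> (\<Sum>n\<in>gdisc 0 X - {0}. (Q powr \<epsilon>) ^ r * K1 ^ r * w n)"
      by (intro sum_mono s_le)
    also have "\<dots> = (Q powr \<epsilon>) ^ r * K1 ^ r * (\<Sum>n\<in>gdisc 0 X - {0}. w n)" by (simp only: sum_distrib_left)
    also have "\<dots> \<le> (Q powr \<epsilon>) ^ r * K1 ^ r * (24 * X * K2)"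
      using K1(1) by (intro mult_left_mono w_sum) auto
    finally have "(\<Sum>n\<in>gdisc 0 X. s n ^ r) \<le> K3 ^ r * (Q\<^sup>2) ^ r + (24 * K1 ^ r * K2) * ((Q powr \<epsilon>) ^ r * X)"
      by (simp add: power_mult_distrib mult_ac)
    also have "\<dots> \<le> K * (Q\<^sup>2) ^ r + K * ((Q powr \<epsilon>) ^ r * X)"
      using K1(1) K2(1) K3(1) X by (intro add_mono mult_right_mono) (auto simp: K_def)
    finally show ?thesis by (simp add: s_def algebra_simps)
  qed
  note main = this
  have "K > 0" using K1(1) K2(1) K3(1) by (auto simp: K_def intro!: add_pos_pos mult_pos_pos)
  then show ?thesis using main by (intro exI[of _ K] conjI allI impI) auto
qed

lemma power_sum_le:
  fixes a :: "'a \<Rightarrow> real"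
  assumes "\<And>i. i \<in> I \<Longrightarrow> a i \<ge> 0" and r: "r \<ge> 1"
  shows "(\<Sum>i\<in>I. a i) ^ r \<le> real (card I) ^ (r - 1) * (\<Sum>i\<in>I. a i ^ r)"
proof (cases "finite I \<and> I \<noteq> {}")
  case True
  define c where "c = real (card I)"
  have c: "c > 0" using True by (auto simp: c_def card_gt_0_iff)
  have conv: "convex_on {0::real..} (\<lambda>x. x ^ r)"
    by (cases "even r") (auto intro: convex_power_odd convex_on_subset[OF convex_power_even])
  have "(\<Sum>i\<in>I. (1 / c) *\<^sub>R a i) ^ r \<le> (\<Sum>i\<in>I. (1 / c) * a i ^ r)"
    by (rule convex_on_sum[OF _ _ conv]) (use True assms c in \<open>auto simp: c_def\<close>)
  then have "(\<Sum>i\<in>I. a i) ^ r / c ^ r \<le> (\<Sum>i\<in>I. a i ^ r) / c"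
    by (simp add: sum_divide_distrib[symmetric] power_divide)
  then have "(\<Sum>i\<in>I. a i) ^ r \<le> (\<Sum>i\<in>I. a i ^ r) / c * c ^ r"
    using c by (simp add: pos_divide_le_eq)
  also have "c ^ r = c * c ^ (r - 1)" using r by (simp add: power_eq_if)
  finally show ?thesis using c by (simp add: c_def mult_ac)
next
  case False
  then have "(\<Sum>i\<in>I. a i) = 0" by auto
  moreover have "(0::real) ^ r = 0" using r by simp
  moreover have "0 \<le> real (card I) ^ (r - 1) * (\<Sum>i\<in>I. a i ^ r)"
    using assms by (intro mult_nonneg_nonneg sum_nonneg) auto
  ultimately show ?thesis by metis
qed

text \<open>Jensen's inequality leads to the sum T of r-th powers over all pairs. Fixing x bounds T
  by \<open>card F * M\<close>, fixing y bounds it by \<open>card G * M\<close>; the geometric mean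
  of the two yields the symmetric exponent \<open>r - 1 + 1/2\<close>.\<close>

lemma pair_sum_moment:
  assumes FG: "F \<subseteq> gdisc z X" "G \<subseteq> gdisc z X" and s: "\<And>n. s n \<ge> 0" and r: "r \<ge> 1"
  shows "(\<Sum>x\<in>F. \<Sum>y\<in>G. s (y - x)) ^ r
    \<le> (real (card F) * real (card G)) powr (real r - 1/2) * (\<Sum>n\<in>gdisc 0 (4 * X). s n ^ r)"
proof -
  define m where "m = real (card F) * real (card G)"
  define M where "M = (\<Sum>n\<in>gdisc 0 (4 * X). s n ^ r)"
  define T where "T = (\<Sum>x\<in>F. \<Sum>y\<in>G. s (y - x) ^ r)"
  have fin: "finite F" "finite G" using FG finite_subset finite_gdisc by blast+
  have M0: "M \<ge> 0" using s by (auto simp: M_def intro!: sum_nonneg)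
  have T0: "T \<ge> 0" using s by (auto simp: T_def intro!: sum_nonneg)
  have diff: "y - x \<in> gdisc 0 (4 * X)" if "x \<in> F" "y \<in> G" for x y
  proof -
    have "gnorm (x - z) < X" "gnorm (y - z) < X" using FG that by (auto simp: gdisc_def)
    moreover have "gnorm ((y - z) + (z - x)) \<le> 2 * gnorm (y - z) + 2 * gnorm (z - x)" by (rule gnorm_add_le)
    ultimately show ?thesis by (simp add: gdisc_def gnorm_minus_commute[of z x])
  qed
  have row: "(\<Sum>y\<in>G. s (y - x) ^ r) \<le> M" if "x \<in> F" for x
  proof -
    have "(\<Sum>y\<in>G. s (y - x) ^ r) = (\<Sum>n\<in>(\<lambda>y. y - x) ` G. s n ^ r)"
      by (simp add: sum.reindex inj_on_def)
    also have "\<dots> \<le> M" unfolding M_def using diff that s by (intro sum_mono2) auto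
    finally show ?thesis .
  qed
  have col: "(\<Sum>x\<in>F. s (y - x) ^ r) \<le> M" if "y \<in> G" for y
  proof -
    have "(\<Sum>x\<in>F. s (y - x) ^ r) = (\<Sum>n\<in>(\<lambda>x. y - x) ` F. s n ^ r)"
      by (simp add: sum.reindex inj_on_def)
    also have "\<dots> \<le> M" unfolding M_def using diff that s by (intro sum_mono2) auto
    finally show ?thesis .
  qed
  have T1: "T \<le> real (card F) * M"
    unfolding T_def using sum_mono[of F "\<lambda>x. \<Sum>y\<in>G. s (y - x) ^ r" "\<lambda>_. M"] row by simp
  have "T = (\<Sum>y\<in>G. \<Sum>x\<in>F. s (y - x) ^ r)" unfolding T_def by (rule sum.swap)
  then have T2: "T \<le> real (card G) * M"
    using sum_mono[of G "\<lambda>y. \<Sum>x\<in>F. s (y - x) ^ r" "\<lambda>_. M"] col by simp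
  have "T\<^sup>2 \<le> (real (card F) * M) * (real (card G) * M)"
    unfolding power2_eq_square by (intro mult_mono T1 T2 T0) (use M0 in auto)
  also have "\<dots> = (sqrt m * M)\<^sup>2" by (simp add: m_def power2_eq_square mult_ac)
  finally have T: "T \<le> sqrt m * M" using M0 by (intro power2_le_imp_le[of T]) (auto simp: m_def)
  have "(\<Sum>x\<in>F. \<Sum>y\<in>G. s (y - x)) ^ r = (\<Sum>i\<in>F \<times> G. s (snd i - fst i)) ^ r"
    by (simp add: sum.cartesian_product')
  also have "\<dots> \<le> real (card (F \<times> G)) ^ (r - 1) * (\<Sum>i\<in>F \<times> G. s (snd i - fst i) ^ r)"
    using s r by (intro power_sum_le) auto
  also have "\<dots> = m ^ (r - 1) * T"
    by (simp add: m_def T_def sum.cartesian_product' card_cartesian_product)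
  also have "\<dots> \<le> m ^ (r - 1) * (sqrt m * M)" by (intro mult_left_mono T) (simp add: m_def)
  also have "\<dots> = m powr (real r - 1/2) * M"
  proof (cases "m = 0")
    case False
    moreover have "m \<ge> 0" unfolding m_def by simp
    ultimately have m: "m > 0" by linarith
    have "m ^ (r - 1) * sqrt m = m powr (real (r - 1)) * m powr (1/2)"
      unfolding powr_realpow[OF m] using m by (simp add: powr_half_sqrt)
    also have "\<dots> = m powr (real r - 1/2)" unfolding powr_add[symmetric] using r by (simp add: of_nat_diff)
    finally show ?thesis by simp
  qed simp
  finally show ?thesis by (simp add: m_def M_def)
qed

section \<open>Interpolation between mean square and moment bounds\<close>

lemma powr_interpolate:
  fixes S a b \<theta> :: real
  assumes "0 \<le> S" "S \<le> a" "S \<le> b" "0 \<le> \<theta>" "\<theta> \<le> 1"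
  shows "S \<le> a powr (1 - \<theta>) * b powr \<theta>"
proof -
  have "S = S powr (1 - \<theta>) * S powr \<theta>" using assms(1) by (simp flip: powr_add)
  also have "\<dots> \<le> a powr (1 - \<theta>) * b powr \<theta>"
    using assms by (intro mult_mono powr_mono2) auto
  finally show ?thesis .
qed

text \<open>The hypothesis on q makes 1/q the interpolation at \<theta> between 1/2, from the mean
  square bound, and \<open>1 - 1 / (2 * real r)\<close>, from the r-th root of the moment bound. For
  \<theta> < 1 the gain of the first outweighs the loss of the second, and the dyadic pieces form a
  geometric series.\<close>

lemma sieve_form_bound:
  fixes r :: nat and q \<theta> :: real
  assumes r: "r \<ge> 5" and \<theta>: "0 \<le> \<theta>" "\<theta> < 1" and q: "1 / q = 1 / 2 + \<theta> * (1 / 2 - 1 / (2 * real r))"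
  shows "\<exists>K>0. \<forall>R X z F G. 1 \<le> R \<longrightarrow> 4 ^ r * R ^ (4 * r) \<le> X \<longrightarrow> F \<subseteq> gdisc z X \<longrightarrow> G \<subseteq> gdisc z X \<longrightarrow>
    (\<Sum>x\<in>F. \<Sum>y\<in>G. sieve_majorant R (y - x))
      \<le> K * X powr (2 - 2 / q) * (real (card F) * real (card G)) powr (1 / q)"
proof -
  \<comment> \<open>With this value the exponent of \<open>2 ^ j\<close> after interpolation,
    \<open>- (1 - \<theta>) / 4 + \<epsilon> * \<theta>\<close>, is at most
    \<open>- \<epsilon>\<close>.\<close>
  define \<epsilon> where "\<epsilon> = (1 - \<theta>) / 8"
  have \<epsilon>: "\<epsilon> > 0" using \<theta> by (simp add: \<epsilon>_def)
  have r1: "r \<ge> 1" using r by simp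
  obtain KA where KA_pos: "KA > 0" and KA_all: "\<forall>\<C> v Q0 Q X z F G. finite \<C> \<longrightarrow>
    (\<forall>C\<in>\<C>. finite C \<and> C \<subseteq> gprimes \<and> Q0 \<le> prod gnorm C \<and> prod gnorm C \<le> Q \<and> \<bar>v C\<bar> \<le> 4 ^ card C) \<longrightarrow>
    1 \<le> Q0 \<longrightarrow> Q0 \<le> Q \<longrightarrow> Q ^ 9 \<le> X \<longrightarrow> F \<subseteq> gdisc z X \<longrightarrow> G \<subseteq> gdisc z X \<longrightarrow>
    (\<Sum>x\<in>F. \<Sum>y\<in>G. \<Sum>C\<in>\<C>. v C * Psi C (y - x))\<^sup>2 \<le> KA * X\<^sup>2 / sqrt Q0 * real (card F) * real (card G)"
    using block_L2_bound by blast
  note KA = KA_pos KA_all[rule_format]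
  obtain KB where KB_pos: "KB > 0" and KB_all: "\<forall>Q X. Q \<ge> 1 \<longrightarrow> X \<ge> 1 \<longrightarrow>
    (\<Sum>n\<in>gdisc 0 X. (\<Sum>C\<in>sieve_sets Q. 4 ^ card C * \<bar>Psi C n\<bar>) ^ r) \<le> KB * ((Q powr \<epsilon>) ^ r * X + (Q\<^sup>2) ^ r)"
    using sieve_moment_bound[OF \<epsilon> r1] by blast
  note KB = KB_pos KB_all[rule_format]
  define K3 where "K3 = sqrt KA powr (1 - \<theta>) * ((5 * KB) powr (1 / r) * 2 powr \<epsilon>) powr \<theta>"
  have K3: "K3 > 0" using KA(1) KB(1) by (simp add: K3_def)
  define \<omega> where "\<omega> = 2 powr (- \<epsilon>)"
  have \<omega>: "0 < \<omega>" "\<omega> < 1" using \<epsilon> by (auto simp: \<omega>_def powr_less_one)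
  define K where "K = K3 / (1 - \<omega>)"
  have "(\<Sum>x\<in>F. \<Sum>y\<in>G. sieve_majorant R (y - x))
      \<le> K * X powr (2 - 2 / q) * (real (card F) * real (card G)) powr (1 / q)"
    if R: "1 \<le> R" and X: "4 ^ r * R ^ (4 * r) \<le> X" and F: "F \<subseteq> gdisc z X" and G: "G \<subseteq> gdisc z X" for R X z F G
  proof -
    define m where "m = real (card F) * real (card G)"
    have m0: "m \<ge> 0" by (simp add: m_def)
    have X1: "X \<ge> 1"
    proof -
      have "1 * 1 \<le> 4 ^ r * R ^ (4 * r)" using R by (intro mult_mono one_le_power) auto
      then show ?thesis using X by simp
    qed
    obtain v where v: "\<And>C. C \<in> sieve_sets (R * R) \<Longrightarrow> \<bar>v C\<bar> \<le> 4 ^ card C"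
      "\<And>n. sieve_majorant R n = (\<Sum>C\<in>sieve_sets (R * R). v C * Psi C n)"
      using sieve_square_expansion[OF R] by blast
    define lev where "lev = (\<lambda>C. nat \<lfloor>log 2 (prod gnorm C)\<rfloor>)"
    define \<C> where "\<C> = (\<lambda>j. {C \<in> sieve_sets (R * R). lev C = j})"
    define S where "S = (\<lambda>j. \<bar>\<Sum>x\<in>F. \<Sum>y\<in>G. \<Sum>C\<in>\<C> j. v C * Psi C (y - x)\<bar>)"
    have lev: "2 ^ lev C \<le> prod gnorm C" "prod gnorm C \<le> 2 ^ Suc (lev C)" if "C \<in> sieve_sets (R * R)" for C
    proof -
      have P: "prod gnorm C \<ge> 1" using sieve_sets_memD(2)[OF that] by (rule prod_gnorm_ge_1)
      then have "log 2 (prod gnorm C) \<ge> 0" by simp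
      then have "real (lev C) \<le> log 2 (prod gnorm C)" "log 2 (prod gnorm C) \<le> real (Suc (lev C))"
        unfolding lev_def by linarith+
      then have "2 powr real (lev C) \<le> prod gnorm C" "prod gnorm C \<le> 2 powr real (Suc (lev C))"
        using P by (simp_all add: le_log_iff log_le_iff del: of_nat_Suc)
      then show "2 ^ lev C \<le> prod gnorm C" "prod gnorm C \<le> 2 ^ Suc (lev C)"
        by (simp_all add: powr_realpow del: of_nat_Suc power_Suc)
    qed
    have S: "S j \<le> K3 * X powr (2 - 2 / q) * m powr (1 / q) * \<omega> ^ j" if j: "j \<in> lev ` sieve_sets (R * R)" for j
    proof -
      define t where "t = (2::real) ^ j"
      define Q where "Q = 2 * t"
      have t1: "t \<ge> 1" by (simp add: t_def)
      have Q1: "Q \<ge> 1" using t1 by (simp add: Q_def)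
      obtain C0 where C0: "C0 \<in> sieve_sets (R * R)" "lev C0 = j" using j by auto
      have "t \<le> R * R" using lev(1)[OF C0(1)] sieve_sets_memD(3)[OF C0(1)] C0(2) by (simp add: t_def)
      then have "Q ^ (2 * r) \<le> (2 * (R * R)) ^ (2 * r)" using Q1 by (intro power_mono) (auto simp: Q_def)
      also have "\<dots> = 4 ^ r * R ^ (4 * r)"
      proof -
        have "(2 * (R * R))\<^sup>2 = 4 * R ^ 4" by (simp add: power2_eq_square power4_eq_xxxx)
        then show ?thesis by (simp add: power_mult power_mult_distrib)
      qed
      \<comment> \<open>This controls the point 0 in the moment bound, and since r \<ge> 5 it also
        provides the \<open>Q ^ 9 \<le> X\<close> of the mean square bound.\<close>
      finally have QX: "Q ^ (2 * r) \<le> X" using X by simp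
      have "Q ^ 9 \<le> Q ^ (2 * r)" using Q1 r by (intro power_increasing) auto
      then have Q9: "Q ^ 9 \<le> X" using QX by simp
      have \<C>: "finite C \<and> C \<subseteq> gprimes \<and> t \<le> prod gnorm C \<and> prod gnorm C \<le> Q \<and> \<bar>v C\<bar> \<le> 4 ^ card C" if "C \<in> \<C> j" for C
        using that lev[of C] v(1)[of C] sieve_sets_memD(1,2)[of C "R * R"] by (auto simp: \<C>_def t_def Q_def)
      have S0: "S j \<ge> 0" by (simp add: S_def)
      have "(S j)\<^sup>2 \<le> KA * X\<^sup>2 / sqrt t * real (card F) * real (card G)"
        unfolding S_def power2_abs using t1 Q9 F G \<C> by (intro KA(2)[where Q = Q]) (auto simp: \<C>_def Q_def)
      also have "\<dots> = (sqrt KA * X * t powr (- (1/4)) * m powr (1/2))\<^sup>2"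
      proof -
        have "(t powr (- (1/4)))\<^sup>2 = t powr (- (1/2))" using t1 by (simp add: power2_eq_square flip: powr_add)
        also have "\<dots> = 1 / sqrt t" using t1 by (simp add: powr_minus_divide powr_half_sqrt)
        finally have "(t powr (- (1/4)))\<^sup>2 = 1 / sqrt t" .
        moreover have "(m powr (1/2))\<^sup>2 = m" using m0 by (simp add: powr_half_sqrt)
        ultimately show ?thesis using KA(1) by (simp add: power_mult_distrib m_def)
      qed
      finally have a: "S j \<le> sqrt KA * X * t powr (- (1/4)) * m powr (1/2)"
        by (rule power2_le_imp_le) (use KA(1) X1 in auto)
      have "S j \<le> (\<Sum>x\<in>F. \<Sum>y\<in>G. \<Sum>C\<in>sieve_sets Q. 4 ^ card C * \<bar>Psi C (y - x)\<bar>)"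
        unfolding S_def
      proof (rule order_trans[OF sum_abs sum_mono], rule order_trans[OF sum_abs sum_mono])
        fix x y
        have "\<bar>\<Sum>C\<in>\<C> j. v C * Psi C (y - x)\<bar> \<le> (\<Sum>C\<in>\<C> j. 4 ^ card C * \<bar>Psi C (y - x)\<bar>)"
          using \<C> by (intro order_trans[OF sum_abs sum_mono]) (auto simp: abs_mult intro!: mult_right_mono)
        also have "\<dots> \<le> (\<Sum>C\<in>sieve_sets Q. 4 ^ card C * \<bar>Psi C (y - x)\<bar>)"
          using \<C> by (intro sum_mono2 finite_sieve_sets) (auto simp: sieve_sets_def)
        finally show "\<bar>\<Sum>C\<in>\<C> j. v C * Psi C (y - x)\<bar> \<le> (\<Sum>C\<in>sieve_sets Q. 4 ^ card C * \<bar>Psi C (y - x)\<bar>)" .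
      qed
      then have "S j ^ r \<le> (\<Sum>x\<in>F. \<Sum>y\<in>G. \<Sum>C\<in>sieve_sets Q. 4 ^ card C * \<bar>Psi C (y - x)\<bar>) ^ r"
        using S0 by (intro power_mono) auto
      also have "\<dots> \<le> m powr (real r - 1/2) * (\<Sum>n\<in>gdisc 0 (4 * X). (\<Sum>C\<in>sieve_sets Q. 4 ^ card C * \<bar>Psi C n\<bar>) ^ r)"
        unfolding m_def using r1 by (intro pair_sum_moment[OF F G]) (auto intro!: sum_nonneg)
      also have "\<dots> \<le> m powr (real r - 1/2) * (KB * ((Q powr \<epsilon>) ^ r * (4 * X) + (Q\<^sup>2) ^ r))"
        using Q1 X1 by (intro mult_left_mono KB(2)) auto
      also have "\<dots> \<le> m powr (real r - 1/2) * (KB * ((Q powr \<epsilon>) ^ r * (5 * X)))"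
      proof (intro mult_left_mono)
        have "1 \<le> (Q powr \<epsilon>) ^ r" using Q1 \<epsilon> by (intro one_le_power ge_one_powr_ge_zero) auto
        then have "1 * X \<le> (Q powr \<epsilon>) ^ r * X" using X1 by (intro mult_right_mono) auto
        moreover have "(Q\<^sup>2) ^ r \<le> X" using QX by (simp add: power_mult)
        ultimately show "(Q powr \<epsilon>) ^ r * (4 * X) + (Q\<^sup>2) ^ r \<le> (Q powr \<epsilon>) ^ r * (5 * X)"
          by (simp add: algebra_simps)
      qed (use KB(1) in auto)
      finally have "S j ^ r \<le> (5 * KB) * (Q powr \<epsilon>) ^ r * X * m powr (real r - 1/2)" by (simp add: mult_ac)
      then have "(S j ^ r) powr (1 / r) \<le> ((5 * KB) * (Q powr \<epsilon>) ^ r * X * m powr (real r - 1/2)) powr (1 / r)"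
        using S0 by (intro powr_mono2) auto
      also have "(S j ^ r) powr (1 / r) = S j"
        using S0 r1 by (cases "S j = 0") (auto simp: powr_powr simp flip: powr_realpow)
      also have "((5 * KB) * (Q powr \<epsilon>) ^ r * X * m powr (real r - 1/2)) powr (1 / r)
          = (5 * KB) powr (1 / r) * Q powr \<epsilon> * X powr (1 / r) * m powr ((real r - 1/2) * (1 / r))"
      proof -
        have "((Q powr \<epsilon>) ^ r) powr (1 / r) = Q powr \<epsilon>"
          using Q1 r1 by (simp add: powr_powr flip: powr_realpow)
        then show ?thesis by (simp only: powr_mult powr_powr)
      qed
      also have "(real r - 1/2) * (1 / r) = 1 - 1 / (2 * real r)" using r1 by (simp add: field_simps)
      also have "Q powr \<epsilon> = 2 powr \<epsilon> * t powr \<epsilon>" by (simp add: Q_def powr_mult)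
      finally have b: "S j \<le> ((5 * KB) powr (1 / r) * 2 powr \<epsilon>) * t powr \<epsilon> * X powr (1 / r) * m powr (1 - 1 / (2 * real r))"
        by (simp add: mult_ac)
      have "S j \<le> (sqrt KA * X * t powr (- (1/4)) * m powr (1/2)) powr (1 - \<theta>)
          * (((5 * KB) powr (1 / r) * 2 powr \<epsilon>) * t powr \<epsilon> * X powr (1 / r) * m powr (1 - 1 / (2 * real r))) powr \<theta>"
        using \<theta> by (intro powr_interpolate S0 a b) auto
      also have "(sqrt KA * X * t powr (- (1/4)) * m powr (1/2)) powr (1 - \<theta>)
          = sqrt KA powr (1 - \<theta>) * X powr (1 - \<theta>) * t powr (- (1/4) * (1 - \<theta>)) * m powr (1/2 * (1 - \<theta>))"
        by (simp only: powr_mult powr_powr)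
      also have "(((5 * KB) powr (1 / r) * 2 powr \<epsilon>) * t powr \<epsilon> * X powr (1 / r) * m powr (1 - 1 / (2 * real r))) powr \<theta>
          = ((5 * KB) powr (1 / r) * 2 powr \<epsilon>) powr \<theta> * t powr (\<epsilon> * \<theta>) * X powr (1 / r * \<theta>) * m powr ((1 - 1 / (2 * real r)) * \<theta>)"
        by (simp only: powr_mult[of _ "m powr (1 - 1 / (2 * real r))"] powr_mult[of _ "X powr (1 / r)"] powr_mult[of _ "t powr \<epsilon>"] powr_powr)
      also have "sqrt KA powr (1 - \<theta>) * X powr (1 - \<theta>) * t powr (- (1/4) * (1 - \<theta>)) * m powr (1/2 * (1 - \<theta>)) * \<dots>
          = K3 * (X powr (1 - \<theta>) * X powr (1 / r * \<theta>)) * (m powr (1/2 * (1 - \<theta>)) * m powr ((1 - 1 / (2 * real r)) * \<theta>))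
            * (t powr (- (1/4) * (1 - \<theta>)) * t powr (\<epsilon> * \<theta>))"
        by (simp only: K3_def mult_ac)
      also have "X powr (1 - \<theta>) * X powr (1 / r * \<theta>) = X powr (2 - 2 / q)"
      proof -
        have "2 - 2 / q = (1 - \<theta>) + 1 / r * \<theta>"
          using q r1 by (simp add: field_simps)
        then show ?thesis by (simp only: powr_add)
      qed
      also have "m powr (1/2 * (1 - \<theta>)) * m powr ((1 - 1 / (2 * real r)) * \<theta>) = m powr (1 / q)"
      proof -
        have "1 / q = 1/2 * (1 - \<theta>) + (1 - 1 / (2 * real r)) * \<theta>"
        proof -
          have "1/2 + \<theta> * (1/2 - u) = 1/2 * (1 - \<theta>) + (1 - u) * \<theta>" for u by (simp add: field_simps)
          then show ?thesis unfolding q .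
        qed
        then show ?thesis by (simp only: powr_add)
      qed
      also have "K3 * X powr (2 - 2 / q) * m powr (1 / q) * (t powr (- (1/4) * (1 - \<theta>)) * t powr (\<epsilon> * \<theta>))
          \<le> K3 * X powr (2 - 2 / q) * m powr (1 / q) * \<omega> ^ j"
      proof (rule mult_left_mono)
        have "\<epsilon> * \<theta> \<le> \<epsilon> * 1" using \<epsilon> \<theta> by (intro mult_left_mono) auto
        then have "- (1/4) * (1 - \<theta>) + \<epsilon> * \<theta> \<le> - \<epsilon>" by (simp add: \<epsilon>_def field_simps)
        then have "t powr (- (1/4) * (1 - \<theta>) + \<epsilon> * \<theta>) \<le> t powr (- \<epsilon>)" using t1 by (intro powr_mono) auto
        also have "t powr (- \<epsilon>) = \<omega> ^ j"
          unfolding t_def \<omega>_def by (simp add: powr_powr mult.commute flip: powr_realpow)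
        finally show "t powr (- (1/4) * (1 - \<theta>)) * t powr (\<epsilon> * \<theta>) \<le> \<omega> ^ j" by (simp only: powr_add)
      qed (use K3 in auto)
      finally show ?thesis .
    qed
    have "(\<Sum>x\<in>F. \<Sum>y\<in>G. sieve_majorant R (y - x))
        = (\<Sum>x\<in>F. \<Sum>y\<in>G. \<Sum>j\<in>lev ` sieve_sets (R * R). \<Sum>C\<in>\<C> j. v C * Psi C (y - x))"
    proof (intro sum.cong refl)
      fix x y
      show "sieve_majorant R (y - x) = (\<Sum>j\<in>lev ` sieve_sets (R * R). \<Sum>C\<in>\<C> j. v C * Psi C (y - x))"
        unfolding v(2) \<C>_def by (rule sum.group[symmetric]) auto
    qed
    also have "\<dots> = (\<Sum>x\<in>F. \<Sum>j\<in>lev ` sieve_sets (R * R). \<Sum>y\<in>G. \<Sum>C\<in>\<C> j. v C * Psi C (y - x))"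
      by (intro sum.cong refl sum.swap)
    also have "\<dots> = (\<Sum>j\<in>lev ` sieve_sets (R * R). \<Sum>x\<in>F. \<Sum>y\<in>G. \<Sum>C\<in>\<C> j. v C * Psi C (y - x))"
      by (rule sum.swap)
    also have "\<dots> \<le> (\<Sum>j\<in>lev ` sieve_sets (R * R). K3 * X powr (2 - 2 / q) * m powr (1 / q) * \<omega> ^ j)"
      using S unfolding S_def by (intro sum_mono) (meson abs_le_D1)
    also have "\<dots> = K3 * X powr (2 - 2 / q) * m powr (1 / q) * (\<Sum>j\<in>lev ` sieve_sets (R * R). \<omega> ^ j)"
      by (simp only: sum_distrib_left)
    also have "\<dots> \<le> K3 * X powr (2 - 2 / q) * m powr (1 / q) * (1 / (1 - \<omega>))"
    proof (rule mult_left_mono)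
      have "(\<Sum>j\<in>lev ` sieve_sets (R * R). \<omega> ^ j) \<le> (\<Sum>j. \<omega> ^ j)"
        using \<omega> by (intro sum_le_suminf summable_geometric) auto
      also have "\<dots> = 1 / (1 - \<omega>)" using \<omega> by (intro suminf_geometric) auto
      finally show "(\<Sum>j\<in>lev ` sieve_sets (R * R). \<omega> ^ j) \<le> 1 / (1 - \<omega>)" .
    qed (use K3 in auto)
    finally show ?thesis by (simp add: K_def m_def mult_ac)
  qed
  note main = this
  have "K > 0" using K3 \<omega> by (simp add: K_def)
  then show ?thesis using main by (intro exI[of _ K] conjI allI impI) auto
qed

section \<open>The von Mangoldt function\<close>

text \<open>Whichever base the choice operator selects, it is irreducible and n is one of its
  powers; upper bounds require nothing more.\<close>

lemma gauss_mangoldt_cases: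
  obtains (zero) "gauss_mangoldt n = 0"
  | (power) \<rho> \<alpha> where "irreducible \<rho>" "\<alpha> \<ge> 1" "n = \<rho> ^ \<alpha>" "gauss_mangoldt n = ln (gnorm \<rho>)"
proof (cases "\<exists>\<rho> \<alpha>. irreducible \<rho> \<and> \<alpha> \<ge> 1 \<and> n = \<rho> ^ \<alpha>")
  case True
  define \<rho> where "\<rho> = (SOME \<rho>. irreducible \<rho> \<and> (\<exists>\<alpha>\<ge>1. n = \<rho> ^ \<alpha>))"
  have "irreducible \<rho> \<and> (\<exists>\<alpha>\<ge>1. n = \<rho> ^ \<alpha>)" unfolding \<rho>_def by (rule someI_ex) (use True in blast)
  moreover have "gauss_mangoldt n = ln (gnorm \<rho>)" using True by (simp add: gauss_mangoldt_def gnorm_def \<rho>_def)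
  ultimately show ?thesis using power by blast
next
  case False
  then have "gauss_mangoldt n = 0" unfolding gauss_mangoldt_def by (rule if_not_P)
  then show ?thesis by (rule zero)
qed

lemma irreducible_gnorm_ge:
  fixes \<rho> :: gauss_int
  assumes "irreducible \<rho>" shows "gnorm \<rho> \<ge> 2"
proof -
  have "\<rho> \<noteq> 0" "\<not> \<rho> dvd 1" using assms by (auto simp: irreducible_def)
  then have "gauss_norm \<rho> \<ge> 2" using gauss_norm_pos[of \<rho>] by (auto simp: gauss_unit_iff)
  then show ?thesis by (simp add: gnorm_def)
qed

lemma gauss_mangoldt_nonneg: "gauss_mangoldt n \<ge> 0"
  by (cases rule: gauss_mangoldt_cases[of n]) (use irreducible_gnorm_ge in fastforce)+

text \<open>The exceptional set: powers of primes inside the sieving range, at which the majorant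
  may be too small.\<close>

definition small_powers :: "real \<Rightarrow> real \<Rightarrow> gauss_int set" where
  "small_powers R N = {n. gnorm n < N \<and> (\<exists>\<rho> \<alpha>. irreducible \<rho> \<and> gnorm \<rho> \<le> R \<and> n = \<rho> ^ \<alpha>)}"

text \<open>A power of an irreducible of norm above R has no prime divisor in the sieving range, so
  the majorant there equals \<open>sieve_mass R\<close>. This is paired with the trivial bound of
  \<Lambda> by \<open>ln N\<close>.\<close>

lemma gauss_mangoldt_le_sieve:
  assumes R: "R \<ge> 1" and n: "gnorm n < N" and N: "N \<ge> 1"
  shows "gauss_mangoldt n \<le> ln N * (sieve_majorant R n / sieve_mass R + of_bool (n \<in> small_powers R N))"
proof (cases rule: gauss_mangoldt_cases[of n])
  case zero
  have "sieve_mass R \<ge> 1" by (rule sieve_mass_ge_1[OF R])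
  then show ?thesis using zero N by (simp add: sieve_majorant_def)
next
  case (power \<rho> \<alpha>)
  have G: "sieve_mass R \<ge> 1" by (rule sieve_mass_ge_1[OF R])
  have \<rho>: "gnorm \<rho> \<ge> 2" by (rule irreducible_gnorm_ge[OF power(1)])
  have "gnorm \<rho> ^ 1 \<le> gnorm \<rho> ^ \<alpha>" using \<rho> power(2) by (intro power_increasing) auto
  then have "gnorm \<rho> \<le> N" using n by (simp add: power(3) gnorm_power)
  then have le: "gauss_mangoldt n \<le> ln N * 1" using \<rho> by (simp add: power(4))
  have "1 \<le> sieve_majorant R n / sieve_mass R + of_bool (n \<in> small_powers R N)"
  proof (cases "gnorm \<rho> \<le> R")
    case True
    then have "n \<in> small_powers R N" using power n by (auto simp: small_powers_def)
    then show ?thesis using G by (simp add: sieve_majorant_def)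
  next
    case False
    have "\<not> \<sigma> dvd n" if \<sigma>: "\<sigma> \<in> gprimes" "gnorm \<sigma> \<le> R" for \<sigma>
    proof
      assume "\<sigma> dvd n"
      then have "\<sigma> dvd \<rho>" unfolding power(3) using prime_elem_dvd_power[OF gprimes_prime_elem[OF \<sigma>(1)]] by blast
      then have "gnorm \<sigma> = gnorm \<rho>"
        using gprimes_dvd_irreducible_norm[OF \<sigma>(1) power(1)] by (simp add: gnorm_def)
      then show False using False \<sigma>(2) by simp
    qed
    then have "(\<Sum>A\<in>sieve_sets R. Psi A n) = sieve_mass R" by (rule sum_Psi_rough)
    then show ?thesis using G by (simp add: sieve_majorant_def power2_eq_square)
  qed
  then have "ln N * 1 \<le> ln N * (sieve_majorant R n / sieve_mass R + of_bool (n \<in> small_powers R N))"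
    using N by (intro mult_left_mono) auto
  then show ?thesis using le by linarith
qed

text \<open>An element is given by a base of norm at most R and an exponent of at most
  \<open>log 2 N\<close>, so few exist when R is a small power of N.\<close>

lemma card_small_powers:
  assumes R: "R \<ge> 1" and N: "N \<ge> 1"
  shows "finite (small_powers R N)" "real (card (small_powers R N)) \<le> 48 * R * (1 + 2 * ln N)"
proof -
  show "finite (small_powers R N)"
    by (rule finite_subset[OF _ finite_gnorm_less[of N]]) (auto simp: small_powers_def)
  define L where "L = nat \<lfloor>log 2 N\<rfloor>"
  have "log 2 N \<ge> 0" using N by simp
  then have L: "real L \<le> log 2 N" by (simp add: L_def)
  have sub: "small_powers R N \<subseteq> (\<lambda>(\<rho>, \<alpha>). \<rho> ^ \<alpha>) ` (gdisc 0 (R + 1) \<times> {..L})"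
  proof
    fix n assume "n \<in> small_powers R N"
    then obtain \<rho> \<alpha> where n: "gnorm n < N" "irreducible \<rho>" "gnorm \<rho> \<le> R" "n = \<rho> ^ \<alpha>" by (auto simp: small_powers_def)
    have "(2::real) ^ \<alpha> \<le> gnorm \<rho> ^ \<alpha>" using irreducible_gnorm_ge[OF n(2)] by (intro power_mono) auto
    then have "2 ^ \<alpha> \<le> N" using n by (simp add: gnorm_power)
    then have "2 powr real \<alpha> \<le> N" by (simp add: powr_realpow)
    then have "real \<alpha> \<le> log 2 N" using N by (simp add: le_log_iff)
    then have "\<alpha> \<le> L" unfolding L_def by linarith
    moreover have "\<rho> \<in> gdisc 0 (R + 1)" using n(3) by (simp add: gdisc_def)
    ultimately show "n \<in> (\<lambda>(\<rho>, \<alpha>). \<rho> ^ \<alpha>) ` (gdisc 0 (R + 1) \<times> {..L})" using n(4) by force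
  qed
  have "card (small_powers R N) \<le> card (gdisc 0 (R + 1) \<times> {..L})"
    using card_mono[OF _ sub] card_image_le[of "gdisc 0 (R + 1) \<times> {..L}" "\<lambda>(\<rho>, \<alpha>). \<rho> ^ \<alpha>"]
    by (meson finite_SigmaI finite_atMost finite_gdisc finite_imageI le_trans)
  then have "real (card (small_powers R N)) \<le> real (card (gdisc 0 (R + 1))) * real (Suc L)"
    unfolding of_nat_mult[symmetric] of_nat_le_iff by (simp only: card_cartesian_product card_atMost)
  also have "\<dots> \<le> (24 * (R + 1)) * (1 + 2 * ln N)"
  proof (intro mult_mono)
    show "real (card (gdisc 0 (R + 1))) \<le> 24 * (R + 1)" using R by (intro card_gdisc_le) auto
    have "ln 2 \<ge> (1/2::real)" using ln2_ge_two_thirds by simp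
    then have "ln N * (1/2) \<le> ln N * ln 2" using N by (intro mult_left_mono) auto
    then have "ln N / ln 2 \<le> 2 * ln N" by (simp add: divide_le_eq)
    then show "real (Suc L) \<le> 1 + 2 * ln N" using L by (simp add: log_def)
  qed (use R in auto)
  also have "\<dots> \<le> 48 * R * (1 + 2 * ln N)" using R N by (intro mult_right_mono) auto
  finally show "real (card (small_powers R N)) \<le> 48 * R * (1 + 2 * ln N)" .
qed

lemma ln_le_powr:
  fixes x a :: real
  assumes "x \<ge> 1" "a > 0"
  shows "ln x \<le> x powr a / a"
proof -
  have "a * ln x = ln (x powr a)" using assms by (simp add: ln_powr)
  also have "\<dots> \<le> x powr a" using assms ln_le_minus_one[of "x powr a"] by simp
  finally show ?thesis using assms by (simp add: field_simps)
qed

definition mangoldt_kernel :: "real \<Rightarrow> gauss_int \<Rightarrow> real" where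
  "mangoldt_kernel N n = of_bool (gnorm n < N) * gauss_mangoldt n"

lemma mangoldt_kernel_nonneg: "mangoldt_kernel N n \<ge> 0"
  by (simp add: mangoldt_kernel_def gauss_mangoldt_nonneg)

text \<open>The factor \<open>ln N\<close> of the pointwise majorization is recovered from
  \<open>sieve_mass R\<close>, as R is a fixed power of N. The sets are confined to one disc because
  the sieve bound requires it.\<close>

lemma mangoldt_local_bound:
  fixes q :: real
  assumes q: "1 < q" "q \<le> 2"
  shows "\<exists>K>0. \<forall>N z F G. 1 \<le> N \<longrightarrow> F \<subseteq> gdisc z (4 * N) \<longrightarrow> G \<subseteq> gdisc z (4 * N) \<longrightarrow>
    (\<Sum>x\<in>F. \<Sum>y\<in>G. mangoldt_kernel N (y - x)) \<le> K * N powr (2 - 2 / q) * (real (card F) * real (card G)) powr (1 / q)"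
proof -
  have pos: "2 - 2 / q > 0" using q by (simp add: field_simps)
  obtain r0 :: nat where r0: "real r0 > 1 / (2 - 2 / q)" using reals_Archimedean2 by blast
  \<comment> \<open>The moment order is large enough for 1/q to lie strictly below the endpoint
    \<open>1 - 1 / (2 * real r)\<close>, which means that \<theta> < 1.\<close>
  define r where "r = max 5 r0"
  have r5: "r \<ge> 5" by (simp add: r_def)
  have rr: "real r > 1 / (2 - 2 / q)" using r0 by (simp add: r_def)
  have r_inv: "1 / real r < 2 - 2 / q"
  proof -
    have "1 < real r * (2 - 2 / q)" using rr pos by (simp add: pos_divide_less_eq)
    then show ?thesis using r5 by (simp add: pos_divide_less_eq mult.commute)
  qed
  define d where "d = 1 - 1 / real r"
  have d: "d > 0" using r5 by (simp add: d_def)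
  define \<theta> where "\<theta> = (2 / q - 1) / d"
  have "0 \<le> 2 / q - 1" using q by (simp add: field_simps)
  moreover have "2 / q - 1 < d" using r_inv by (simp add: d_def)
  ultimately have \<theta>: "0 \<le> \<theta>" "\<theta> < 1"
    unfolding \<theta>_def using d by (simp_all only: divide_less_eq_1_pos divide_nonneg_pos)
  have q_eq: "1 / q = 1 / 2 + \<theta> * (1 / 2 - 1 / (2 * real r))"
  proof -
    have "\<theta> * d = 2 / q - 1" using d by (simp add: \<theta>_def)
    moreover have e: "1 / 2 - 1 / (2 * real r) = d / 2" by (simp add: d_def diff_divide_distrib)
    ultimately have "\<theta> * (d / 2) = (2 / q - 1) / 2" by simp
    then show ?thesis unfolding e by (simp add: diff_divide_distrib)
  qed
  obtain K0 where K0: "K0 > 0" and K0_all: "\<forall>R X z F G. 1 \<le> R \<longrightarrow> 4 ^ r * R ^ (4 * r) \<le> X \<longrightarrow> F \<subseteq> gdisc z X \<longrightarrow> G \<subseteq> gdisc z X \<longrightarrow>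
    (\<Sum>x\<in>F. \<Sum>y\<in>G. sieve_majorant R (y - x))
      \<le> K0 * X powr (2 - 2 / q) * (real (card F) * real (card G)) powr (1 / q)"
    using sieve_form_bound[OF r5 \<theta> q_eq] by blast
  define K1 where "K1 = 68 * real r * K0 * (4 ^ r) powr (2 - 2 / q)"
  define K2 where "K2 = 8 * real r * (48 * (1 + 16 * real r))"
  have "(\<Sum>x\<in>F. \<Sum>y\<in>G. mangoldt_kernel N (y - x)) \<le> (K1 + K2) * N powr (2 - 2 / q) * (real (card F) * real (card G)) powr (1 / q)"
    if N: "1 \<le> N" and F: "F \<subseteq> gdisc z (4 * N)" and G: "G \<subseteq> gdisc z (4 * N)" for N z F G
  proof -
    define m where "m = real (card F) * real (card G)"
    \<comment> \<open>The exponent gives \<open>R ^ (4 * r) = N\<close>, so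
      \<open>sieve_form_bound\<close> applies with X a constant multiple of N.\<close>
    define R where "R = N powr (1 / (4 * real r))"
    define X where "X = 4 ^ r * N"
      have fin: "finite F" "finite G" using F G finite_subset finite_gdisc by blast+
    have R: "R \<ge> 1" using N by (auto simp: R_def intro: ge_one_powr_ge_zero)
    have Gm: "sieve_mass R \<ge> 1" by (rule sieve_mass_ge_1[OF R])
    have lnN: "0 \<le> ln N" using N by simp
    have "R ^ (4 * r) = N" using N r5 R by (simp add: R_def powr_powr flip: powr_realpow)
    then have X: "4 ^ r * R ^ (4 * r) \<le> X" by (simp add: X_def)
    have "4 * N \<le> X" unfolding X_def using N r5 self_le_power[of "4::real" r] by (intro mult_right_mono) auto
    then have sub: "gdisc z (4 * N) \<subseteq> gdisc z X" by (auto simp: gdisc_def)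
    \<comment> \<open>The logarithm disappears here: \<open>ln N\<close> is a fixed multiple of
      \<open>ln R\<close>, which is bounded by a multiple of the mass.\<close>
    have "ln N = 4 * real r * ln R" using N r5 by (simp add: R_def ln_powr)
    also have "\<dots> \<le> 4 * real r * (17 * sieve_mass R)" using ln_le_sieve_mass[OF R] by (intro mult_left_mono) auto
    finally have lnG: "ln N / sieve_mass R \<le> 68 * real r" using Gm by (simp add: pos_divide_le_eq)
    have "(\<Sum>x\<in>F. \<Sum>y\<in>G. mangoldt_kernel N (y - x))
        \<le> (\<Sum>x\<in>F. \<Sum>y\<in>G. ln N / sieve_mass R * sieve_majorant R (y - x) + ln N * of_bool (y - x \<in> small_powers R N))"
    proof (intro sum_mono)
      fix x y
      show "mangoldt_kernel N (y - x) \<le> ln N / sieve_mass R * sieve_majorant R (y - x) + ln N * of_bool (y - x \<in> small_powers R N)"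
      proof (cases "gnorm (y - x) < N")
        case True
        have "gauss_mangoldt (y - x) \<le> ln N * (sieve_majorant R (y - x) / sieve_mass R + of_bool (y - x \<in> small_powers R N))"
          by (rule gauss_mangoldt_le_sieve[OF R True N])
        also have "\<dots> = ln N / sieve_mass R * sieve_majorant R (y - x) + ln N * of_bool (y - x \<in> small_powers R N)"
          by (simp add: distrib_left)
        finally show ?thesis using True by (simp add: mangoldt_kernel_def)
      next
        case False
        have "0 \<le> ln N / sieve_mass R * sieve_majorant R (y - x)" using lnN Gm by (simp add: sieve_majorant_def)
        then show ?thesis using False lnN by (simp add: mangoldt_kernel_def)
      qed
    qed
    also have "\<dots> = ln N / sieve_mass R * (\<Sum>x\<in>F. \<Sum>y\<in>G. sieve_majorant R (y - x)) + ln N * (\<Sum>x\<in>F. \<Sum>y\<in>G. of_bool (y - x \<in> small_powers R N))"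
      by (simp only: sum.distrib sum_distrib_left)
    also have "ln N / sieve_mass R * (\<Sum>x\<in>F. \<Sum>y\<in>G. sieve_majorant R (y - x)) \<le> K1 * N powr (2 - 2 / q) * m powr (1 / q)"
    proof -
      have "(\<Sum>x\<in>F. \<Sum>y\<in>G. sieve_majorant R (y - x)) \<le> K0 * X powr (2 - 2 / q) * m powr (1 / q)"
        unfolding m_def using K0_all R X F G sub by blast
      then have "ln N / sieve_mass R * (\<Sum>x\<in>F. \<Sum>y\<in>G. sieve_majorant R (y - x)) \<le> 68 * real r * (K0 * X powr (2 - 2 / q) * m powr (1 / q))"
        using lnG Gm by (intro mult_mono) (auto simp: sieve_majorant_def intro!: sum_nonneg)
      also have "X powr (2 - 2 / q) = (4 ^ r) powr (2 - 2 / q) * N powr (2 - 2 / q)"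
        by (simp only: X_def powr_mult)
      finally show ?thesis by (simp add: K1_def mult_ac)
    qed
    also have "ln N * (\<Sum>x\<in>F. \<Sum>y\<in>G. of_bool (y - x \<in> small_powers R N)) \<le> K2 * N powr (2 - 2 / q) * m powr (1 / q)"
    proof -
      \<comment> \<open>Each of two logarithms is paid for with \<open>N powr a\<close>. Together
        with R this makes \<open>N powr (1 / (2 * real r))\<close>, which is within
        \<open>N powr (2 - 2 / q)\<close>.\<close>
      define a where "a = 1 / (8 * real r)"
      have a: "a > 0" using r5 by (simp add: a_def)
      have "(\<Sum>x\<in>F. \<Sum>y\<in>G. of_bool (y - x \<in> small_powers R N)) ^ 1
          \<le> m powr (real 1 - 1/2) * (\<Sum>n\<in>gdisc 0 (4 * (4 * N)). of_bool (n \<in> small_powers R N) ^ 1)"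
        unfolding m_def by (rule pair_sum_moment[OF F G]) auto
      then have "(\<Sum>x\<in>F. \<Sum>y\<in>G. of_bool (y - x \<in> small_powers R N))
          \<le> m powr (1/2) * (\<Sum>n\<in>gdisc 0 (4 * (4 * N)). of_bool (n \<in> small_powers R N))" by simp
      also have "\<dots> \<le> m powr (1 / q) * (48 * R * (1 + 2 * ln N))"
      proof (rule mult_mono)
        \<comment> \<open>The number m of pairs is 0 or at least 1, so the exponent may be raised
          from 1/2 to 1/q.\<close>
        show "m powr (1/2) \<le> m powr (1 / q)"
        proof (cases "m = 0")
          case False
          then have "card F \<ge> 1" "card G \<ge> 1" by (auto simp: m_def Suc_le_eq)
          then have "1 * 1 \<le> m" unfolding m_def by (intro mult_mono) auto
          then show ?thesis using q by (intro powr_mono) (auto simp: field_simps)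
        qed simp
        have "(\<Sum>n\<in>gdisc 0 (4 * (4 * N)). of_bool (n \<in> small_powers R N)) = real (card (gdisc 0 (4 * (4 * N)) \<inter> small_powers R N))"
          by (simp add: sum_of_bool_eq)
        also have "\<dots> \<le> real (card (small_powers R N))"
          using card_small_powers(1)[OF R N] by (simp add: card_mono)
        also have "\<dots> \<le> 48 * R * (1 + 2 * ln N)" by (rule card_small_powers(2)[OF R N])
        finally show "(\<Sum>n\<in>gdisc 0 (4 * (4 * N)). of_bool (n \<in> small_powers R N)) \<le> 48 * R * (1 + 2 * ln N)" .
      qed (auto intro!: sum_nonneg)
      finally have le: "(\<Sum>x\<in>F. \<Sum>y\<in>G. of_bool (y - x \<in> small_powers R N)) \<le> m powr (1 / q) * (48 * R * (1 + 2 * ln N))" .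
      have ln_a: "ln N \<le> 8 * real r * N powr a"
        using ln_le_powr[OF N a] by (simp add: a_def mult.commute)
      have one_a: "1 \<le> N powr a" using N a by (intro ge_one_powr_ge_zero) auto
      have "ln N * (m powr (1 / q) * (48 * R * (1 + 2 * ln N)))
          \<le> (8 * real r * N powr a) * (m powr (1 / q) * (48 * R * (N powr a + 2 * (8 * real r * N powr a))))"
        using ln_a one_a lnN R by (intro mult_mono mult_left_mono add_mono) auto
      also have "\<dots> = K2 * (N powr a * N powr a * R) * m powr (1 / q)"
        by (simp add: K2_def algebra_simps)
      also have "N powr a * N powr a * R = N powr (1 / (2 * real r))"
        unfolding R_def powr_add[symmetric] using r5 by (simp add: a_def field_simps)
      also have "K2 * N powr (1 / (2 * real r)) * m powr (1 / q) \<le> K2 * N powr (2 - 2 / q) * m powr (1 / q)"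
      proof (intro mult_right_mono mult_left_mono powr_mono N)
        have "1 / (2 * real r) \<le> 1 / real r" using r5 by (simp add: field_simps)
        then show "1 / (2 * real r) \<le> 2 - 2 / q" using r_inv by simp
      qed (auto simp: K2_def)
      finally have "ln N * (m powr (1 / q) * (48 * R * (1 + 2 * ln N))) \<le> K2 * N powr (2 - 2 / q) * m powr (1 / q)" .
      then show ?thesis using mult_left_mono[OF le lnN] by linarith
    qed
    finally show ?thesis by (simp add: m_def distrib_right)
  qed
  note main = this
  have "K1 + K2 > 0" using K0 r5 by (auto simp: K1_def K2_def intro!: add_pos_nonneg mult_pos_pos)
  then show ?thesis using main by blast
qed

section \<open>From sets in one disc to arbitrary finite sets\<close>

text \<open>For N \<ge> 100 the error \<open>14 * sqrt N\<close> is at most \<open>1.4 * N\<close>,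
  against a main term of at least \<open>3 * N\<close>; below 100 the centre alone suffices.\<close>

lemma card_gdisc_ge:
  assumes N: "N \<ge> 1"
  shows "N \<le> 100 * real (card (gdisc z N))"
proof (cases "N \<ge> 100")
  case True
  have "sqrt N * 10 \<le> sqrt N * sqrt N"
    using True real_sqrt_le_mono[of 100 N] by (intro mult_left_mono) (auto simp: real_sqrt_mult real_le_rsqrt)
  then have "sqrt N \<le> N / 10" using N by simp
  moreover have "3 * N \<le> pi * N" using N pi_gt3 by (intro mult_right_mono) auto
  ultimately have "N \<le> real (card (gdisc z N))" using card_gdisc_asymp[OF N, of z] N by argo
  then show ?thesis using N by linarith
next
  case False
  have "z \<in> gdisc z N" using N by (simp add: gdisc_def)
  then have "card (gdisc z N) \<ge> 1" by (metis One_nat_def Suc_leI card_gt_0_iff empty_iff finite_gdisc)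
  then show ?thesis using False by linarith
qed

lemma Cauchy_Schwarz_sum_sqrt:
  fixes A B :: "'a \<Rightarrow> real"
  shows "(\<Sum>z\<in>Z. A z * B z) \<le> sqrt (\<Sum>z\<in>Z. (A z)\<^sup>2) * sqrt (\<Sum>z\<in>Z. (B z)\<^sup>2)"
  unfolding real_sqrt_mult[symmetric] by (intro real_le_rsqrt Cauchy_Schwarz_ineq_sum)

text \<open>The kernel vanishes at differences of norm at least N, so F and G interact only within
  discs of comparable size. The local bounds recombine by Cauchy-Schwarz, since 2/q \<ge> 1 makes
  the powers of the local sizes summable.\<close>

lemma mangoldt_restricted_bound:
  fixes q :: real
  assumes q: "1 < q" "q \<le> 2"
  shows "\<exists>K>0. \<forall>N F G. 1 \<le> N \<longrightarrow> finite F \<longrightarrow> finite G \<longrightarrow>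
    (\<Sum>x\<in>F. \<Sum>y\<in>G. mangoldt_kernel N (y - x)) \<le> K * N powr (2 - 2 / q) * (real (card F) * real (card G)) powr (1 / q)"
proof -
  obtain K where K: "K > 0" and K_all: "\<forall>N z F G. 1 \<le> N \<longrightarrow> F \<subseteq> gdisc z (4 * N) \<longrightarrow> G \<subseteq> gdisc z (4 * N) \<longrightarrow>
    (\<Sum>x\<in>F. \<Sum>y\<in>G. mangoldt_kernel N (y - x)) \<le> K * N powr (2 - 2 / q) * (real (card F) * real (card G)) powr (1 / q)"
    using mangoldt_local_bound[OF q] by blast
  have "(\<Sum>x\<in>F. \<Sum>y\<in>G. mangoldt_kernel N (y - x)) \<le> (9600 * K) * N powr (2 - 2 / q) * (real (card F) * real (card G)) powr (1 / q)"
    if N: "1 \<le> N" and fin: "finite F" "finite G" for N F G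
  proof -
    define Z where "Z = (\<Union>x\<in>F. gdisc x N)"
    define D where "D = real (card (gdisc 0 N))"
    define loc where "loc = (\<lambda>S z. S \<inter> gdisc z (4 * N))"
    have finZ: "finite Z" using fin by (simp add: Z_def)
    have D: "N \<le> 100 * D" unfolding D_def by (rule card_gdisc_ge[OF N])
    have D0: "D > 0" using D N by linarith
    \<comment> \<open>Averaging over the discs of radius \<open>2 \<surd>N\<close> reduces the bound to sets contained in one of them.\<close>
    have cover: "D * mangoldt_kernel N (y - x) \<le> (\<Sum>z\<in>Z. of_bool (x \<in> gdisc z (4 * N)) * of_bool (y \<in> gdisc z (4 * N)) * mangoldt_kernel N (y - x))"
      if x: "x \<in> F" for x y
    proof (cases "gnorm (y - x) < N")
      case True
      have mem: "x \<in> gdisc z (4 * N)" "y \<in> gdisc z (4 * N)" if "z \<in> gdisc x N" for z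
      proof -
        have z: "gnorm (x - z) < N" using that by (simp add: gdisc_def gnorm_minus_commute)
        then show "x \<in> gdisc z (4 * N)" using N by (simp add: gdisc_def)
        have "gnorm ((y - x) + (x - z)) \<le> 2 * gnorm (y - x) + 2 * gnorm (x - z)" by (rule gnorm_add_le)
        then show "y \<in> gdisc z (4 * N)" using True z by (simp add: gdisc_def)
      qed
      have "D * mangoldt_kernel N (y - x) = (\<Sum>z\<in>gdisc x N. mangoldt_kernel N (y - x))"
        by (simp add: D_def card_gdisc[of x])
      also have "\<dots> = (\<Sum>z\<in>gdisc x N. of_bool (x \<in> gdisc z (4 * N)) * of_bool (y \<in> gdisc z (4 * N)) * mangoldt_kernel N (y - x))"
        using mem by (intro sum.cong) auto
      also have "\<dots> \<le> (\<Sum>z\<in>Z. of_bool (x \<in> gdisc z (4 * N)) * of_bool (y \<in> gdisc z (4 * N)) * mangoldt_kernel N (y - x))"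
        using finZ x by (intro sum_mono2) (auto simp: Z_def mangoldt_kernel_nonneg)
      finally show ?thesis .
    qed (simp add: mangoldt_kernel_def)
    \<comment> \<open>As 2/q - 1 \<ge> 0, the power \<open>2 / q\<close> of a local size is at most
      the local size times \<open>card S\<close> to the power \<open>2 / q - 1\<close>, and each
      point of S lies in at most \<open>96 * N\<close> of the discs.\<close>
    have loc_sum: "(\<Sum>z\<in>Z. ((real (card (loc S z))) powr (1 / q))\<^sup>2) \<le> (96 * N) * ((real (card S)) powr (1 / q))\<^sup>2" if S: "finite S" for S
    proof -
      have e: "2 / q - 1 \<ge> 0" using q by (simp add: field_simps)
      have sq: "(t powr (1 / q))\<^sup>2 = t powr (2 / q - 1) * t" if "t \<ge> 0" for t :: real
      proof -
        have "(t powr (1 / q))\<^sup>2 = t powr (1 / q + 1 / q)" by (simp only: power2_eq_square powr_add)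
        also have "\<dots> = t powr ((2 / q - 1) + 1)" by (simp add: add_divide_distrib[symmetric])
        also have "\<dots> = t powr (2 / q - 1) * t" using that by (simp only: powr_add) simp
        finally show ?thesis .
      qed
      have "(\<Sum>z\<in>Z. ((real (card (loc S z))) powr (1 / q))\<^sup>2) \<le> (\<Sum>z\<in>Z. (real (card S)) powr (2 / q - 1) * real (card (loc S z)))"
        using S e by (intro sum_mono) (auto simp: sq loc_def intro!: mult_right_mono powr_mono2 card_mono)
      also have "\<dots> = (real (card S)) powr (2 / q - 1) * (\<Sum>z\<in>Z. real (card (loc S z)))" by (simp only: sum_distrib_left)
      also have "\<dots> \<le> (real (card S)) powr (2 / q - 1) * (96 * N * real (card S))"
      proof (rule mult_left_mono)
        have "(\<Sum>z\<in>Z. real (card (loc S z))) = (\<Sum>z\<in>Z. \<Sum>x\<in>S. of_bool (x \<in> gdisc z (4 * N)))"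
          using S by (simp add: loc_def sum_of_bool_eq)
        also have "\<dots> = (\<Sum>x\<in>S. \<Sum>z\<in>Z. of_bool (x \<in> gdisc z (4 * N)))" by (rule sum.swap)
        also have "\<dots> \<le> (\<Sum>x\<in>S. 96 * N)"
        proof (rule sum_mono)
          fix x
          have "(\<Sum>z\<in>Z. of_bool (x \<in> gdisc z (4 * N))) = real (card (Z \<inter> {z. x \<in> gdisc z (4 * N)}))"
            using finZ by (simp add: sum_of_bool_eq)
          also have "\<dots> \<le> real (card (gdisc x (4 * N)))"
            by (intro of_nat_mono card_mono finite_gdisc) (auto simp: gdisc_def gnorm_minus_commute)
          also have "\<dots> \<le> 96 * N" using card_gdisc_le[of "4 * N" x] N by simp
          finally show "(\<Sum>z\<in>Z. of_bool (x \<in> gdisc z (4 * N))) \<le> 96 * N" .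
        qed
        finally show "(\<Sum>z\<in>Z. real (card (loc S z))) \<le> 96 * N * real (card S)" by (simp add: mult.commute)
      qed simp
      finally show ?thesis by (simp add: sq mult_ac)
    qed
    have "D * (\<Sum>x\<in>F. \<Sum>y\<in>G. mangoldt_kernel N (y - x)) = (\<Sum>x\<in>F. \<Sum>y\<in>G. D * mangoldt_kernel N (y - x))"
      by (simp only: sum_distrib_left)
    also have "\<dots> \<le> (\<Sum>x\<in>F. \<Sum>y\<in>G. \<Sum>z\<in>Z. of_bool (x \<in> gdisc z (4 * N)) * of_bool (y \<in> gdisc z (4 * N)) * mangoldt_kernel N (y - x))"
      by (intro sum_mono cover)
    also have "\<dots> = (\<Sum>x\<in>F. \<Sum>z\<in>Z. \<Sum>y\<in>G. of_bool (x \<in> gdisc z (4 * N)) * of_bool (y \<in> gdisc z (4 * N)) * mangoldt_kernel N (y - x))"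
      by (intro sum.cong refl sum.swap)
    also have "\<dots> = (\<Sum>z\<in>Z. \<Sum>x\<in>F. \<Sum>y\<in>G. of_bool (x \<in> gdisc z (4 * N)) * of_bool (y \<in> gdisc z (4 * N)) * mangoldt_kernel N (y - x))"
      by (rule sum.swap)
    also have "\<dots> = (\<Sum>z\<in>Z. \<Sum>x\<in>loc F z. \<Sum>y\<in>loc G z. mangoldt_kernel N (y - x))"
    proof (rule sum.cong[OF refl])
      fix z
      have "(\<Sum>x\<in>F. \<Sum>y\<in>G. of_bool (x \<in> gdisc z (4 * N)) * of_bool (y \<in> gdisc z (4 * N)) * mangoldt_kernel N (y - x))
          = (\<Sum>x\<in>F. if x \<in> gdisc z (4 * N) then (\<Sum>y\<in>G. if y \<in> gdisc z (4 * N) then mangoldt_kernel N (y - x) else 0) else 0)"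
        by (intro sum.cong refl) (auto intro!: sum.cong sum.neutral)
      also have "\<dots> = (\<Sum>x\<in>loc F z. \<Sum>y\<in>loc G z. mangoldt_kernel N (y - x))"
        using fin by (simp only: loc_def sum.inter_restrict)
      finally show "(\<Sum>x\<in>F. \<Sum>y\<in>G. of_bool (x \<in> gdisc z (4 * N)) * of_bool (y \<in> gdisc z (4 * N)) * mangoldt_kernel N (y - x))
          = (\<Sum>x\<in>loc F z. \<Sum>y\<in>loc G z. mangoldt_kernel N (y - x))" .
    qed
    also have "\<dots> \<le> (\<Sum>z\<in>Z. K * N powr (2 - 2 / q) * (real (card (loc F z)) * real (card (loc G z))) powr (1 / q))"
    proof (rule sum_mono)
      fix z
      have "loc F z \<subseteq> gdisc z (4 * N)" "loc G z \<subseteq> gdisc z (4 * N)" by (auto simp: loc_def)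
      then show "(\<Sum>x\<in>loc F z. \<Sum>y\<in>loc G z. mangoldt_kernel N (y - x))
          \<le> K * N powr (2 - 2 / q) * (real (card (loc F z)) * real (card (loc G z))) powr (1 / q)"
        using K_all N by blast
    qed
    also have "\<dots> = K * N powr (2 - 2 / q) * (\<Sum>z\<in>Z. real (card (loc F z)) powr (1 / q) * real (card (loc G z)) powr (1 / q))"
      by (simp only: powr_mult sum_distrib_left)
    also have "\<dots> \<le> K * N powr (2 - 2 / q) * (96 * N * (real (card F) powr (1 / q) * real (card G) powr (1 / q)))"
    proof (rule mult_left_mono)
      have "(\<Sum>z\<in>Z. real (card (loc F z)) powr (1 / q) * real (card (loc G z)) powr (1 / q))
          \<le> sqrt (\<Sum>z\<in>Z. ((real (card (loc F z))) powr (1 / q))\<^sup>2) * sqrt (\<Sum>z\<in>Z. ((real (card (loc G z))) powr (1 / q))\<^sup>2)"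
        by (rule Cauchy_Schwarz_sum_sqrt)
      also have "\<dots> \<le> sqrt ((96 * N) * ((real (card F)) powr (1 / q))\<^sup>2) * sqrt ((96 * N) * ((real (card G)) powr (1 / q))\<^sup>2)"
        using fin by (intro mult_mono real_sqrt_le_mono loc_sum real_sqrt_ge_zero sum_nonneg) (use N in auto)
      also have "\<dots> = (sqrt (96 * N) * sqrt (96 * N)) * (real (card F) powr (1 / q) * real (card G) powr (1 / q))"
        by (simp only: real_sqrt_mult real_sqrt_abs abs_of_nonneg powr_ge_zero mult_ac)
      also have "sqrt (96 * N) * sqrt (96 * N) = 96 * N" using N by simp
      finally show "(\<Sum>z\<in>Z. real (card (loc F z)) powr (1 / q) * real (card (loc G z)) powr (1 / q))
          \<le> 96 * N * (real (card F) powr (1 / q) * real (card G) powr (1 / q))" .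
    qed (use K in auto)
    also have "\<dots> \<le> K * N powr (2 - 2 / q) * (96 * (100 * D) * (real (card F) powr (1 / q) * real (card G) powr (1 / q)))"
      using K D by (intro mult_left_mono mult_right_mono) auto
    also have "\<dots> = D * ((9600 * K) * N powr (2 - 2 / q) * (real (card F) * real (card G)) powr (1 / q))"
      by (simp add: powr_mult mult_ac)
    finally show ?thesis using D0 by simp
  qed
  then show ?thesis using K by (intro exI[of _ "9600 * K"]) auto
qed

text \<open>A Chebyshev-type bound, found by testing the restricted inequality at q = 2 on two
  concentric discs: translates of the smaller disc by its own points stay in the larger one.\<close>

lemma sum_mangoldt_le:
  "\<exists>K>0. \<forall>N\<ge>1. (\<Sum>n\<in>gdisc 0 N. gauss_mangoldt n) \<le> K * N"
proof -
  obtain K where K: "K > 0" and K_all: "\<forall>N F G. 1 \<le> N \<longrightarrow> finite F \<longrightarrow> finite G \<longrightarrow>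
    (\<Sum>x\<in>F. \<Sum>y\<in>G. mangoldt_kernel N (y - x)) \<le> K * N powr (2 - 2 / 2) * (real (card F) * real (card G)) powr (1 / 2)"
    using mangoldt_restricted_bound[of 2] by auto
  have "(\<Sum>n\<in>gdisc 0 N. gauss_mangoldt n) \<le> (4800 * K) * N" if N: "N \<ge> 1" for N
  proof -
    define D where "D = real (card (gdisc 0 N))"
    have D: "N \<le> 100 * D" unfolding D_def by (rule card_gdisc_ge[OF N])
    have D0: "D > 0" using D N by linarith
    have "D * (\<Sum>n\<in>gdisc 0 N. gauss_mangoldt n) = (\<Sum>x\<in>gdisc 0 N. \<Sum>n\<in>gdisc 0 N. gauss_mangoldt n)"
      by (simp add: D_def)
    also have "\<dots> \<le> (\<Sum>x\<in>gdisc 0 N. \<Sum>y\<in>gdisc 0 (4 * N). mangoldt_kernel N (y - x))"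
    proof (rule sum_mono)
      fix x assume x: "x \<in> gdisc 0 N"
      have "(\<Sum>n\<in>gdisc 0 N. gauss_mangoldt n) = (\<Sum>y\<in>(\<lambda>n. n + x) ` gdisc 0 N. mangoldt_kernel N (y - x))"
        by (subst sum.reindex) (auto simp: inj_on_def mangoldt_kernel_def gdisc_def intro!: sum.cong)
      also have "\<dots> \<le> (\<Sum>y\<in>gdisc 0 (4 * N). mangoldt_kernel N (y - x))"
      proof (rule sum_mono2)
        show "(\<lambda>n. n + x) ` gdisc 0 N \<subseteq> gdisc 0 (4 * N)"
        proof clarify
          fix n assume "n \<in> gdisc 0 N"
          then show "n + x \<in> gdisc 0 (4 * N)" using gnorm_add_le[of n x] x by (simp add: gdisc_def)
        qed
      qed (auto simp: mangoldt_kernel_nonneg)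
      finally show "(\<Sum>n\<in>gdisc 0 N. gauss_mangoldt n) \<le> (\<Sum>y\<in>gdisc 0 (4 * N). mangoldt_kernel N (y - x))" .
    qed
    also have "\<dots> \<le> K * N powr (2 - 2 / 2) * (D * real (card (gdisc 0 (4 * N)))) powr (1 / 2)"
      using K_all N by (simp add: D_def)
    also have "\<dots> \<le> K * N * (D * 9600 * D) powr (1 / 2)"
    proof -
      have "real (card (gdisc 0 (4 * N))) \<le> 96 * N" using card_gdisc_le[of "4 * N" 0] N by simp
      also have "\<dots> \<le> 9600 * D" using D by simp
      finally have "(D * real (card (gdisc 0 (4 * N)))) powr (1 / 2) \<le> (D * (9600 * D)) powr (1 / 2)"
        using D0 by (intro powr_mono2 mult_left_mono) auto
      then show ?thesis using K N by (simp add: mult_left_mono mult.assoc)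
    qed
    also have "(D * 9600 * D) powr (1 / 2) \<le> 100 * D"
    proof -
      have "D * 9600 * D \<le> (100 * D)\<^sup>2" by (simp add: power2_eq_square)
      then have "sqrt (D * 9600 * D) \<le> 100 * D" using D0 by (intro real_le_lsqrt) auto
      then show ?thesis using D0 by (simp add: powr_half_sqrt)
    qed
    finally have "D * (\<Sum>n\<in>gdisc 0 N. gauss_mangoldt n) \<le> D * (100 * K * N)"
      using K N by (simp add: mult_left_mono mult_ac)
    then have "(\<Sum>n\<in>gdisc 0 N. gauss_mangoldt n) \<le> 100 * K * N" using D0 by simp
    also have "\<dots> \<le> 4800 * K * N" using K N by simp
    finally show ?thesis .
  qed
  then show ?thesis using K by (intro exI[of _ "4800 * K"]) auto
qed

section \<open>Interpolation\<close>

text \<open>The terms decay geometrically on both sides of the s for which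
  \<open>2 powr s * T\<close> is near 1. Changing T merely shifts the sum, and rounding
  \<open>log 2 T\<close> costs \<open>2 powr \<eta>\<close>, so W is uniform in T.\<close>

lemma two_sided_geometric_sum:
  fixes u v :: real
  assumes uv: "u > 0" "v > 0"
  shows "\<exists>W>0. \<forall>T A. T > 0 \<longrightarrow> finite A \<longrightarrow>
    (\<Sum>s\<in>A. min ((2 powr real_of_int s * T) powr u) ((2 powr real_of_int s * T) powr (- v))) \<le> W"
proof -
  define \<eta> where "\<eta> = min u v"
  have \<eta>: "\<eta> > 0" "\<eta> \<le> u" "\<eta> \<le> v" using uv by (auto simp: \<eta>_def)
  define \<omega> where "\<omega> = 2 powr (- \<eta>)"
  have \<omega>: "0 < \<omega>" "\<omega> < 1" using \<eta> by (auto simp: \<omega>_def powr_less_one)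
  define W where "W = 2 powr \<eta> * (2 * suminf (\<lambda>k. \<omega> ^ k))"
  have summ: "summable (\<lambda>k. \<omega> ^ k)" using \<omega> by (intro summable_geometric) auto
  have W: "W > 0"
  proof -
    have "suminf (\<lambda>k. \<omega> ^ k) > 0" using \<omega> by (intro suminf_pos summ) auto
    then show ?thesis by (simp add: W_def)
  qed
  have "(\<Sum>s\<in>A. min ((2 powr real_of_int s * T) powr u) ((2 powr real_of_int s * T) powr (- v))) \<le> W"
    if T: "T > 0" and A: "finite A" for T A
  proof -
    define \<tau> where "\<tau> = log 2 T"
    define \<sigma> where "\<sigma> = \<lfloor>\<tau>\<rfloor>"
    have "min ((2 powr real_of_int s * T) powr u) ((2 powr real_of_int s * T) powr (- v)) \<le> 2 powr \<eta> * \<omega> ^ nat \<bar>s + \<sigma>\<bar>" for s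
    proof -
      define e where "e = real_of_int s + \<tau>"
      have "2 powr real_of_int s * T = 2 powr e" using T by (simp add: e_def \<tau>_def powr_add)
      then have "min ((2 powr real_of_int s * T) powr u) ((2 powr real_of_int s * T) powr (- v)) = min (2 powr (e * u)) (2 powr (- e * v))"
        by (simp add: powr_powr)
      also have "\<dots> \<le> 2 powr (- \<eta> * \<bar>e\<bar>)"
      proof (cases "e \<ge> 0")
        case True
        then have "e * \<eta> \<le> e * v" using \<eta> by (intro mult_left_mono) auto
        then have "2 powr (- e * v) \<le> (2::real) powr (- \<eta> * \<bar>e\<bar>)" using True by (intro powr_mono) (auto simp: mult.commute)
        then show ?thesis by (rule min.coboundedI2)
      next
        case False
        then have "e * u \<le> e * \<eta>" using \<eta> by (intro mult_left_mono_neg) auto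
        then have "2 powr (e * u) \<le> (2::real) powr (- \<eta> * \<bar>e\<bar>)" using False by (intro powr_mono) (auto simp: mult.commute)
        then show ?thesis by (rule min.coboundedI1)
      qed
      also have "\<dots> \<le> 2 powr (\<eta> + (- \<eta>) * \<bar>real_of_int (s + \<sigma>)\<bar>)"
      proof (rule powr_mono)
        have "\<bar>real_of_int (s + \<sigma>)\<bar> \<le> \<bar>e\<bar> + 1" unfolding e_def \<sigma>_def by (simp add: abs_le_iff) linarith
        then have "\<eta> * \<bar>real_of_int (s + \<sigma>)\<bar> \<le> \<eta> * (\<bar>e\<bar> + 1)" using \<eta> by (intro mult_left_mono) auto
        then show "- \<eta> * \<bar>e\<bar> \<le> \<eta> + (- \<eta>) * \<bar>real_of_int (s + \<sigma>)\<bar>" by (simp add: algebra_simps)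
      qed simp
      also have "\<dots> = 2 powr \<eta> * (2 powr (- \<eta>)) powr real (nat \<bar>s + \<sigma>\<bar>)"
        by (simp only: powr_add powr_powr) simp
      also have "\<dots> = 2 powr \<eta> * \<omega> ^ nat \<bar>s + \<sigma>\<bar>"
        by (simp only: \<omega>_def[symmetric] powr_realpow[OF \<omega>(1)])
      finally show ?thesis .
    qed
    then have "(\<Sum>s\<in>A. min ((2 powr real_of_int s * T) powr u) ((2 powr real_of_int s * T) powr (- v)))
        \<le> (\<Sum>s\<in>A. 2 powr \<eta> * \<omega> ^ nat \<bar>s + \<sigma>\<bar>)" by (rule sum_mono)
    also have "\<dots> = 2 powr \<eta> * (\<Sum>s\<in>(\<lambda>s. s + \<sigma>) ` A. \<omega> ^ nat \<bar>s\<bar>)"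
      by (simp add: sum_distrib_left sum.reindex inj_on_def)
    also have "\<dots> \<le> W" unfolding W_def
      using A \<omega> summ by (intro mult_left_mono sum_nat_abs_le) auto
    finally show ?thesis .
  qed
  then show ?thesis using W by blast
qed

lemma floor_log2_bounds:
  assumes "x > 0"
  shows "2 powr real_of_int \<lfloor>log 2 x\<rfloor> \<le> x" "x \<le> 2 * 2 powr real_of_int \<lfloor>log 2 x\<rfloor>"
proof -
  have "real_of_int \<lfloor>log 2 x\<rfloor> \<le> log 2 x" "log 2 x \<le> 1 + real_of_int \<lfloor>log 2 x\<rfloor>" by linarith+
  then have "2 powr real_of_int \<lfloor>log 2 x\<rfloor> \<le> 2 powr log 2 x" "2 powr log 2 x \<le> 2 powr (1 + real_of_int \<lfloor>log 2 x\<rfloor>)"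
    by (intro powr_mono; simp)+
  moreover have "2 powr log 2 x = x" using assms by simp
  ultimately show "2 powr real_of_int \<lfloor>log 2 x\<rfloor> \<le> x" "x \<le> 2 * 2 powr real_of_int \<lfloor>log 2 x\<rfloor>"
    by (simp_all add: powr_add)
qed

text \<open>Markov's inequality on a dyadic level set, where a is at least
  \<open>2 powr i\<close>.\<close>

lemma level_set_card:
  fixes a :: "'a \<Rightarrow> real"
  assumes "finite F" "\<And>x. x \<in> F \<Longrightarrow> a x > 0" "p > 0"
  shows "real (card {x \<in> F. \<lfloor>log 2 (a x)\<rfloor> = i}) \<le> (\<Sum>x | x \<in> F \<and> \<lfloor>log 2 (a x)\<rfloor> = i. a x powr p) * 2 powr (- (real_of_int i * p))"
proof -
  have "real (card {x \<in> F. \<lfloor>log 2 (a x)\<rfloor> = i}) * 2 powr (real_of_int i * p)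
      = (\<Sum>x | x \<in> F \<and> \<lfloor>log 2 (a x)\<rfloor> = i. (2 powr real_of_int i) powr p)"
    by (simp add: powr_powr)
  also have "\<dots> \<le> (\<Sum>x | x \<in> F \<and> \<lfloor>log 2 (a x)\<rfloor> = i. a x powr p)"
    using assms floor_log2_bounds(1) by (intro sum_mono powr_mono2) auto
  finally show ?thesis by (simp add: powr_minus field_simps)
qed

text \<open>On level sets of heights \<open>2^i\<close> and \<open>2^l\<close> the restricted bounds
  at q1 and 2, on either side of p, give powers of \<open>2^(i+l) * N powr (2 / p)\<close> with
  exponents of opposite sign. The better of the two is the weight w, summable in either index with
  the other fixed, and the factor \<open>sqrt (A i * B l)\<close> is replaced by the mean of
  \<open>A i\<close> and \<open>B l\<close>. The unsimplified \<open>2 - 2 / 2\<close> lets both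
  bounds be treated as one expression in q.\<close>

lemma restricted_to_strong_normalized:
  fixes k :: "'a \<Rightarrow> 'b \<Rightarrow> real"
  assumes k: "\<And>x y. k x y \<ge> 0" and p: "0 < q1" "q1 < p" "p < 2" and N: "N > 0" and K: "K \<ge> 0"
    and R1: "\<And>F G. finite F \<Longrightarrow> finite G \<Longrightarrow> (\<Sum>x\<in>F. \<Sum>y\<in>G. k x y) \<le> K * N powr (2 - 2 / q1) * (real (card F) * real (card G)) powr (1 / q1)"
    and R2: "\<And>F G. finite F \<Longrightarrow> finite G \<Longrightarrow> (\<Sum>x\<in>F. \<Sum>y\<in>G. k x y) \<le> K * N powr (2 - 2 / 2) * (real (card F) * real (card G)) powr (1 / 2)"
    and W: "\<And>T A. T > 0 \<Longrightarrow> finite A \<Longrightarrow>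
      (\<Sum>s\<in>A. min ((2 powr real_of_int s * T) powr (1 - p / 2)) ((2 powr real_of_int s * T) powr (- (p / q1 - 1)))) \<le> W"
    and F: "finite F" "\<And>x. x \<in> F \<Longrightarrow> a x > 0" "(\<Sum>x\<in>F. a x powr p) \<le> 1"
    and G: "finite G" "\<And>y. y \<in> G \<Longrightarrow> b y > 0" "(\<Sum>y\<in>G. b y powr p) \<le> 1"
  shows "(\<Sum>x\<in>F. \<Sum>y\<in>G. k x y * a x * b y) \<le> 4 * K * W * N powr (2 - 2 / p)"
proof -
  define lv where "lv = (\<lambda>x. \<lfloor>log 2 (a x)\<rfloor>)"
  define lw where "lw = (\<lambda>y. \<lfloor>log 2 (b y)\<rfloor>)"
  define Fi where "Fi = (\<lambda>i. {x \<in> F. lv x = i})"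
  define Gl where "Gl = (\<lambda>l. {y \<in> G. lw y = l})"
  define A where "A = (\<lambda>i. \<Sum>x\<in>Fi i. a x powr p)"
  define B where "B = (\<lambda>l. \<Sum>y\<in>Gl l. b y powr p)"
  define T where "T = N powr (2 / p)"
  define w where "w = (\<lambda>s. min ((2 powr real_of_int s * T) powr (1 - p / 2)) ((2 powr real_of_int s * T) powr (- (p / q1 - 1))))"
  define M where "M = N powr (2 - 2 / p)"
  have T: "T > 0" using N by (simp add: T_def)
  have w0: "w s \<ge> 0" for s by (simp add: w_def)
  have AB0: "A i \<ge> 0" "B l \<ge> 0" for i l by (auto simp: A_def B_def intro!: sum_nonneg)
  have A_sum: "(\<Sum>i\<in>lv ` F. A i) \<le> 1"
    unfolding A_def Fi_def using F sum.group[of F "lv ` F" lv "\<lambda>x. a x powr p"] by simp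
  have B_sum: "(\<Sum>l\<in>lw ` G. B l) \<le> 1"
    unfolding B_def Gl_def using G sum.group[of G "lw ` G" lw "\<lambda>y. b y powr p"] by simp
  have A1: "A i \<le> 1" for i
    unfolding A_def by (rule order_trans[OF sum_mono2 F(3)]) (auto simp: Fi_def F(1))
  have B1: "B l \<le> 1" for l
    unfolding B_def by (rule order_trans[OF sum_mono2 G(3)]) (auto simp: Gl_def G(1))
  have cF: "real (card (Fi i)) \<le> A i * 2 powr (- (real_of_int i * p))" for i
    unfolding Fi_def A_def lv_def using F p by (intro level_set_card) auto
  have cG: "real (card (Gl l)) \<le> B l * 2 powr (- (real_of_int l * p))" for l
    unfolding Gl_def B_def lw_def using G p by (intro level_set_card) auto
  have cell: "(\<Sum>x\<in>Fi i. \<Sum>y\<in>Gl l. k x y * a x * b y) \<le> 4 * K * M * (sqrt (A i * B l) * w (i + l))" for i l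
  proof -
    define s where "s = real_of_int (i + l)"
    have fin: "finite (Fi i)" "finite (Gl l)" using F G by (auto simp: Fi_def Gl_def)
    have card_le: "real (card (Fi i)) * real (card (Gl l)) \<le> (A i * B l) * 2 powr (- (s * p))"
    proof -
      have "real (card (Fi i)) * real (card (Gl l)) \<le> (A i * 2 powr (- (real_of_int i * p))) * (B l * 2 powr (- (real_of_int l * p)))"
        using AB0 by (intro mult_mono cF cG) auto
      also have "\<dots> = (A i * B l) * (2 powr (- (real_of_int i * p)) * 2 powr (- (real_of_int l * p)))" by simp
      also have "2 powr (- (real_of_int i * p)) * 2 powr (- (real_of_int l * p)) = 2 powr (- (s * p))"
        unfolding powr_add[symmetric] by (simp add: s_def algebra_simps)
      finally show ?thesis .
    qed
    have bound: "2 powr s * (K * N powr (2 - 2 / q) * (real (card (Fi i)) * real (card (Gl l))) powr (1 / q))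
        \<le> K * M * (sqrt (A i * B l) * (2 powr s * T) powr (1 - p / q))" if q: "0 < q" "q \<le> 2" for q
    proof -
      have "(real (card (Fi i)) * real (card (Gl l))) powr (1 / q) \<le> ((A i * B l) * 2 powr (- (s * p))) powr (1 / q)"
        using q by (intro powr_mono2 card_le) auto
      also have "\<dots> = (A i * B l) powr (1 / q) * 2 powr (- (s * p / q))" by (simp add: powr_mult powr_powr)
      \<comment> \<open>As \<open>A i * B l \<le> 1\<close>, the exponent \<open>1/2\<close> serves for both endpoints.\<close>
      also have "\<dots> \<le> sqrt (A i * B l) * 2 powr (- (s * p / q))"
      proof (rule mult_right_mono)
        have "A i * B l \<le> 1 * 1" using AB0 A1 B1 by (intro mult_mono) auto
        moreover have "1 / 2 \<le> 1 / q" using q by (simp add: field_simps)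
        ultimately have "(A i * B l) powr (1 / q) \<le> (A i * B l) powr (1 / 2)" using AB0 by (intro powr_mono') auto
        then show "(A i * B l) powr (1 / q) \<le> sqrt (A i * B l)" using AB0 by (simp add: powr_half_sqrt)
      qed simp
      finally have "2 powr s * (K * N powr (2 - 2 / q) * (real (card (Fi i)) * real (card (Gl l))) powr (1 / q))
          \<le> 2 powr s * (K * N powr (2 - 2 / q) * (sqrt (A i * B l) * 2 powr (- (s * p / q))))"
        using K by (intro mult_left_mono) auto
      also have "\<dots> = K * N powr (2 - 2 / q) * sqrt (A i * B l) * (2 powr s * 2 powr (- (s * p / q)))" by simp
      also have "2 powr s * 2 powr (- (s * p / q)) = (2 powr s) powr (1 - p / q)"
        unfolding powr_add[symmetric] powr_powr by (simp add: algebra_simps)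
      also have "K * N powr (2 - 2 / q) * sqrt (A i * B l) * (2 powr s) powr (1 - p / q)
          = K * M * (sqrt (A i * B l) * (2 powr s * T) powr (1 - p / q))"
      proof -
        have "2 - 2 / q = (2 - 2 / p) + 2 / p * (1 - p / q)" using p q by (simp add: field_simps)
        then have "N powr (2 - 2 / q) = M * T powr (1 - p / q)" by (simp only: M_def T_def powr_add powr_powr)
        then show ?thesis by (simp only: powr_mult mult_ac)
      qed
      finally show ?thesis .
    qed
    have "(\<Sum>x\<in>Fi i. \<Sum>y\<in>Gl l. k x y * a x * b y)
        \<le> (\<Sum>x\<in>Fi i. \<Sum>y\<in>Gl l. k x y * (2 * 2 powr real_of_int i) * (2 * 2 powr real_of_int l))"
    proof (intro sum_mono mult_mono mult_nonneg_nonneg k order_refl)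
      fix x y assume x: "x \<in> Fi i" and y: "y \<in> Gl l"
      show "a x \<le> 2 * 2 powr real_of_int i" using x F(2)[of x] floor_log2_bounds(2)[of "a x"] by (auto simp: Fi_def lv_def)
      show "b y \<le> 2 * 2 powr real_of_int l" using y G(2)[of y] floor_log2_bounds(2)[of "b y"] by (auto simp: Gl_def lw_def)
      show "0 \<le> a x" using x F(2)[of x] by (auto simp: Fi_def)
      show "0 \<le> b y" using y G(2)[of y] by (auto simp: Gl_def)
    qed auto
    also have "\<dots> = 4 * (2 powr s * (\<Sum>x\<in>Fi i. \<Sum>y\<in>Gl l. k x y))"
      unfolding sum_distrib_left by (intro sum.cong refl) (simp add: s_def powr_add)
    finally have le: "(\<Sum>x\<in>Fi i. \<Sum>y\<in>Gl l. k x y * a x * b y) \<le> 4 * (2 powr s * (\<Sum>x\<in>Fi i. \<Sum>y\<in>Gl l. k x y))" .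
    have b1: "2 powr s * (\<Sum>x\<in>Fi i. \<Sum>y\<in>Gl l. k x y) \<le> K * M * (sqrt (A i * B l) * (2 powr s * T) powr (1 - p / q1))"
      using p by (intro order_trans[OF mult_left_mono[OF R1[OF fin]] bound]) auto
    have b2: "2 powr s * (\<Sum>x\<in>Fi i. \<Sum>y\<in>Gl l. k x y) \<le> K * M * (sqrt (A i * B l) * (2 powr s * T) powr (1 - p / 2))"
      using p by (intro order_trans[OF mult_left_mono[OF R2[OF fin]] bound]) auto
    have "2 powr s * (\<Sum>x\<in>Fi i. \<Sum>y\<in>Gl l. k x y) \<le> K * M * (sqrt (A i * B l) * w (i + l))"
    proof (cases "(2 powr s * T) powr (1 - p / 2) \<le> (2 powr s * T) powr (- (p / q1 - 1))")
      case True
      then have "w (i + l) = (2 powr s * T) powr (1 - p / 2)" by (simp add: w_def s_def)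
      then show ?thesis using b2 by simp
    next
      case False
      then have "w (i + l) = (2 powr s * T) powr (1 - p / q1)" by (simp add: w_def s_def)
      then show ?thesis using b1 by simp
    qed
    then show ?thesis using le by linarith
  qed
  have "(\<Sum>x\<in>F. \<Sum>y\<in>G. k x y * a x * b y) = (\<Sum>i\<in>lv ` F. \<Sum>x\<in>Fi i. \<Sum>y\<in>G. k x y * a x * b y)"
    unfolding Fi_def by (rule sum.group[symmetric]) (use F in auto)
  also have "\<dots> = (\<Sum>i\<in>lv ` F. \<Sum>x\<in>Fi i. \<Sum>l\<in>lw ` G. \<Sum>y\<in>Gl l. k x y * a x * b y)"
    unfolding Gl_def by (intro sum.cong refl sum.group[symmetric]) (use G in auto)
  also have "\<dots> = (\<Sum>i\<in>lv ` F. \<Sum>l\<in>lw ` G. \<Sum>x\<in>Fi i. \<Sum>y\<in>Gl l. k x y * a x * b y)"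
    by (intro sum.cong refl sum.swap)
  also have "\<dots> \<le> (\<Sum>i\<in>lv ` F. \<Sum>l\<in>lw ` G. 4 * K * M * (sqrt (A i * B l) * w (i + l)))"
    by (intro sum_mono cell)
  also have "\<dots> = 4 * K * M * (\<Sum>i\<in>lv ` F. \<Sum>l\<in>lw ` G. sqrt (A i * B l) * w (i + l))"
    by (simp only: sum_distrib_left)
  also have "\<dots> \<le> 4 * K * M * W"
  proof (rule mult_left_mono)
    have row: "(\<Sum>l\<in>L. w (i + l)) \<le> W" if "finite L" for L i
    proof -
      have "(\<Sum>l\<in>L. w (i + l)) = (\<Sum>s\<in>(+) i ` L. w s)" by (simp add: sum.reindex inj_on_def)
      also have "\<dots> \<le> W" unfolding w_def using that by (intro W T) auto
      finally show ?thesis .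
    qed
    have W0: "W \<ge> 0" using row[of "{}"] by simp
    have "(\<Sum>i\<in>lv ` F. \<Sum>l\<in>lw ` G. sqrt (A i * B l) * w (i + l))
        \<le> (\<Sum>i\<in>lv ` F. \<Sum>l\<in>lw ` G. (A i / 2) * w (i + l) + (B l / 2) * w (i + l))"
    proof (intro sum_mono)
      fix i l
      have "sqrt (A i * B l) \<le> (A i + B l) / 2" using AB0 by (intro arith_geo_mean_sqrt)
      then have "sqrt (A i * B l) * w (i + l) \<le> (A i + B l) / 2 * w (i + l)" using w0 by (intro mult_right_mono)
      then show "sqrt (A i * B l) * w (i + l) \<le> (A i / 2) * w (i + l) + (B l / 2) * w (i + l)"
        by (simp add: add_divide_distrib distrib_right)
    qed
    also have "\<dots> = (\<Sum>i\<in>lv ` F. (A i / 2) * (\<Sum>l\<in>lw ` G. w (i + l))) + (\<Sum>l\<in>lw ` G. (B l / 2) * (\<Sum>i\<in>lv ` F. w (l + i)))"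
      unfolding sum.distrib sum_distrib_left by (subst (2) sum.swap) (simp add: add.commute)
    also have "\<dots> \<le> (\<Sum>i\<in>lv ` F. (A i / 2) * W) + (\<Sum>l\<in>lw ` G. (B l / 2) * W)"
      using AB0 F(1) G(1) by (intro add_mono sum_mono mult_left_mono row) auto
    also have "\<dots> = (W / 2) * (\<Sum>i\<in>lv ` F. A i) + (W / 2) * (\<Sum>l\<in>lw ` G. B l)"
      by (simp add: sum_distrib_left sum_divide_distrib mult_ac)
    also have "\<dots> \<le> (W / 2) * 1 + (W / 2) * 1"
      using W0 A_sum B_sum by (intro add_mono mult_left_mono) auto
    finally show "(\<Sum>i\<in>lv ` F. \<Sum>l\<in>lw ` G. sqrt (A i * B l) * w (i + l)) \<le> W" by simp
  qed (use K in \<open>auto simp: M_def\<close>)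
  finally show ?thesis by (simp add: M_def mult_ac)
qed

text \<open>Dyadic levels exist only for positive values, hence the restriction to the supports F'
  and G'; homogeneity reduces the rest to norms at most 1.\<close>

lemma restricted_to_strong:
  fixes k :: "'a \<Rightarrow> 'b \<Rightarrow> real"
  assumes k: "\<And>x y. k x y \<ge> 0" and p: "0 < q1" "q1 < p" "p < 2" and N: "N > 0" and K: "K \<ge> 0"
    and R1: "\<And>F G. finite F \<Longrightarrow> finite G \<Longrightarrow> (\<Sum>x\<in>F. \<Sum>y\<in>G. k x y) \<le> K * N powr (2 - 2 / q1) * (real (card F) * real (card G)) powr (1 / q1)"
    and R2: "\<And>F G. finite F \<Longrightarrow> finite G \<Longrightarrow> (\<Sum>x\<in>F. \<Sum>y\<in>G. k x y) \<le> K * N powr (2 - 2 / 2) * (real (card F) * real (card G)) powr (1 / 2)"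
    and W: "\<And>T A. T > 0 \<Longrightarrow> finite A \<Longrightarrow>
      (\<Sum>s\<in>A. min ((2 powr real_of_int s * T) powr (1 - p / 2)) ((2 powr real_of_int s * T) powr (- (p / q1 - 1)))) \<le> W"
    and F: "finite F" "\<And>x. a x \<ge> 0" and G: "finite G" "\<And>y. b y \<ge> 0"
  shows "(\<Sum>x\<in>F. \<Sum>y\<in>G. k x y * a x * b y)
    \<le> 4 * K * W * N powr (2 - 2 / p) * (\<Sum>x\<in>F. a x powr p) powr (1 / p) * (\<Sum>y\<in>G. b y powr p) powr (1 / p)"
proof -
  define \<alpha> where "\<alpha> = (\<Sum>x\<in>F. a x powr p) powr (1 / p)"
  define \<beta> where "\<beta> = (\<Sum>y\<in>G. b y powr p) powr (1 / p)"
  define F' where "F' = {x \<in> F. a x > 0}"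
  define G' where "G' = {y \<in> G. b y > 0}"
  have p0: "p > 0" using p by simp
  have supp: "(\<Sum>x\<in>F. \<Sum>y\<in>G. k x y * a x * b y) = (\<Sum>x\<in>F'. \<Sum>y\<in>G'. k x y * a x * b y)"
  proof -
    have z: "\<forall>x\<in>F - F'. a x = 0" unfolding F'_def using F(2) by (simp add: order_antisym not_less)
    have z': "\<forall>y\<in>G - G'. b y = 0" unfolding G'_def using G(2) by (simp add: order_antisym not_less)
    have sub: "F' \<subseteq> F" "G' \<subseteq> G" by (auto simp: F'_def G'_def)
    have "(\<Sum>x\<in>F. \<Sum>y\<in>G. k x y * a x * b y) = (\<Sum>x\<in>F'. \<Sum>y\<in>G. k x y * a x * b y)"
      by (rule sum.mono_neutral_right) (use F(1) z sub in auto)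
    also have "\<dots> = (\<Sum>x\<in>F'. \<Sum>y\<in>G'. k x y * a x * b y)"
      by (rule sum.cong[OF refl], rule sum.mono_neutral_right) (use G(1) z' sub in auto)
    finally show ?thesis .
  qed
  show ?thesis
  proof (cases "F' = {} \<or> G' = {}")
    case True
    have "W \<ge> 0" using W[of 1 "{}"] by simp
    then show ?thesis unfolding supp using True K by auto
  next
    case False

    have sa: "(\<Sum>x\<in>F. a x powr p) > 0" and sb: "(\<Sum>y\<in>G. b y powr p) > 0"
    proof -
      obtain x y where "x \<in> F" "a x > 0" "y \<in> G" "b y > 0" using False by (auto simp: F'_def G'_def)
      then show "(\<Sum>x\<in>F. a x powr p) > 0" "(\<Sum>y\<in>G. b y powr p) > 0"
        using F G by (auto intro!: sum_pos2[of F x] sum_pos2[of G y])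
    qed
    have \<alpha>\<beta>: "\<alpha> > 0" "\<beta> > 0" using sa sb by (auto simp: \<alpha>_def \<beta>_def)
    have \<alpha>p: "\<alpha> powr p = (\<Sum>x\<in>F. a x powr p)" and \<beta>p: "\<beta> powr p = (\<Sum>y\<in>G. b y powr p)"
      using sa sb p0 by (simp_all add: \<alpha>_def \<beta>_def powr_powr)
    have na: "(\<Sum>x\<in>F'. (a x / \<alpha>) powr p) \<le> 1"
    proof -
      have "(\<Sum>x\<in>F'. (a x / \<alpha>) powr p) \<le> (\<Sum>x\<in>F. (a x / \<alpha>) powr p)"
        using F by (intro sum_mono2) (auto simp: F'_def)
      also have "\<dots> = (\<Sum>x\<in>F. a x powr p) / \<alpha> powr p"
        using F \<alpha>\<beta> by (simp add: powr_divide sum_divide_distrib)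
      finally show ?thesis using sa by (simp add: \<alpha>p)
    qed
    have nb: "(\<Sum>y\<in>G'. (b y / \<beta>) powr p) \<le> 1"
    proof -
      have "(\<Sum>y\<in>G'. (b y / \<beta>) powr p) \<le> (\<Sum>y\<in>G. (b y / \<beta>) powr p)"
        using G by (intro sum_mono2) (auto simp: G'_def)
      also have "\<dots> = (\<Sum>y\<in>G. b y powr p) / \<beta> powr p"
        using G \<alpha>\<beta> by (simp add: powr_divide sum_divide_distrib)
      finally show ?thesis using sb by (simp add: \<beta>p)
    qed
    have "(\<Sum>x\<in>F'. \<Sum>y\<in>G'. k x y * (a x / \<alpha>) * (b y / \<beta>)) \<le> 4 * K * W * N powr (2 - 2 / p)"
      using F G \<alpha>\<beta>
      by (intro restricted_to_strong_normalized[OF k p N K R1 R2 W] na nb) (auto simp: F'_def G'_def)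
    moreover have "(\<Sum>x\<in>F'. \<Sum>y\<in>G'. k x y * (a x / \<alpha>) * (b y / \<beta>)) = (\<Sum>x\<in>F'. \<Sum>y\<in>G'. k x y * a x * b y) / (\<alpha> * \<beta>)"
      by (simp add: sum_divide_distrib)
    ultimately have "(\<Sum>x\<in>F'. \<Sum>y\<in>G'. k x y * a x * b y) \<le> 4 * K * W * N powr (2 - 2 / p) * (\<alpha> * \<beta>)"
      using \<alpha>\<beta> by (simp add: pos_divide_le_eq)
    then show ?thesis unfolding supp by (simp add: \<alpha>_def \<beta>_def mult.assoc)
  qed
qed

text \<open>At p = 2 there is no restricted bound with a larger exponent to interpolate with;
  Schur's test applies instead, as all row and column sums of the kernel are at most
  \<open>K * N\<close>. For p < 2 any q1 strictly between 1 and p would do, and the midpoint is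
  taken.\<close>

lemma mangoldt_strong_bound:
  fixes p :: real
  assumes p: "1 < p" "p \<le> 2"
  shows "\<exists>K>0. \<forall>N F G a b. 1 \<le> N \<longrightarrow> finite F \<longrightarrow> finite G \<longrightarrow> (\<forall>x. a x \<ge> 0) \<longrightarrow> (\<forall>y. b y \<ge> 0) \<longrightarrow>
    (\<Sum>x\<in>F. \<Sum>y\<in>G. mangoldt_kernel N (y - x) * a x * b y)
      \<le> K * N powr (2 - 2 / p) * (\<Sum>x\<in>F. a x powr p) powr (1 / p) * (\<Sum>y\<in>G. b y powr p) powr (1 / p)"
proof (cases "p = 2")
  case True
  obtain K where K: "K > 0" and K_all: "\<forall>N\<ge>1. (\<Sum>n\<in>gdisc 0 N. gauss_mangoldt n) \<le> K * N"
    using sum_mangoldt_le by blast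
  have "(\<Sum>x\<in>F. \<Sum>y\<in>G. mangoldt_kernel N (y - x) * a x * b y)
      \<le> K * N powr (2 - 2 / p) * (\<Sum>x\<in>F. a x powr p) powr (1 / p) * (\<Sum>y\<in>G. b y powr p) powr (1 / p)"
    if N: "1 \<le> N" and FG: "finite F" "finite G" and ab: "\<forall>x. a x \<ge> 0" "\<forall>y. b y \<ge> 0" for N F G a b
  proof -
    define \<kappa> where "\<kappa> = mangoldt_kernel N"
    have \<kappa>0: "\<kappa> n \<ge> 0" for n by (simp add: \<kappa>_def mangoldt_kernel_nonneg)
    have tot: "(\<Sum>n\<in>S. \<kappa> n) \<le> K * N" if "finite S" for S
    proof -
      have "(\<Sum>n\<in>S. \<kappa> n) = (\<Sum>n\<in>S \<inter> gdisc 0 N. gauss_mangoldt n)"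
        using that unfolding \<kappa>_def mangoldt_kernel_def
        by (intro sum.mono_neutral_cong_right) (auto simp: gdisc_def)
      also have "\<dots> \<le> (\<Sum>n\<in>gdisc 0 N. gauss_mangoldt n)"
        by (intro sum_mono2) (auto simp: gauss_mangoldt_nonneg)
      also have "\<dots> \<le> K * N" using K_all N by blast
      finally show ?thesis .
    qed
    have row: "(\<Sum>y\<in>G. \<kappa> (y - x)) \<le> K * N" for x
      using tot[of "(\<lambda>y. y - x) ` G"] FG by (simp add: sum.reindex inj_on_def)
    have col: "(\<Sum>x\<in>F. \<kappa> (y - x)) \<le> K * N" for y
      using tot[of "(\<lambda>x. y - x) ` F"] FG by (simp add: sum.reindex inj_on_def)
    have pw: "t powr p = t\<^sup>2" if "t \<ge> 0" for t :: real
      using True that by simp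
    \<comment> \<open>Schur's test: the kernel is split into two square roots, one for a and one for
      b, so that Cauchy-Schwarz produces row sums and column sums.\<close>
    have "(\<Sum>x\<in>F. \<Sum>y\<in>G. \<kappa> (y - x) * a x * b y)
        = (\<Sum>(x, y)\<in>F \<times> G. (sqrt (\<kappa> (y - x)) * a x) * (sqrt (\<kappa> (y - x)) * b y))"
      unfolding sum.cartesian_product by (intro sum.cong refl) (auto simp: \<kappa>0 mult_ac simp flip: real_sqrt_mult_self power2_eq_square)
    also have "\<dots> \<le> sqrt ((\<Sum>(x, y)\<in>F \<times> G. (sqrt (\<kappa> (y - x)) * a x)\<^sup>2) * (\<Sum>(x, y)\<in>F \<times> G. (sqrt (\<kappa> (y - x)) * b y)\<^sup>2))"
      unfolding split_def by (intro real_le_rsqrt Cauchy_Schwarz_ineq_sum)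
    also have "\<dots> \<le> sqrt ((K * N * (\<Sum>x\<in>F. a x powr p)) * (K * N * (\<Sum>y\<in>G. b y powr p)))"
    proof (intro real_sqrt_le_mono mult_mono)
      have "(\<Sum>(x, y)\<in>F \<times> G. (sqrt (\<kappa> (y - x)) * a x)\<^sup>2) = (\<Sum>x\<in>F. (\<Sum>y\<in>G. \<kappa> (y - x)) * (a x)\<^sup>2)"
        by (simp add: sum.cartesian_product[symmetric] power_mult_distrib \<kappa>0 sum_distrib_right)
      also have "\<dots> \<le> (\<Sum>x\<in>F. K * N * (a x)\<^sup>2)" by (intro sum_mono mult_right_mono row) auto
      finally show "(\<Sum>(x, y)\<in>F \<times> G. (sqrt (\<kappa> (y - x)) * a x)\<^sup>2) \<le> K * N * (\<Sum>x\<in>F. a x powr p)"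
        using ab pw by (simp add: sum_distrib_left)
      have "(\<Sum>(x, y)\<in>F \<times> G. (sqrt (\<kappa> (y - x)) * b y)\<^sup>2) = (\<Sum>y\<in>G. (\<Sum>x\<in>F. \<kappa> (y - x)) * (b y)\<^sup>2)"
        by (simp add: sum.cartesian_product[symmetric] power_mult_distrib \<kappa>0 sum_distrib_right) (rule sum.swap)
      also have "\<dots> \<le> (\<Sum>y\<in>G. K * N * (b y)\<^sup>2)" by (intro sum_mono mult_right_mono col) auto
      finally show "(\<Sum>(x, y)\<in>F \<times> G. (sqrt (\<kappa> (y - x)) * b y)\<^sup>2) \<le> K * N * (\<Sum>y\<in>G. b y powr p)"
        using ab pw by (simp add: sum_distrib_left)
    qed (use K N in \<open>auto intro!: sum_nonneg mult_nonneg_nonneg\<close>)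
    also have "\<dots> = sqrt ((K * N)\<^sup>2 * ((\<Sum>x\<in>F. a x powr p) * (\<Sum>y\<in>G. b y powr p)))"
      by (simp add: power2_eq_square mult_ac)
    also have "\<dots> = K * N * (sqrt (\<Sum>x\<in>F. a x powr p) * sqrt (\<Sum>y\<in>G. b y powr p))"
      using K N by (simp add: real_sqrt_mult)
    also have "\<dots> = K * N powr (2 - 2 / p) * (\<Sum>x\<in>F. a x powr p) powr (1 / p) * (\<Sum>y\<in>G. b y powr p) powr (1 / p)"
      using N unfolding True by (simp add: powr_half_sqrt sum_nonneg)
    finally show ?thesis by (simp add: \<kappa>_def)
  qed
  then show ?thesis using K by blast
next
  case False
  define q1 where "q1 = (1 + p) / 2"
  have q1: "1 < q1" "q1 < p" "q1 \<le> 2" and p2: "p < 2" using p False by (auto simp: q1_def)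
  obtain K1 where K1: "K1 > 0" and K1_all: "\<forall>N F G. 1 \<le> N \<longrightarrow> finite F \<longrightarrow> finite G \<longrightarrow>
    (\<Sum>x\<in>F. \<Sum>y\<in>G. mangoldt_kernel N (y - x)) \<le> K1 * N powr (2 - 2 / q1) * (real (card F) * real (card G)) powr (1 / q1)"
    using mangoldt_restricted_bound[OF q1(1,3)] by blast
  obtain K2 where K2: "K2 > 0" and K2_all: "\<forall>N F G. 1 \<le> N \<longrightarrow> finite F \<longrightarrow> finite G \<longrightarrow>
    (\<Sum>x\<in>F. \<Sum>y\<in>G. mangoldt_kernel N (y - x)) \<le> K2 * N powr (2 - 2 / 2) * (real (card F) * real (card G)) powr (1 / 2)"
    using mangoldt_restricted_bound[of 2] by auto
  have "1 - p / 2 > 0" "p / q1 - 1 > 0" using q1 p2 by auto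
  from two_sided_geometric_sum[OF this] obtain W where W: "W > 0" and W_all: "\<forall>T A. T > 0 \<longrightarrow> finite A \<longrightarrow>
    (\<Sum>s\<in>A. min ((2 powr real_of_int s * T) powr (1 - p / 2)) ((2 powr real_of_int s * T) powr (- (p / q1 - 1)))) \<le> W"
    by blast
  define K where "K = K1 + K2"
  have R1: "(\<Sum>x\<in>F. \<Sum>y\<in>G. mangoldt_kernel N (y - x)) \<le> K * N powr (2 - 2 / q1) * (real (card F) * real (card G)) powr (1 / q1)"
    if "1 \<le> N" "finite F" "finite G" for N F G
    using that K2 by (intro order_trans[OF K1_all[rule_format]] mult_right_mono) (auto simp: K_def)
  have R2: "(\<Sum>x\<in>F. \<Sum>y\<in>G. mangoldt_kernel N (y - x)) \<le> K * N powr (2 - 2 / 2) * (real (card F) * real (card G)) powr (1 / 2)"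
    if "1 \<le> N" "finite F" "finite G" for N F G
    using that K1 by (intro order_trans[OF K2_all[rule_format]] mult_right_mono) (auto simp: K_def)
  have "(\<Sum>x\<in>F. \<Sum>y\<in>G. mangoldt_kernel N (y - x) * a x * b y)
      \<le> 4 * K * W * N powr (2 - 2 / p) * (\<Sum>x\<in>F. a x powr p) powr (1 / p) * (\<Sum>y\<in>G. b y powr p) powr (1 / p)"
    if N: "1 \<le> N" and FG: "finite F" "finite G" and ab: "\<forall>x. a x \<ge> 0" "\<forall>y. b y \<ge> 0" for N F G a b
  proof (rule restricted_to_strong[where ?q1.0 = q1 and k = "\<lambda>x y. mangoldt_kernel N (y - x)"])
    show "0 < q1" "q1 < p" "p < 2" "N > 0" "K \<ge> 0" using q1 p2 N K1 K2 by (auto simp: K_def)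
    show "mangoldt_kernel N (y - x) \<ge> 0" for x y by (rule mangoldt_kernel_nonneg)
  qed (use R1 R2 N FG ab W_all in auto)
  moreover have "4 * K * W > 0" using K1 K2 W by (simp add: K_def)
  ultimately show ?thesis by blast
qed

section \<open>From the bilinear form to averages and norms\<close>

lemma gauss_disc_eq: "{n. gauss_norm n < int N} = gdisc 0 (real N)"
  by (auto simp: gdisc_def gnorm_def)

lemma norm_gauss_avg_le:
  assumes F: "finite F" "\<And>n. gnorm n < real N \<Longrightarrow> y - n \<in> F"
  shows "norm (gauss_avg N f y) \<le> 1 / real N * (\<Sum>x\<in>F. mangoldt_kernel (real N) (y - x) * norm (f x))"
proof -
  have "norm (gauss_avg N f y) = 1 / real N * norm (\<Sum>n\<in>gdisc 0 (real N). of_real (gauss_mangoldt n) * f (y - n))"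
    by (simp add: gauss_avg_def gauss_disc_eq norm_mult norm_divide)
  also have "\<dots> \<le> 1 / real N * (\<Sum>n\<in>gdisc 0 (real N). gauss_mangoldt n * norm (f (y - n)))"
    by (intro mult_left_mono order_trans[OF norm_sum sum_mono]) (auto simp: norm_mult gauss_mangoldt_nonneg)
  also have "(\<Sum>n\<in>gdisc 0 (real N). gauss_mangoldt n * norm (f (y - n)))
      = (\<Sum>x\<in>(\<lambda>n. y - n) ` gdisc 0 (real N). mangoldt_kernel (real N) (y - x) * norm (f x))"
    by (subst sum.reindex) (auto simp: inj_on_def mangoldt_kernel_def gdisc_def intro!: sum.cong)
  also have "1 / real N * \<dots> \<le> 1 / real N * (\<Sum>x\<in>F. mangoldt_kernel (real N) (y - x) * norm (f x))"
    using F by (intro mult_left_mono sum_mono2) (auto simp: gdisc_def mangoldt_kernel_nonneg)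
  finally show ?thesis .
qed

lemma finite_sum_powr_le_lp_norm:
  assumes "in_lp p f" "finite F" "p > 0"
  shows "(\<Sum>x\<in>F. norm (f x) powr p) powr (1 / p) \<le> lp_norm p f"
  unfolding lp_norm_def
proof (intro powr_mono2)
  show "(\<Sum>x\<in>F. norm (f x) powr p) \<le> (\<Sum>\<^sub>\<infinity>x. norm (f x) powr p)"
    using assms unfolding in_lp_def by (intro finite_sum_le_infsum) auto
qed (use assms in \<open>auto intro: sum_nonneg\<close>)

text \<open>Absolute values and a nonnegative test function b on a finite set serve both the
  absolute convergence of the pairing and the dual norm. The factor 1/N of the average lowers the
  exponent \<open>2 - 2 / p\<close> to \<open>1 - 2 / p\<close>.\<close>

lemma gauss_avg_pairing_bound:
  fixes p :: real
  assumes p: "1 < p" "p \<le> 2"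
  shows "\<exists>K>0. \<forall>N\<ge>1. \<forall>f G b. in_lp p f \<longrightarrow> finite G \<longrightarrow> (\<forall>y. b y \<ge> 0) \<longrightarrow>
    (\<Sum>y\<in>G. norm (gauss_avg N f y) * b y) \<le> K * real N powr (1 - 2 / p) * lp_norm p f * (\<Sum>y\<in>G. b y powr p) powr (1 / p)"
proof -
  obtain K where K: "K > 0" and K_all: "\<forall>N F G a b. 1 \<le> N \<longrightarrow> finite F \<longrightarrow> finite G \<longrightarrow> (\<forall>x. a x \<ge> 0) \<longrightarrow> (\<forall>y. b y \<ge> 0) \<longrightarrow>
    (\<Sum>x\<in>F. \<Sum>y\<in>G. mangoldt_kernel N (y - x) * a x * b y)
      \<le> K * N powr (2 - 2 / p) * (\<Sum>x\<in>F. a x powr p) powr (1 / p) * (\<Sum>y\<in>G. b y powr p) powr (1 / p)"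
    using mangoldt_strong_bound[OF p] by blast
  have "(\<Sum>y\<in>G. norm (gauss_avg N f y) * b y) \<le> K * real N powr (1 - 2 / p) * lp_norm p f * (\<Sum>y\<in>G. b y powr p) powr (1 / p)"
    if N: "N \<ge> 1" and f: "in_lp p f" and G: "finite G" and b: "\<forall>y. b y \<ge> 0" for N f G and b :: "gauss_int \<Rightarrow> real"
  proof -
    \<comment> \<open>F contains every point at which the averages over G read f. It is finite, so
      only finite parts of the norm of f occur.\<close>
    define F where "F = (\<Union>y\<in>G. (\<lambda>n. y - n) ` gdisc 0 (real N))"
    have F: "finite F" using G by (simp add: F_def)
    have N1: "1 \<le> real N" using N by simp
    have "(\<Sum>y\<in>G. norm (gauss_avg N f y) * b y)
        \<le> (\<Sum>y\<in>G. 1 / real N * (\<Sum>x\<in>F. mangoldt_kernel (real N) (y - x) * norm (f x)) * b y)"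
      using b F by (intro sum_mono mult_right_mono norm_gauss_avg_le) (auto simp: F_def gdisc_def)
    also have "\<dots> = 1 / real N * (\<Sum>y\<in>G. \<Sum>x\<in>F. mangoldt_kernel (real N) (y - x) * norm (f x) * b y)"
      by (simp add: sum_distrib_left sum_distrib_right mult_ac)
    also have "\<dots> = 1 / real N * (\<Sum>x\<in>F. \<Sum>y\<in>G. mangoldt_kernel (real N) (y - x) * norm (f x) * b y)"
      by (subst sum.swap) simp
    also have "\<dots> \<le> 1 / real N * (K * real N powr (2 - 2 / p) * (\<Sum>x\<in>F. norm (f x) powr p) powr (1 / p) * (\<Sum>y\<in>G. b y powr p) powr (1 / p))"
      using K_all N1 F G b by (intro mult_left_mono) auto
    also have "\<dots> \<le> 1 / real N * (K * real N powr (2 - 2 / p) * lp_norm p f * (\<Sum>y\<in>G. b y powr p) powr (1 / p))"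
      using K p by (intro mult_left_mono mult_right_mono finite_sum_powr_le_lp_norm f F) auto
    also have "\<dots> = K * (real N powr (2 - 2 / p) / real N) * lp_norm p f * (\<Sum>y\<in>G. b y powr p) powr (1 / p)"
      by simp
    also have "real N powr (2 - 2 / p) / real N = real N powr (1 - 2 / p)"
      using N1 powr_diff[of "real N" "2 - 2 / p" 1] by simp
    finally show ?thesis .
  qed
  then show ?thesis using K by blast
qed

lemma lp_norm_nonneg [simp]: "lp_norm p f \<ge> 0"
  by (simp add: lp_norm_def)

text \<open>A half-open interval of length s contains at most s + 1 integers, and this is at most 2s
  because s \<ge> 1.\<close>

lemma card_gauss_cube_le:
  assumes N: "N \<ge> 1"
  shows "real (card (gauss_cube c (sqrt (real N)))) \<le> 4 * real N"
proof -
  define s where "s = sqrt (real N)"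
  have s: "s \<ge> 1" using N by (simp add: s_def)
  define I where "I = (\<lambda>t::real. {\<lceil>t\<rceil>..<\<lceil>t + s\<rceil>})"
  have card_I: "real (card (I t)) \<le> 2 * s" for t
  proof -
    have "\<lceil>t\<rceil> \<le> \<lceil>t + s\<rceil>" using s by (intro ceiling_mono) auto
    then have "real (card (I t)) = real_of_int (\<lceil>t + s\<rceil> - \<lceil>t\<rceil>)" by (simp add: I_def)
    also have "\<dots> \<le> s + 1" by (simp; linarith)
    finally show ?thesis using s by linarith
  qed
  have sub: "gauss_cube c s \<subseteq> (\<lambda>(a, b). Gauss_Int a b) ` (I (Re c) \<times> I (Im c))"
  proof
    fix n assume "n \<in> gauss_cube c s"
    then have "(ReZ n, ImZ n) \<in> I (Re c) \<times> I (Im c)"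
      by (auto simp: gauss_cube_def I_def ceiling_le_iff less_ceiling_iff)
    then show "n \<in> (\<lambda>(a, b). Gauss_Int a b) ` (I (Re c) \<times> I (Im c))" by force
  qed
  have "card (gauss_cube c s) \<le> card ((\<lambda>(a, b). Gauss_Int a b) ` (I (Re c) \<times> I (Im c)))"
    by (rule card_mono[OF _ sub]) (simp add: I_def)
  also have "\<dots> \<le> card (I (Re c) \<times> I (Im c))" by (rule card_image_le) (simp add: I_def)
  finally have "real (card (gauss_cube c s)) \<le> real (card (I (Re c))) * real (card (I (Im c)))"
    unfolding of_nat_mult[symmetric] of_nat_le_iff by (simp only: card_cartesian_product)
  also have "\<dots> \<le> (2 * s) * (2 * s)" using s by (intro mult_mono card_I) auto
  also have "\<dots> = 4 * real N" by (simp add: s_def)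
  finally show ?thesis by (simp add: s_def)
qed

text \<open>Converse of Hoelder's inequality: the test function is the absolute value of the average
  to the power \<open>p' - 1\<close>, whose p-th power is the power p' since
  \<open>(p' - 1) * p = p'\<close>. As f is finitely supported so is its average, hence S is a
  finite sum and can be divided out.\<close>

lemma lp_norm_gauss_avg_le:
  fixes p p' :: real
  assumes p: "1 < p" and p': "1 / p + 1 / p' = 1" and Q: "finite Q" "\<And>x. x \<notin> Q \<Longrightarrow> f x = 0"
    and bound: "\<And>G b. finite G \<Longrightarrow> (\<forall>y. b y \<ge> 0) \<Longrightarrow>
      (\<Sum>y\<in>G. norm (gauss_avg N f y) * b y) \<le> c * (\<Sum>y\<in>G. b y powr p) powr (1 / p)" and c: "c \<ge> 0"
  shows "lp_norm p' (gauss_avg N f) \<le> c"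
proof -
  define P where "P = (\<Union>x\<in>Q. (\<lambda>n. x + n) ` gdisc 0 (real N))"
  define S where "S = (\<Sum>y\<in>P. norm (gauss_avg N f y) powr p')"
  have P: "finite P" using Q by (simp add: P_def)
  have inv: "1 / p' = 1 - 1 / p" using p' by simp
  have "1 / p' > 0" unfolding inv using p by simp
  then have p'0: "p' > 0" by simp
  have mult: "(p' - 1) * p = p'"
    using p' p p'0 by (simp add: field_simps)
  have zero: "gauss_avg N f y = 0" if "y \<notin> P" for y
  proof -
    have "f (y - n) = 0" if "n \<in> gdisc 0 (real N)" for n
    proof (rule ccontr)
      assume "f (y - n) \<noteq> 0"
      then have "y - n \<in> Q" using Q(2) by blast
      then have "(y - n) + n \<in> P" using that unfolding P_def by blast
      then show False using \<open>y \<notin> P\<close> by simp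
    qed
    then show ?thesis by (simp add: gauss_avg_def gauss_disc_eq)
  qed
  have "lp_norm p' (gauss_avg N f) = S powr (1 / p')"
  proof -
    have "(\<Sum>\<^sub>\<infinity>y. norm (gauss_avg N f y) powr p') = (\<Sum>\<^sub>\<infinity>y\<in>P. norm (gauss_avg N f y) powr p')"
      by (rule infsum_cong_neutral) (auto simp: zero)
    then show ?thesis using P by (simp add: lp_norm_def S_def)
  qed
  also have "S powr (1 / p') \<le> c"
  proof (cases "S = 0")
    case True
    then show ?thesis using c by simp
  next
    case False
    have "S \<ge> 0" unfolding S_def by (intro sum_nonneg) simp
    then have S: "S > 0" using False by simp
    have "S = (\<Sum>y\<in>P. norm (gauss_avg N f y) * norm (gauss_avg N f y) powr (p' - 1))"
      unfolding S_def
    proof (rule sum.cong[OF refl])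
      fix y
      show "norm (gauss_avg N f y) powr p' = norm (gauss_avg N f y) * norm (gauss_avg N f y) powr (p' - 1)"
        by (cases "gauss_avg N f y = 0") (auto simp: powr_diff)
    qed
    also have "\<dots> \<le> c * (\<Sum>y\<in>P. (norm (gauss_avg N f y) powr (p' - 1)) powr p) powr (1 / p)"
      by (rule bound[OF P]) simp
    also have "\<dots> = c * S powr (1 / p)" by (simp add: powr_powr mult S_def)
    finally have "S / S powr (1 / p) \<le> c" using S by (simp add: pos_divide_le_eq)
    also have "S / S powr (1 / p) = S powr (1 / p')"
      unfolding inv using S by (simp add: powr_diff)
    finally show ?thesis .
  qed
  finally show ?thesis .
qed

theorem theorem1p2:
  fixes p :: real
  assumes "1 < p" and "p \<le> 2"
  shows "(\<exists>C::real. \<forall>N::nat. N \<ge> 1 \<longrightarrow> (\<forall>f g. in_lp p f \<longrightarrow> in_lp p g \<longrightarrow>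
            norm (l2_inner (gauss_avg N f) g)
              \<le> C * real N powr (1 - 2 / p) * lp_norm p f * lp_norm p g))
       \<and> (\<exists>C::real. \<forall>N::nat. N \<ge> 1 \<longrightarrow> (\<forall>(p'::real) c Q f.
            1 / p + 1 / p' = 1 \<longrightarrow> Q = gauss_cube c (sqrt (real N)) \<longrightarrow> (\<forall>x. x \<notin> Q \<longrightarrow> f x = 0) \<longrightarrow>
            lp_norm p' (gauss_avg N f) / real (card Q) powr (1 / p')
              \<le> C * (lp_norm p f / real (card Q) powr (1 / p))))"
proof -
  obtain K where K: "K > 0" and K_all: "\<forall>N\<ge>1. \<forall>f G b. in_lp p f \<longrightarrow> finite G \<longrightarrow> (\<forall>y. b y \<ge> 0) \<longrightarrow>
    (\<Sum>y\<in>G. norm (gauss_avg N f y) * b y) \<le> K * real N powr (1 - 2 / p) * lp_norm p f * (\<Sum>y\<in>G. b y powr p) powr (1 / p)"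
    using gauss_avg_pairing_bound[OF assms] by blast
  have part1: "norm (l2_inner (gauss_avg N f) g) \<le> K * real N powr (1 - 2 / p) * lp_norm p f * lp_norm p g"
    if N: "N \<ge> 1" and f: "in_lp p f" and g: "in_lp p g" for N f g
  proof -
    define h where "h = (\<lambda>y. gauss_avg N f y * cnj (g y))"
    define B where "B = K * real N powr (1 - 2 / p) * lp_norm p f * lp_norm p g"
    have fin: "(\<Sum>y\<in>G. norm (h y)) \<le> B" if G: "finite G" for G
    proof -
      have "(\<Sum>y\<in>G. norm (h y)) = (\<Sum>y\<in>G. norm (gauss_avg N f y) * norm (g y))"
        by (simp add: h_def norm_mult)
      also have "\<dots> \<le> K * real N powr (1 - 2 / p) * lp_norm p f * (\<Sum>y\<in>G. norm (g y) powr p) powr (1 / p)"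
        using K_all N f G by simp
      also have "\<dots> \<le> B" unfolding B_def
        using K assms by (intro mult_left_mono finite_sum_powr_le_lp_norm g G) auto
      finally show ?thesis .
    qed
    \<comment> \<open>The uniform bound on finite partial sums gives the absolute convergence of the
      pairing.\<close>
    have summ: "(\<lambda>y. norm (h y)) summable_on UNIV"
      by (rule nonneg_bdd_above_summable_on) (auto intro!: bdd_aboveI2[of _ _ B] fin)
    have "norm (l2_inner (gauss_avg N f) g) \<le> (\<Sum>\<^sub>\<infinity>y. norm (h y))"
      unfolding l2_inner_def h_def[symmetric] by (rule norm_infsum_bound[OF summ])
    also have "\<dots> \<le> B" by (rule infsum_le_finite_sums[OF summ]) (auto intro: fin)
    finally show ?thesis by (simp add: B_def)
  qed
  have part2: "lp_norm p' (gauss_avg N f) / real (card Q) powr (1 / p')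
      \<le> (K * 4 powr (2 / p - 1)) * (lp_norm p f / real (card Q) powr (1 / p))"
    if N: "N \<ge> 1" and p': "1 / p + 1 / p' = 1" and Q: "Q = gauss_cube c (sqrt (real N))" and supp: "\<forall>x. x \<notin> Q \<longrightarrow> f x = 0"
    for N p' c Q f
  \<comment> \<open>If Q were empty both denominators would be 0, and division by zero makes both
    sides 0.\<close>
  proof (cases "card Q = 0")
    case False
    have finQ: "finite Q" unfolding Q by (rule finite_gauss_cube)
    have "(\<lambda>x. norm (f x) powr p) summable_on Q" using finQ by (rule summable_on_finite)
    then have f: "in_lp p f"
      unfolding in_lp_def by (rule summable_on_cong_neutral[THEN iffD1, rotated -1]) (use supp in auto)
    define M where "M = K * real N powr (1 - 2 / p) * lp_norm p f"
    have "lp_norm p' (gauss_avg N f) \<le> M"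
      using assms(1) p' finQ
    proof (rule lp_norm_gauss_avg_le)
      show "f x = 0" if "x \<notin> Q" for x using supp that by blast
      show "(\<Sum>y\<in>G. norm (gauss_avg N f y) * b y) \<le> M * (\<Sum>y\<in>G. b y powr p) powr (1 / p)"
        if "finite G" "\<forall>y. 0 \<le> b y" for G b
        unfolding M_def using K_all N f that by blast
      show "M \<ge> 0" using K by (simp add: M_def)
    qed
    then have "lp_norm p' (gauss_avg N f) / real (card Q) powr (1 / p') \<le> M / real (card Q) powr (1 / p')"
      by (intro divide_right_mono) auto
    \<comment> \<open>Since \<open>1 / p' = 1 / p - (2 / p - 1)\<close>, the size of Q enters
      through the nonnegative exponent \<open>2 / p - 1\<close>. The upper bound
      \<open>4 * N\<close> for it then cancels the power of N and leaves
      \<open>4 powr (2 / p - 1)\<close>.\<close>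
    also have "\<dots> = K * (lp_norm p f / real (card Q) powr (1 / p)) * (real N powr (1 - 2 / p) * real (card Q) powr (2 / p - 1))"
    proof -
      have "1 / p' = 1 / p - (2 / p - 1)" using p' by (simp add: field_simps)
      then have "real (card Q) powr (1 / p') = real (card Q) powr (1 / p) / real (card Q) powr (2 / p - 1)"
        by (simp only: powr_diff)
      then show ?thesis by (simp add: M_def)
    qed
    also have "\<dots> \<le> K * (lp_norm p f / real (card Q) powr (1 / p)) * 4 powr (2 / p - 1)"
    proof (rule mult_left_mono)
      have "0 \<le> 2 / p - 1" using assms by (simp add: field_simps)
      then have "real (card Q) powr (2 / p - 1) \<le> (4 * real N) powr (2 / p - 1)"
        unfolding Q by (intro powr_mono2 card_gauss_cube_le N) auto
      then have "real N powr (1 - 2 / p) * real (card Q) powr (2 / p - 1) \<le> real N powr (1 - 2 / p) * (4 * real N) powr (2 / p - 1)"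
        by (intro mult_left_mono) auto
      also have "\<dots> = 4 powr (2 / p - 1) * (real N powr (1 - 2 / p) * real N powr (2 / p - 1))"
        by (simp add: powr_mult)
      also have "real N powr (1 - 2 / p) * real N powr (2 / p - 1) = 1"
        unfolding powr_add[symmetric] using N by simp
      finally show "real N powr (1 - 2 / p) * real (card Q) powr (2 / p - 1) \<le> 4 powr (2 / p - 1)" by simp
    qed (use K in auto)
    finally show ?thesis by (simp add: mult_ac)
  qed simp
  show ?thesis
    by (intro conjI exI allI impI) (erule (2) part1, erule (3) part2)
qed

end
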